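(* Let $T>0$ and let $h_0\in D(\partial\phi)$ with $\phi(h_0)<+\infty$. Let $h:[0,+\infty)\to H$ be the unique curve among all locally absolutely continuous curves with $\lim_{t\to0}h(t)=h_0$ in $H$ satisfying $$\frac12\frac{\mathrm d}{\mathrm dt}\|h(t)-v\|^2+\frac{\lambda}{2}\|h(t)-v\|^2\le \phi(v)-\phi(h(t))\qquad\text{for a.e. }t>0,\ \forall v\in D(\phi).$$ Then $h$ is a global strong solution, in the sense that $$\partial_t h=-\partial\phi(h)=-\partial_{xx}\big(\sinh(h_{xx})\big)\quad\text{holds for all }t\ge 0,$$ with the regularity $$h\in C([0,T];D(\partial\phi))\cap C^1([0,T];H),$$ and the decay estimates $$\|h(t)\|\le\|h_0\|,\quad\forall t\ge0,\qquad \|\partial_t h(t)\|=\|\partial\phi(h(t))\|\le e^{-\lambda t}\|\partial\phi(h_0)\|,\quad\forall t\ge0.$$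
   Context: $\mathbb T$ is the unit interval with periodic boundary conditions (endpoints identified). $H=\{u\in L^2(\mathbb T):\int_{\mathbb T}u\,\mathrm dx=0\}$ with the $L^2$-norm $\|\cdot\|$, and $V=\{u\in H^2(\mathbb T):\int_{\mathbb T}u\,\mathrm dx=0\}$ with the $H^2$-norm. The functional $\phi:H\to[0,+\infty]$ is $$\phi(h)=\int_{\mathbb T}\cosh(h_{xx})\,\mathrm dx\ \text{ if }h\in V,\qquad \phi(h)=+\infty\ \text{ otherwise},$$ and $D(\phi)=\{\phi<+\infty\}$. The constant is $\lambda=(2\pi)^4$ (in general $\lambda=(2\pi/L)^4$ for period $L$; here $L=1$). $\partial\phi$ is the (convex-analysis) subdifferential of $\phi$ in $H$, with domain $D(\partial\phi)=\{v\in D(\phi):\partial\phi(v)\ne\emptyset\}$; here it is single-valued, equal to $\partial\phi(h)=(\sinh(h_{xx}))_{xx}$ (second derivative in the distributional sense), and $D(\partial\phi)=\{h\in V:(\sinh(h_{xx}))_{xx}\in H\}$. $h\in C([0,T];D(\partial\phi))$ means that $h(t)\in D(\partial\phi)$ for all $t\in[0,T]$ and that $t\mapsto h(t)$ and $t\mapsto\partial\phi(h(t))$ are continuous from $[0,T]$ to $H$. "Locally absolutely continuous" means absolutely continuous on compact subintervals of $(0,+\infty)$ with values in $H$. At $t=0$, $\partial_t h$ is the one-sided derivative. *)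

theory Defs
  imports "HOL-Analysis.Analysis"
begin

section \<open>The Hilbert space of mean-zero square integrable functions on the torus\<close>

text \<open>
  The endpoints of the unit interval are a null set, so identifying them does not change the
  measure space. Periodicity enters through the test functions used for weak derivatives.
\<close>

definition torus :: "real measure" where
  "torus = lebesgue_on {0..1}"

definition L2_torus :: "(real \<Rightarrow> real) set" where
  "L2_torus = {f. f \<in> borel_measurable torus \<and> integrable torus (\<lambda>x. (f x)\<^sup>2)}"

definition H_carrier :: "(real \<Rightarrow> real) set" where
  "H_carrier = {f \<in> L2_torus. (\<integral>x. f x \<partial>torus) = 0}"

definition H_rel :: "(real \<Rightarrow> real) \<Rightarrow> (real \<Rightarrow> real) \<Rightarrow> bool" where
  "H_rel f g \<longleftrightarrow> f \<in> H_carrier \<and> g \<in> H_carrier \<and> (AE x in torus. f x = g x)"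

lemma finite_measure_torus: "finite_measure torus"
  unfolding torus_def by (rule finite_measure_lebesgue_on) (auto intro: lmeasurable_cbox)

lemma L2_mult_integrable:
  assumes "f \<in> L2_torus" "g \<in> L2_torus"
  shows "integrable torus (\<lambda>x. f x * g x)"
proof (rule Bochner_Integration.integrable_bound)
  show "integrable torus (\<lambda>x. (f x)\<^sup>2 + (g x)\<^sup>2)"
    using assms by (intro Bochner_Integration.integrable_add) (simp_all add: L2_torus_def)
  show "(\<lambda>x. f x * g x) \<in> borel_measurable torus"
    using assms by (intro borel_measurable_times) (simp_all add: L2_torus_def)
  have "norm (a * b) \<le> norm (a\<^sup>2 + b\<^sup>2)" for a b :: real
  proof -
    have "2 * (\<bar>a\<bar> * \<bar>b\<bar>) \<le> a\<^sup>2 + b\<^sup>2"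
      using sum_squares_bound[of "\<bar>a\<bar>" "\<bar>b\<bar>"] unfolding power2_abs mult.assoc .
    moreover have "0 \<le> \<bar>a\<bar> * \<bar>b\<bar>"
      by (intro mult_nonneg_nonneg abs_ge_zero)
    ultimately have "\<bar>a\<bar> * \<bar>b\<bar> \<le> a\<^sup>2 + b\<^sup>2"
      by linarith
    then show ?thesis
      unfolding real_norm_def abs_mult by linarith
  qed
  then show "AE x in torus. norm (f x * g x) \<le> norm ((f x)\<^sup>2 + (g x)\<^sup>2)"
    by (intro AE_I2)
qed

lemma L2_integrable: "f \<in> L2_torus \<Longrightarrow> integrable torus f"
  unfolding L2_torus_def
  by (elim CollectE conjE) (rule finite_measure.square_integrable_imp_integrable[OF finite_measure_torus])

lemma L2_add: "f \<in> L2_torus \<Longrightarrow> g \<in> L2_torus \<Longrightarrow> (\<lambda>x. f x + g x) \<in> L2_torus"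
proof -
  assume fg: "f \<in> L2_torus" "g \<in> L2_torus"
  have "integrable torus (\<lambda>x. (f x)\<^sup>2 + (g x)\<^sup>2 + 2 * (f x * g x))"
    using fg L2_mult_integrable[OF fg]
    by (intro Bochner_Integration.integrable_add integrable_mult_right) (auto simp: L2_torus_def)
  moreover have "(\<lambda>x. (f x)\<^sup>2 + (g x)\<^sup>2 + 2 * (f x * g x)) = (\<lambda>x. (f x + g x)\<^sup>2)"
    by (simp add: power2_sum mult.assoc)
  moreover have "(\<lambda>x. f x + g x) \<in> borel_measurable torus"
    using fg by (intro borel_measurable_add) (auto simp: L2_torus_def)
  ultimately show ?thesis
    by (simp add: L2_torus_def)
qed

lemma L2_cmult: "f \<in> L2_torus \<Longrightarrow> (\<lambda>x. c * f x) \<in> L2_torus"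
  by (simp add: L2_torus_def power_mult_distrib borel_measurable_times)

lemma H_carrier_L2: "f \<in> H_carrier \<Longrightarrow> f \<in> L2_torus"
  by (simp add: H_carrier_def)

lemma H_carrier_zero: "(\<lambda>x. 0) \<in> H_carrier"
  by (simp add: H_carrier_def L2_torus_def)

lemma H_carrier_add: "f \<in> H_carrier \<Longrightarrow> g \<in> H_carrier \<Longrightarrow> (\<lambda>x. f x + g x) \<in> H_carrier"
  by (auto simp: H_carrier_def L2_add L2_integrable)

lemma H_carrier_cmult: "f \<in> H_carrier \<Longrightarrow> (\<lambda>x. c * f x) \<in> H_carrier"
  by (auto simp: H_carrier_def L2_cmult)

lemma H_carrier_minus: "f \<in> H_carrier \<Longrightarrow> (\<lambda>x. - f x) \<in> H_carrier"
  using H_carrier_cmult[of f "- 1"] by simp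

lemma H_carrier_diff: "f \<in> H_carrier \<Longrightarrow> g \<in> H_carrier \<Longrightarrow> (\<lambda>x. f x - g x) \<in> H_carrier"
  using H_carrier_add[of f "\<lambda>x. - g x"] H_carrier_minus[of g] by simp

lemma part_equivp_H_rel: "part_equivp H_rel"
proof (rule part_equivpI)
  show "\<exists>f. H_rel f f"
    using H_carrier_zero by (auto simp: H_rel_def)
  show "symp H_rel"
    by (auto simp: symp_def H_rel_def eq_commute)
  show "transp H_rel"
  proof (rule transpI)
    fix f g h assume fg: "H_rel f g" and gh: "H_rel g h"
    then have "AE x in torus. f x = g x" "AE x in torus. g x = h x"
      by (auto simp: H_rel_def)
    then have "AE x in torus. f x = h x"
      by (rule eventually_elim2) simp
    with fg gh show "H_rel f h"
      by (simp add: H_rel_def)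
  qed
qed

quotient_type H = "real \<Rightarrow> real" / partial: H_rel
  by (rule part_equivp_H_rel)

text \<open>
  For \<open>u :: H\<close>, the function \<open>rep_H u\<close> is a representative of the class \<open>u\<close>; any two
  representatives agree almost everywhere.
\<close>

lemma H_rel_rep: "H_rel (rep_H u) (rep_H u)"
  using Quotient3_rep_reflp[OF Quotient3_H] .

lemma rep_H_carrier: "rep_H u \<in> H_carrier"
  using H_rel_rep by (simp add: H_rel_def)

lemma rep_H_abs: "f \<in> H_carrier \<Longrightarrow> AE x in torus. rep_H (abs_H f) x = f x"
  using rep_abs_rsp_left[OF Quotient3_H, of f f] by (simp add: H_rel_def)

lemma abs_H_eqI:
  "f \<in> H_carrier \<Longrightarrow> g \<in> H_carrier \<Longrightarrow> (AE x in torus. f x = g x) \<Longrightarrow> abs_H f = abs_H g"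
  using Quotient3_rel_abs[OF Quotient3_H, of f g] by (simp add: H_rel_def)

instantiation H :: real_inner
begin

lift_definition zero_H :: H is "\<lambda>x. 0"
  by (simp add: H_rel_def H_carrier_zero)

lift_definition plus_H :: "H \<Rightarrow> H \<Rightarrow> H" is "\<lambda>f g x. f x + g x"
  unfolding H_rel_def by (auto intro!: H_carrier_add)

lift_definition minus_H :: "H \<Rightarrow> H \<Rightarrow> H" is "\<lambda>f g x. f x - g x"
  unfolding H_rel_def by (auto intro!: H_carrier_diff)

lift_definition uminus_H :: "H \<Rightarrow> H" is "\<lambda>f x. - f x"
  unfolding H_rel_def by (auto intro!: H_carrier_minus)

lift_definition scaleR_H :: "real \<Rightarrow> H \<Rightarrow> H" is "\<lambda>c f x. c * f x"
  unfolding H_rel_def by (auto intro!: H_carrier_cmult)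

lift_definition inner_H :: "H \<Rightarrow> H \<Rightarrow> real" is "\<lambda>f g. \<integral>x. f x * g x \<partial>torus"
proof -
  fix f f' g g' assume "H_rel f f'" "H_rel g g'"
  then have meas: "f \<in> borel_measurable torus" "f' \<in> borel_measurable torus"
      "g \<in> borel_measurable torus" "g' \<in> borel_measurable torus"
    and "AE x in torus. f x = f' x" "AE x in torus. g x = g' x"
    by (auto simp: H_rel_def H_carrier_def L2_torus_def)
  from this(5,6) have "AE x in torus. f x * g x = f' x * g' x"
    by (rule eventually_elim2) simp
  then show "(\<integral>x. f x * g x \<partial>torus) = (\<integral>x. f' x * g' x \<partial>torus)"
    using meas by (intro integral_cong_AE) auto
qed

definition norm_H :: "H \<Rightarrow> real" where
  "norm_H u = sqrt (inner u u)"

definition sgn_H :: "H \<Rightarrow> H" where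
  "sgn_H u = inverse (norm u) *\<^sub>R u"

definition dist_H :: "H \<Rightarrow> H \<Rightarrow> real" where
  "dist_H u v = norm (u - v)"

definition uniformity_H :: "(H \<times> H) filter" where
  "uniformity_H = (INF e\<in>{0<..}. principal {(u, v). dist u v < e})"

definition open_H :: "H set \<Rightarrow> bool" where
  "open_H U \<longleftrightarrow> (\<forall>u\<in>U. eventually (\<lambda>(u', v). u' = u \<longrightarrow> v \<in> U) uniformity)"

instance
proof
  fix a b :: real and u v w :: H and U :: "H set"
  show "u + v + w = u + (v + w)"
    by transfer (auto simp: H_rel_def H_carrier_add add.assoc)
  show "u + v = v + u"
    by transfer (auto simp: H_rel_def H_carrier_add add.commute)
  show "0 + u = u"
    by transfer (auto simp: H_rel_def)
  show "- u + u = 0"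
    by transfer (auto simp: H_rel_def H_carrier_zero)
  show "u - v = u + - v"
    by transfer (auto simp: H_rel_def H_carrier_add H_carrier_minus H_carrier_diff)
  show "a *\<^sub>R (u + v) = a *\<^sub>R u + a *\<^sub>R v"
    by transfer (auto simp: H_rel_def H_carrier_add H_carrier_cmult distrib_left)
  show "(a + b) *\<^sub>R u = a *\<^sub>R u + b *\<^sub>R u"
    by transfer (auto simp: H_rel_def H_carrier_add H_carrier_cmult distrib_right)
  show "a *\<^sub>R b *\<^sub>R u = (a * b) *\<^sub>R u"
    by transfer (auto simp: H_rel_def H_carrier_cmult mult.assoc)
  show "1 *\<^sub>R u = u"
    by transfer (auto simp: H_rel_def)
  show "sgn u = inverse (norm u) *\<^sub>R u"
    by (rule sgn_H_def)
  show "dist u v = norm (u - v)"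
    by (rule dist_H_def)
  show "(uniformity :: (H \<times> H) filter) = (INF e\<in>{0<..}. principal {(u, v). dist u v < e})"
    by (rule uniformity_H_def)
  show "open U \<longleftrightarrow> (\<forall>u\<in>U. eventually (\<lambda>(u', v). u' = u \<longrightarrow> v \<in> U) uniformity)"
    by (rule open_H_def)
  show "inner u v = inner v u"
    by transfer (simp add: mult.commute)
  show "inner (u + v) w = inner u w + inner v w"
    by transfer
       (auto simp: H_rel_def distrib_right H_carrier_L2 L2_mult_integrable)
  show "inner (a *\<^sub>R u) v = a * inner u v"
    by transfer (auto simp: mult.assoc)
  show "0 \<le> inner u u"
    by transfer (auto intro: integral_nonneg_AE)
  show "inner u u = 0 \<longleftrightarrow> u = 0"
  proof transfer
    fix f assume f: "H_rel f f"
    then have "integrable torus (\<lambda>x. f x * f x)"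
      by (simp add: H_rel_def H_carrier_L2 L2_mult_integrable)
    then have "(\<integral>x. f x * f x \<partial>torus) = 0 \<longleftrightarrow> (AE x in torus. f x * f x = 0)"
      by (intro integral_nonneg_eq_0_iff_AE) auto
    then show "(\<integral>x. f x * f x \<partial>torus) = 0 \<longleftrightarrow> H_rel f (\<lambda>x. 0)"
      using f by (simp add: H_rel_def H_carrier_zero)
  qed
  show "norm u = sqrt (inner u u)"
    by (rule norm_H_def)
qed

end


section \<open>Weak derivatives on the torus and the domain space\<close>

definition torus_test :: "(real \<Rightarrow> real) \<Rightarrow> bool" where
  "torus_test \<psi> \<longleftrightarrow>
     (\<forall>x. \<psi> (x + 1) = \<psi> x) \<and> (\<forall>k x. (deriv ^^ k) \<psi> differentiable at x)"

text \<open>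
  \<open>weak_deriv k f g\<close>: the distributional \<open>k\<close>-th derivative on the torus of the integrable
  function \<open>f\<close> is the integrable function \<open>g\<close>.
\<close>

definition weak_deriv :: "nat \<Rightarrow> (real \<Rightarrow> real) \<Rightarrow> (real \<Rightarrow> real) \<Rightarrow> bool" where
  "weak_deriv k f g \<longleftrightarrow> integrable torus f \<and> integrable torus g \<and>
     (\<forall>\<psi>. torus_test \<psi> \<longrightarrow>
        (\<integral>x. f x * (deriv ^^ k) \<psi> x \<partial>torus) = (-1) ^ k * (\<integral>x. g x * \<psi> x \<partial>torus))"

definition H2_torus :: "(real \<Rightarrow> real) set" where
  "H2_torus = {f \<in> L2_torus.
     (\<exists>g\<in>L2_torus. weak_deriv 1 f g) \<and> (\<exists>g\<in>L2_torus. weak_deriv 2 f g)}"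

text \<open>The mean-zero condition in \<open>V_space\<close> is part of the type \<open>H\<close>.\<close>

definition V_space :: "H set" where
  "V_space = {u. rep_H u \<in> H2_torus}"

text \<open>\<open>dxx u\<close> is meaningful for \<open>u \<in> V_space\<close>, and is then unique up to null sets.\<close>

definition dxx :: "H \<Rightarrow> real \<Rightarrow> real" where
  "dxx u = (SOME g. g \<in> L2_torus \<and> weak_deriv 2 (rep_H u) g)"


section \<open>The functional\<close>

definition \<phi> :: "H \<Rightarrow> ereal" where
  "\<phi> u = (if u \<in> V_space then enn2ereal (\<integral>\<^sup>+x. ennreal (cosh (dxx u x)) \<partial>torus) else \<infinity>)"

text \<open>
  \<open>(2\<pi>/L)^4\<close> for period \<open>L = 1\<close>: the best constant in \<open>lam * \<parallel>u\<parallel>\<^sup>2 \<le> \<parallel>u''\<parallel>\<^sup>2\<close>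
  for mean-zero \<open>u\<close>.
\<close>

definition lam :: real where
  "lam = (2 * pi) ^ 4"


section \<open>Subdifferentials and evolution variational inequalities\<close>

definition eff_domain :: "('a \<Rightarrow> ereal) \<Rightarrow> 'a set" where
  "eff_domain F = {v. F v < \<infinity>}"

definition subdiff :: "('a::real_inner \<Rightarrow> ereal) \<Rightarrow> 'a \<Rightarrow> 'a set" where
  "subdiff F u = {\<xi>. u \<in> eff_domain F \<and> (\<forall>v. F u + ereal (inner \<xi> (v - u)) \<le> F v)}"

definition subdiff_domain :: "('a::real_inner \<Rightarrow> ereal) \<Rightarrow> 'a set" where
  "subdiff_domain F = {v \<in> eff_domain F. subdiff F v \<noteq> {}}"

text \<open>
  The element of a single-valued subdifferential; statements using it should also assert
  \<open>subdiff F u = {subgrad F u}\<close>.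
\<close>

definition subgrad :: "('a::real_inner \<Rightarrow> ereal) \<Rightarrow> 'a \<Rightarrow> 'a" where
  "subgrad F u = (THE \<xi>. \<xi> \<in> subdiff F u)"

definition abs_cont_on :: "real \<Rightarrow> real \<Rightarrow> (real \<Rightarrow> 'a::real_normed_vector) \<Rightarrow> bool" where
  "abs_cont_on s t h \<longleftrightarrow>
     (\<forall>\<epsilon>>0. \<exists>\<delta>>0. \<forall>(n::nat) a b.
        (\<forall>i<n. s \<le> a i \<and> a i \<le> b i \<and> b i \<le> t) \<and>
        (\<forall>i<n. \<forall>j<n. i \<noteq> j \<longrightarrow> {a i<..<b i} \<inter> {a j<..<b j} = {}) \<and>
        (\<Sum>i<n. b i - a i) < \<delta> \<longrightarrow>
        (\<Sum>i<n. norm (h (b i) - h (a i))) < \<epsilon>)"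

definition loc_abs_cont :: "(real \<Rightarrow> 'a::real_normed_vector) \<Rightarrow> bool" where
  "loc_abs_cont h \<longleftrightarrow> (\<forall>s t. 0 < s \<and> s \<le> t \<longrightarrow> abs_cont_on s t h)"

text \<open>
  Curves on \<open>[0,\<infinity>)\<close> are functions on \<open>real\<close> whose values at negative times are irrelevant.
  At times with \<open>F (h t) = \<infinity>\<close> the right-hand side of the inequality is \<open>-\<infinity>\<close>, so the
  inequality forces \<open>F (h t) < \<infinity>\<close> almost everywhere.
\<close>

definition EVI_curve ::
  "('a::real_inner \<Rightarrow> ereal) \<Rightarrow> real \<Rightarrow> 'a \<Rightarrow> (real \<Rightarrow> 'a) \<Rightarrow> bool" where
  "EVI_curve F l h0 h \<longleftrightarrow>
     loc_abs_cont h \<and> h 0 = h0 \<and> (h \<longlongrightarrow> h0) (at_right 0) \<and>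
     (AE t in lebesgue. 0 < t \<longrightarrow> (\<forall>v\<in>eff_domain F.
        \<exists>D. ((\<lambda>s. (norm (h s - v))\<^sup>2) has_real_derivative D) (at t) \<and>
            ereal (1/2 * D + l/2 * (norm (h t - v))\<^sup>2) \<le> F v - F (h t)))"

definition C1_on_interval :: "real \<Rightarrow> (real \<Rightarrow> 'a::real_normed_vector) \<Rightarrow> bool" where
  "C1_on_interval T h \<longleftrightarrow>
     (\<exists>h'. (\<forall>t\<in>{0..T}. (h has_vector_derivative h' t) (at t within {0..T})) \<and>
           continuous_on {0..T} h')"

end

theory Submission
  imports Defs
begin

text \<open>
  Let \<open>K\<close> be the inverse of the second derivative on mean-zero functions (\<open>inv_dxx\<close> below), a bounded
  injective self-adjoint operator. Then \<open>\<phi> (K g) = \<integral> cosh g\<close>, and \<open>\<xi> \<in> \<partial>\<phi> (K g)\<close> holds iff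
  \<open>sinh g = c + K \<xi>\<close> for a constant \<open>c\<close>; in particular \<open>g\<close> is bounded by a multiple of \<open>\<parallel>\<xi>\<parallel>\<close>, and
  \<open>\<parallel>g\<^sub>1 - g\<^sub>2\<parallel>\<^sup>2 \<le> (\<xi>\<^sub>1 - \<xi>\<^sub>2, K g\<^sub>1 - K g\<^sub>2)\<close>.

  The variational inequality gives contraction at rate \<open>\<lambda>\<close>, so \<open>h\<close> is Lipschitz with constant
  \<open>e^{-\<lambda>t} \<parallel>\<partial>\<phi> (h\<^sub>0)\<parallel>\<close> from time \<open>t\<close> on. At almost every time this bounds the slope of \<open>\<phi>\<close>, hence
  (Riesz) the subgradient \<open>\<xi>\<close>, and since \<open>\<partial>\<phi>\<close> is closed, the bound holds at every time. The map
  \<open>t \<mapsto> \<xi> t\<close> is weakly continuous with nonincreasing norm, so it is strongly continuous from the right,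
  and \<open>h\<close> has right derivative \<open>- \<xi>\<close>.

  Continuity from the left is not part of the general theory. Here, if \<open>\<parallel>\<xi>\<parallel>\<^sup>2\<close> had a jump \<open>J\<close> at \<open>t\<close>, then
  \<open>(\<xi> s - \<xi> t, h s - h t) / (t - s)\<close> would tend to \<open>J\<close> as \<open>s\<close> increases to \<open>t\<close>, whereas boundedness of \<open>g\<close>
  controls this quotient by \<open>\<parallel>g s - g t\<parallel>\<^sup>2 / (t - s)\<close>, which is shown to tend to \<open>0\<close>.
\<close>

section \<open>Absolutely continuous functions with nonpositive derivative\<close>

definition nonoverlapping :: "real \<Rightarrow> real \<Rightarrow> 'i set \<Rightarrow> ('i \<Rightarrow> real) \<Rightarrow> ('i \<Rightarrow> real) \<Rightarrow> bool" where
  "nonoverlapping a b I l r \<longleftrightarrow> finite I \<and> (\<forall>i\<in>I. a \<le> l i \<and> l i \<le> r i \<and> r i \<le> b) \<and>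
     (\<forall>i\<in>I. \<forall>j\<in>I. i \<noteq> j \<longrightarrow> {l i<..<r i} \<inter> {l j<..<r j} = {})"

lemma abs_cont_onD_family:
  assumes u: "abs_cont_on a b u" and "\<epsilon> > 0"
  shows "\<exists>\<delta>>0. \<forall>(I :: 'i set) l r. nonoverlapping a b I l r \<and> (\<Sum>i\<in>I. r i - l i) < \<delta> \<longrightarrow>
    (\<Sum>i\<in>I. norm (u (r i) - u (l i))) < \<epsilon>"
proof -
  obtain \<delta> where "\<delta> > 0" and \<delta>: "\<forall>n l r. (\<forall>i<n. a \<le> l i \<and> l i \<le> r i \<and> r i \<le> b) \<and>
        (\<forall>i<n. \<forall>j<n. i \<noteq> j \<longrightarrow> {l i<..<r i} \<inter> {l j<..<r j} = {}) \<and>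
        (\<Sum>i<n. r i - l i) < \<delta> \<longrightarrow> (\<Sum>i<(n::nat). norm (u (r i) - u (l i))) < \<epsilon>"
    using u[unfolded abs_cont_on_def, rule_format, OF \<open>\<epsilon> > 0\<close>] by blast
  show ?thesis
  proof (intro exI[of _ \<delta>] conjI allI impI)
    fix I :: "'i set" and l r :: "'i \<Rightarrow> real"
    assume *: "nonoverlapping a b I l r \<and> (\<Sum>i\<in>I. r i - l i) < \<delta>"
    then have I: "finite I" and len: "(\<Sum>i\<in>I. r i - l i) < \<delta>"
      by (auto simp: nonoverlapping_def)
    obtain h where h: "bij_betw h {..<card I} I"
      using ex_bij_betw_nat_finite[OF I] by (auto simp: atLeast0LessThan)
    have hI: "h i \<in> I" if "i < card I" for i
      using h that by (auto simp: bij_betw_def)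
    have inj: "h i \<noteq> h j" if "i < card I" "j < card I" "i \<noteq> j" for i j
      using h that by (auto simp: bij_betw_def inj_on_def)
    have "(\<Sum>i<card I. r (h i) - l (h i)) < \<delta>"
      using len sum.reindex_bij_betw[OF h, of "\<lambda>i. r i - l i"] by simp
    then have "(\<Sum>i<card I. norm (u (r (h i)) - u (l (h i)))) < \<epsilon>"
      using * hI inj by (intro \<delta>[rule_format]) (simp add: nonoverlapping_def)
    then show "(\<Sum>i\<in>I. norm (u (r i) - u (l i))) < \<epsilon>"
      using sum.reindex_bij_betw[OF h, of "\<lambda>i. norm (u (r i) - u (l i))"] by simp
  qed (rule \<open>\<delta> > 0\<close>)
qed

lemma sum_lengths_le_measure:
  assumes "nonoverlapping a b I l r" "U \<in> lmeasurable"
    and "\<And>i. i \<in> I \<Longrightarrow> {l i<..<r i} \<subseteq> U"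
  shows "(\<Sum>i\<in>I. r i - l i) \<le> measure lebesgue U"
proof -
  have "(\<Sum>i\<in>I. r i - l i) = (\<Sum>i\<in>I. measure lebesgue {l i<..<r i})"
    using assms(1) by (intro sum.cong) (auto simp: measure_completion nonoverlapping_def)
  also have "\<dots> = measure lebesgue (\<Union>i\<in>I. {l i<..<r i})"
  proof (rule measure_finite_Union[symmetric])
    show "disjoint_family_on (\<lambda>i. {l i<..<r i}) I"
      using assms(1) by (auto simp: disjoint_family_on_def nonoverlapping_def)
    show "emeasure lebesgue {l i<..<r i} \<noteq> \<infinity>" if "i \<in> I" for i
      using that assms(1) by (auto simp: nonoverlapping_def)
  qed (use assms(1) in \<open>auto simp: nonoverlapping_def\<close>)
  also have "\<dots> \<le> measure lebesgue U"
    using assms by (intro measure_mono_fmeasurable) (auto simp: nonoverlapping_def)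
  finally show ?thesis .
qed

lemma abs_cont_on_variation_bound:
  assumes u: "abs_cont_on a b u" and "a \<le> b"
  shows "\<exists>C\<ge>0. \<forall>(I :: 'i set) l r. nonoverlapping a b I l r \<longrightarrow>
    (\<Sum>i\<in>I. norm (u (r i) - u (l i))) \<le> C"
proof -
  obtain \<delta> where "\<delta> > 0" and \<delta>: "\<forall>(I :: 'i set) l r. nonoverlapping a b I l r \<and>
      (\<Sum>i\<in>I. r i - l i) < \<delta> \<longrightarrow> (\<Sum>i\<in>I. norm (u (r i) - u (l i))) < 1"
    using abs_cont_onD_family[OF u zero_less_one] by blast
  obtain K :: nat where K: "(b - a) / \<delta> < real K"
    using reals_Archimedean2 by blast
  then have "K > 0"
    using \<open>a \<le> b\<close> \<open>\<delta> > 0\<close> by (cases K) (auto simp: divide_less_0_iff)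
  define g where "g k = a + real k * ((b - a) / K)" for k
  have g_step: "g (Suc k) - g k = (b - a) / K" for k
    by (simp add: g_def algebra_simps add_divide_distrib diff_divide_distrib)
  have gap: "(b - a) / K < \<delta>"
    using K \<open>K > 0\<close> \<open>\<delta> > 0\<close> by (simp add: field_simps)
  have g_mono: "g k \<le> g (Suc k)" for k
    using g_step[of k] \<open>a \<le> b\<close> \<open>K > 0\<close> by (metis diff_ge_0_iff_ge divide_nonneg_pos of_nat_0_less_iff)
  have g_a: "a \<le> g k" for k
    using \<open>a \<le> b\<close> by (simp add: g_def)
  have g_b: "g k \<le> b" if "k \<le> K" for k
  proof -
    have "real k * ((b - a) / K) \<le> real K * ((b - a) / K)"
      using that \<open>a \<le> b\<close> by (intro mult_right_mono) auto
    then show ?thesis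
      using \<open>K > 0\<close> by (simp add: g_def)
  qed
  have g0: "g 0 = a" and gK: "g K = b"
    using \<open>K > 0\<close> by (auto simp: g_def)
  define c where "c k x = max (g k) (min x (g (Suc k)))" for k x
  have tel: "u x - u a = (\<Sum>k<K. u (c k x) - u (g k))" if "a \<le> x" "x \<le> b" for x
  proof -
    have "u (c k x) - u (g k) = u (min x (g (Suc k))) - u (min x (g k))" for k
      using g_mono[of k] by (cases "x \<le> g k") (auto simp: c_def min_def max_def)
    then have "(\<Sum>k<K. u (c k x) - u (g k)) = (\<Sum>k<K. u (min x (g (Suc k))) - u (min x (g k)))"
      by simp
    also have "\<dots> = u (min x (g K)) - u (min x (g 0))"
      by (rule sum_lessThan_telescope)
    finally show ?thesis
      using that by (simp add: g0 gK)
  qed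
  show ?thesis
  proof (intro exI[of _ "real K"] conjI allI impI)
    fix I :: "'i set" and l r :: "'i \<Rightarrow> real"
    assume I: "nonoverlapping a b I l r"
    then have rng: "a \<le> l i \<and> l i \<le> r i \<and> r i \<le> b" if "i \<in> I" for i
      using that by (simp add: nonoverlapping_def)
    have piece: "(\<Sum>i\<in>I. norm (u (c k (r i)) - u (c k (l i)))) < 1" if "k < K" for k
    proof (rule \<delta>[rule_format], rule conjI)
      have sub: "{c k (l i)<..<c k (r i)} \<subseteq> {l i<..<r i} \<inter> {g k<..<g (Suc k)}" for i
        using g_mono[of k] by (auto simp: c_def)
      have d: "{c k (l i)<..<c k (r i)} \<inter> {c k (l j)<..<c k (r j)} = {}"
        if "i \<in> I" "j \<in> I" "i \<noteq> j" for i j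
        using sub[of i] sub[of j] I that unfolding nonoverlapping_def by blast
      have le: "c k (l i) \<le> c k (r i)" if "i \<in> I" for i
        using rng[OF that] by (auto simp: c_def)
      have bd: "a \<le> c k (l i) \<and> c k (l i) \<le> c k (r i) \<and> c k (r i) \<le> b" if "i \<in> I" for i
        using le[OF that] g_a[of k] g_b[of k] g_b[of "Suc k"] \<open>k < K\<close> by (auto simp: c_def)
      show *: "nonoverlapping a b I (\<lambda>i. c k (l i)) (\<lambda>i. c k (r i))"
        using I bd d by (simp add: nonoverlapping_def)
      have "(\<Sum>i\<in>I. c k (r i) - c k (l i)) \<le> measure lebesgue {g k<..<g (Suc k)}"
        by (rule sum_lengths_le_measure[OF *]) (simp, use sub in blast)
      also have "\<dots> < \<delta>"
        using gap g_step[of k] g_mono[of k] by (simp add: measure_completion)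
      finally show "(\<Sum>i\<in>I. c k (r i) - c k (l i)) < \<delta>" .
    qed
    have "(\<Sum>i\<in>I. norm (u (r i) - u (l i))) \<le> (\<Sum>i\<in>I. \<Sum>k<K. norm (u (c k (r i)) - u (c k (l i))))"
    proof (rule sum_mono)
      fix i assume "i \<in> I"
      then have "u (r i) - u (l i) = (\<Sum>k<K. u (c k (r i)) - u (g k)) - (\<Sum>k<K. u (c k (l i)) - u (g k))"
        using rng[of i] tel[of "r i"] tel[of "l i"] by (smt (verit, best) diff_diff_eq2 diff_add_cancel)
      also have "\<dots> = (\<Sum>k<K. u (c k (r i)) - u (c k (l i)))"
        by (simp flip: sum_subtractf)
      finally show "norm (u (r i) - u (l i)) \<le> (\<Sum>k<K. norm (u (c k (r i)) - u (c k (l i))))"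
        by (metis norm_sum)
    qed
    also have "\<dots> = (\<Sum>k<K. \<Sum>i\<in>I. norm (u (c k (r i)) - u (c k (l i))))"
      by (rule sum.swap)
    also have "\<dots> \<le> (\<Sum>k<K. 1)"
      using piece by (intro sum_mono) (auto intro: less_imp_le)
    finally show "(\<Sum>i\<in>I. norm (u (r i) - u (l i))) \<le> real K"
      by simp
  qed simp
qed

text \<open>
  The comparison function \<open>A\<close>, which may depend on \<open>x\<close>, together with the error measured by \<open>u\<close>
  allows for \<open>G t = \<parallel>v t - w t\<parallel>\<^sup>2\<close> with neither curve known to be differentiable anywhere:
  the mixed increments sum up to at most a small multiple of the variation of \<open>u\<close>.
\<close>

lemma abs_cont_on_nonincreasing:
  fixes G :: "real \<Rightarrow> real" and u :: "real \<Rightarrow> 'a::real_normed_vector"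
  assumes "a \<le> b" and u: "abs_cont_on a b u" and G: "abs_cont_on a b G"
    and deriv: "AE x in lebesgue. a < x \<and> x < b \<longrightarrow>
      (\<exists>A D. (A has_real_derivative D) (at x) \<and> D \<le> 0 \<and>
        (\<forall>\<epsilon>>0. \<forall>\<^sub>F s in nhds x. \<bar>G s - A s\<bar> \<le> \<epsilon> * norm (u s - u x)))"
  shows "G b \<le> G a"
proof (rule field_le_epsilon)
  fix e :: real assume "e > 0"
  define good where "good x \<longleftrightarrow> a < x \<and> x < b \<and>
      (\<exists>A D. (A has_real_derivative D) (at x) \<and> D \<le> 0 \<and>
        (\<forall>\<epsilon>>0. \<forall>\<^sub>F s in nhds x. \<bar>G s - A s\<bar> \<le> \<epsilon> * norm (u s - u x)))" for x
  obtain C where "C \<ge> 0" and C: "\<forall>(I :: (real \<times> real set) set) l r. nonoverlapping a b I l r \<longrightarrow>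
      (\<Sum>i\<in>I. norm (u (r i) - u (l i))) \<le> C"
    using abs_cont_on_variation_bound[OF u \<open>a \<le> b\<close>] by blast
  define \<epsilon> where "\<epsilon> = e / (2 * (b - a + 2 * C + 1))"
  have den: "b - a + 2 * C + 1 > 0"
    using \<open>a \<le> b\<close> \<open>C \<ge> 0\<close> by simp
  have "\<epsilon> > 0"
    using \<open>e > 0\<close> den by (simp add: \<epsilon>_def)
  obtain \<delta> where "\<delta> > 0" and \<delta>: "\<forall>(I :: (real \<times> real set) set) l r. nonoverlapping a b I l r \<and>
      (\<Sum>i\<in>I. r i - l i) < \<delta> \<longrightarrow> (\<Sum>i\<in>I. norm (G (r i) - G (l i))) < e / 2"
    using abs_cont_onD_family[OF G, of "e / 2"] \<open>e > 0\<close> by auto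
  define N where "N = {x. a \<le> x \<and> x \<le> b \<and> \<not> good x}"
  have "negligible N"
  proof -
    have "AE x in lebesgue. x \<notin> {a, b}"
      by (intro AE_not_in) (auto simp flip: negligible_iff_null_sets)
    with deriv have "AE x in lebesgue. x \<notin> N"
      by eventually_elim (auto simp: N_def good_def)
    then show ?thesis
      by (auto simp: negligible_iff_null_sets AE_iff_null_sets completion.AE_iff_null_sets)
  qed
  then have "N \<in> sets lebesgue"
    by (simp add: negligible_imp_sets)
  then obtain U where U: "open U" "N \<subseteq> U" "U - N \<in> lmeasurable"
      "emeasure lebesgue (U - N) < ennreal \<delta>"
    using sets_lebesgue_outer_open \<open>\<delta> > 0\<close> by metis
  have N_lm: "N \<in> lmeasurable"
    using \<open>negligible N\<close> by (simp add: negligible_imp_measurable)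
  have U_eq: "U = (U - N) \<union> N"
    using U(2) by blast
  have "U \<in> lmeasurable"
    by (subst U_eq) (intro fmeasurable.Un U(3) N_lm)
  have "measure lebesgue U = measure lebesgue (U - N)"
    using \<open>negligible N\<close> \<open>U \<in> lmeasurable\<close>
    by (metis measure_Diff_null_set negligible_iff_null_sets fmeasurableD)
  also have "\<dots> < \<delta>"
    using U(3,4) \<open>\<delta> > 0\<close> by (simp add: emeasure_eq_measure2 ennreal_less_iff)
  finally have mU: "measure lebesgue U < \<delta>" .
  have "\<exists>d>0. \<forall>l r. x - d < l \<and> l \<le> x \<and> x \<le> r \<and> r < x + d \<longrightarrow>
     G r - G l \<le> \<epsilon> * (r - l) + \<epsilon> * (norm (u r - u x) + norm (u x - u l))" if gx: "good x" for x
  proof -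
    obtain A D where A: "(A has_real_derivative D) (at x)" "D \<le> 0"
      and err: "\<forall>\<^sub>F s in nhds x. \<bar>G s - A s\<bar> \<le> \<epsilon> * norm (u s - u x)"
      using gx \<open>\<epsilon> > 0\<close> unfolding good_def by blast
    obtain d1 where "d1 > 0" and d1: "\<And>s. dist s x < d1 \<Longrightarrow> \<bar>G s - A s\<bar> \<le> \<epsilon> * norm (u s - u x)"
      using err unfolding eventually_nhds_metric by blast
    have "(A has_derivative (\<lambda>h. h * D)) (at x)"
      using A(1) by (simp add: has_field_derivative_def mult_commute_abs)
    then obtain d2 where "d2 > 0"
      and d2: "\<And>s. \<bar>s - x\<bar> < d2 \<Longrightarrow> \<bar>A s - A x - (s - x) * D\<bar> \<le> \<epsilon> * \<bar>s - x\<bar>"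
      using \<open>\<epsilon> > 0\<close> unfolding has_derivative_at_alt by (metis real_norm_def)
    show ?thesis
    proof (intro exI[of _ "min d1 d2"] conjI allI impI)
      fix l r assume "x - min d1 d2 < l \<and> l \<le> x \<and> x \<le> r \<and> r < x + min d1 d2"
      then have lr: "dist l x < d1" "dist r x < d1" "\<bar>l - x\<bar> < d2" "\<bar>r - x\<bar> < d2" "l \<le> x" "x \<le> r"
        by (auto simp: dist_real_def)
      have "(r - x) * D \<le> 0" "(l - x) * D \<ge> 0"
        using lr(5,6) A(2) by (auto simp: mult_le_0_iff zero_le_mult_iff)
      then show "G r - G l \<le> \<epsilon> * (r - l) + \<epsilon> * (norm (u r - u x) + norm (u x - u l))"
        using d1[OF lr(1)] d1[OF lr(2)] d2[OF lr(3)] d2[OF lr(4)] lr(5,6)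
        unfolding norm_minus_commute[of "u x" "u l"]
        by (simp add: algebra_simps abs_if split: if_splits)
    qed (use \<open>d1 > 0\<close> \<open>d2 > 0\<close> in auto)
  qed
  then obtain d where d_pos: "\<And>x. good x \<Longrightarrow> d x > 0"
    and d: "\<And>x l r. good x \<Longrightarrow> x - d x < l \<Longrightarrow> l \<le> x \<Longrightarrow> x \<le> r \<Longrightarrow> r < x + d x \<Longrightarrow>
     G r - G l \<le> \<epsilon> * (r - l) + \<epsilon> * (norm (u r - u x) + norm (u x - u l))"
    by metis
  define \<gamma> where "\<gamma> x = (if good x then ball x (d x) else if x \<in> N then U else ball x 1)" for x
  have "gauge \<gamma>"
    using d_pos U(1,2) by (auto simp: gauge_def \<gamma>_def)
  then obtain p where p: "p tagged_division_of {a..b}" "\<gamma> fine p"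
    by (rule fine_division_exists_real)
  note td = tagged_division_ofD[OF p(1)]
  have "finite p"
    by (rule td(1))
  have K: "\<exists>l r. K = {l..r} \<and> l \<le> x \<and> x \<le> r \<and> a \<le> l \<and> r \<le> b \<and> Inf K = l \<and> Sup K = r"
    if xK: "(x, K) \<in> p" for x K
  proof -
    obtain l r where "K = {l..r}"
      using td(4)[OF xK] by auto
    then show ?thesis
      using td(2)[OF xK] td(3)[OF xK] by auto
  qed
  define l r where "l i = Inf (snd i)" and "r i = Sup (snd i)" for i :: "real \<times> real set"
  have lr: "snd i = {l i..r i}" "l i \<le> fst i" "fst i \<le> r i" "a \<le> l i" "r i \<le> b" if "i \<in> p" for i
    using K[of "fst i" "snd i"] that by (auto simp: l_def r_def)
  have disj: "{l i<..<r i} \<inter> {l j<..<r j} = {}" if "i \<in> p" "j \<in> p" "i \<noteq> j" for i j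
  proof -
    have "interior (snd i) \<inter> interior (snd j) = {}"
      using td(5)[of "fst i" "snd i" "fst j" "snd j"] that by (metis prod.collapse)
    then show ?thesis
      by (simp only: lr(1)[OF that(1)] lr(1)[OF that(2)] interior_atLeastAtMost_real)
  qed
  have disj': "{l i<..<fst i} \<inter> {l j<..<fst j} = {}" "{fst i<..<r i} \<inter> {fst j<..<r j} = {}"
    if "i \<in> p" "j \<in> p" "i \<noteq> j" for i j
  proof -
    have "{l i<..<fst i} \<subseteq> {l i<..<r i}" "{l j<..<fst j} \<subseteq> {l j<..<r j}"
      "{fst i<..<r i} \<subseteq> {l i<..<r i}" "{fst j<..<r j} \<subseteq> {l j<..<r j}"
      using lr(2,3)[OF that(1)] lr(2,3)[OF that(2)] by auto
    then show "{l i<..<fst i} \<inter> {l j<..<fst j} = {}" "{fst i<..<r i} \<inter> {fst j<..<r j} = {}"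
      using disj[OF that] by blast+
  qed
  define p1 where "p1 = {i \<in> p. good (fst i)}"
  define p2 where "p2 = {i \<in> p. \<not> good (fst i)}"
  have fin: "finite p1" "finite p2" and split: "p = p1 \<union> p2" "p1 \<inter> p2 = {}"
    using \<open>finite p\<close> by (auto simp: p1_def p2_def)
  have sub: "i \<in> p" if "i \<in> p1 \<or> i \<in> p2" for i
    using that by (auto simp: p1_def p2_def)
  have no: "nonoverlapping a b q l r" "nonoverlapping a b q l fst" "nonoverlapping a b q fst r"
    if "q \<subseteq> p" for q
  proof -
    have "a \<le> l i \<and> l i \<le> fst i \<and> fst i \<le> r i \<and> r i \<le> b" if "i \<in> q" for i
      using lr(2-5)[of i] \<open>q \<subseteq> p\<close> that by auto
    moreover from this have "a \<le> fst i \<and> fst i \<le> b \<and> l i \<le> r i" if "i \<in> q" for i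
      using that by (meson order_trans)
    ultimately show "nonoverlapping a b q l r" "nonoverlapping a b q l fst" "nonoverlapping a b q fst r"
      using disj disj' that finite_subset[OF that \<open>finite p\<close>]
      unfolding nonoverlapping_def by (meson order_trans subsetD)+
  qed
  have subs: "p1 \<subseteq> p" "p2 \<subseteq> p"
    using sub by auto
  have "G b - G a = (\<Sum>(x, K)\<in>p. G (Sup K) - G (Inf K))"
    using additive_tagged_division_1[OF \<open>a \<le> b\<close> p(1), of G] by (rule sym)
  also have "\<dots> = (\<Sum>i\<in>p. G (r i) - G (l i))"
    by (simp add: l_def r_def case_prod_beta)
  also have "\<dots> = (\<Sum>i\<in>p1. G (r i) - G (l i)) + (\<Sum>i\<in>p2. G (r i) - G (l i))"
    unfolding split(1) using fin split(2) by (rule sum.union_disjoint)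
  also have "\<dots> \<le> e / 2 + e / 2"
  proof (rule add_mono)
    have "(\<Sum>i\<in>p1. G (r i) - G (l i)) \<le>
        (\<Sum>i\<in>p1. \<epsilon> * (r i - l i) + \<epsilon> * (norm (u (r i) - u (fst i)) + norm (u (fst i) - u (l i))))"
    proof (rule sum_mono)
      fix i assume "i \<in> p1"
      then have i: "i \<in> p" "good (fst i)"
        by (auto simp: p1_def)
      have "snd i \<subseteq> \<gamma> (fst i)"
        using p(2) i(1) by (metis fineD prod.collapse)
      then have "{l i..r i} \<subseteq> ball (fst i) (d (fst i))"
        using i lr(1)[OF i(1)] by (simp add: \<gamma>_def)
      moreover have "l i \<in> {l i..r i}" "r i \<in> {l i..r i}"
        using lr(2,3)[OF i(1)] by auto
      ultimately have "l i \<in> ball (fst i) (d (fst i))" "r i \<in> ball (fst i) (d (fst i))"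
        by blast+
      then have "fst i - d (fst i) < l i" "r i < fst i + d (fst i)"
        by (auto simp: dist_real_def)
      then show "G (r i) - G (l i) \<le> \<epsilon> * (r i - l i) + \<epsilon> * (norm (u (r i) - u (fst i)) + norm (u (fst i) - u (l i)))"
        using lr(2,3)[OF i(1)] i(2) by (intro d) auto
    qed
    also have "\<dots> = \<epsilon> * ((\<Sum>i\<in>p1. r i - l i) + (\<Sum>i\<in>p1. norm (u (r i) - u (fst i)))
        + (\<Sum>i\<in>p1. norm (u (fst i) - u (l i))))"
      by (simp add: sum.distrib distrib_left sum_distrib_left)
    also have "\<dots> \<le> \<epsilon> * ((b - a) + C + C)"
    proof (intro mult_left_mono add_mono)
      have "(\<Sum>i\<in>p1. r i - l i) \<le> measure lebesgue {a..b}"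
        using no(1)[OF subs(1)]
        by (rule sum_lengths_le_measure) (use no(1)[OF subs(1)] in \<open>fastforce simp: nonoverlapping_def\<close>)+
      then show "(\<Sum>i\<in>p1. r i - l i) \<le> b - a"
        using \<open>a \<le> b\<close> by (simp add: measure_completion)
      show "(\<Sum>i\<in>p1. norm (u (r i) - u (fst i))) \<le> C"
        "(\<Sum>i\<in>p1. norm (u (fst i) - u (l i))) \<le> C"
        using C no[OF subs(1)] by blast+
    qed (use \<open>\<epsilon> > 0\<close> in auto)
    also have "\<dots> \<le> e / 2"
    proof -
      have "\<epsilon> * ((b - a) + C + C) \<le> \<epsilon> * (b - a + 2 * C + 1)"
        using \<open>\<epsilon> > 0\<close> by (intro mult_left_mono) auto
      also have "\<dots> = e / 2"
        using den by (simp add: \<epsilon>_def field_simps)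
      finally show ?thesis .
    qed
    finally show "(\<Sum>i\<in>p1. G (r i) - G (l i)) \<le> e / 2" .
  next
    have "(\<Sum>i\<in>p2. G (r i) - G (l i)) \<le> (\<Sum>i\<in>p2. norm (G (r i) - G (l i)))"
      by (intro sum_mono) auto
    also have "\<dots> < e / 2"
    proof (rule \<delta>[rule_format], rule conjI[OF no(1)[OF subs(2)]])
      have "(\<Sum>i\<in>p2. r i - l i) \<le> measure lebesgue U"
      proof (rule sum_lengths_le_measure[OF no(1)[OF subs(2)] \<open>U \<in> lmeasurable\<close>])
        fix i assume "i \<in> p2"
        then have i: "i \<in> p" "\<not> good (fst i)"
          by (auto simp: p2_def)
        have "snd i \<subseteq> \<gamma> (fst i)"
          using p(2) i(1) by (metis fineD prod.collapse)
        moreover have "fst i \<in> N"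
          using lr(2-5)[OF i(1)] i(2) by (auto simp: N_def)
        ultimately have "snd i \<subseteq> U"
          using i(2) by (simp add: \<gamma>_def)
        then show "{l i<..<r i} \<subseteq> U"
          using lr(1)[OF i(1)] by fastforce
      qed
      then show "(\<Sum>i\<in>p2. r i - l i) < \<delta>"
        using mU by simp
    qed
    finally show "(\<Sum>i\<in>p2. G (r i) - G (l i)) \<le> e / 2"
      by simp
  qed
  finally show "G b \<le> G a + e"
    by simp
qed

section \<open>Evolution variational inequalities\<close>

lemma abs_cont_onI_family:
  assumes "\<And>\<epsilon>. \<epsilon> > 0 \<Longrightarrow> \<exists>\<delta>>0. \<forall>(I :: nat set) l r. nonoverlapping a b I l r \<and> (\<Sum>i\<in>I. r i - l i) < \<delta> \<longrightarrow>
    (\<Sum>i\<in>I. norm (u (r i) - u (l i))) < \<epsilon>"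
  shows "abs_cont_on a b u"
  unfolding abs_cont_on_def
proof (intro allI impI)
  fix \<epsilon> :: real assume "\<epsilon> > 0"
  then obtain \<delta> where "\<delta> > 0" and \<delta>: "\<forall>(I :: nat set) l r. nonoverlapping a b I l r \<and>
      (\<Sum>i\<in>I. r i - l i) < \<delta> \<longrightarrow> (\<Sum>i\<in>I. norm (u (r i) - u (l i))) < \<epsilon>"
    using assms by blast
  then show "\<exists>\<delta>>0. \<forall>(n::nat) l r. (\<forall>i<n. a \<le> l i \<and> l i \<le> r i \<and> r i \<le> b) \<and>
        (\<forall>i<n. \<forall>j<n. i \<noteq> j \<longrightarrow> {l i<..<r i} \<inter> {l j<..<r j} = {}) \<and>
        (\<Sum>i<n. r i - l i) < \<delta> \<longrightarrow> (\<Sum>i<n. norm (u (r i) - u (l i))) < \<epsilon>"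
    by (intro exI[of _ \<delta>]) (simp add: nonoverlapping_def)
qed

lemma abs_cont_on_dominated:
  fixes u :: "real \<Rightarrow> 'a::real_normed_vector" and v :: "real \<Rightarrow> 'b::real_normed_vector"
    and G :: "real \<Rightarrow> 'c::real_normed_vector"
  assumes u: "abs_cont_on a b u" and v: "abs_cont_on a b v" and "C \<ge> 0"
    and dom: "\<And>p q. a \<le> p \<Longrightarrow> p \<le> q \<Longrightarrow> q \<le> b \<Longrightarrow>
      norm (G q - G p) \<le> C * (norm (u q - u p) + norm (v q - v p) + (q - p))"
  shows "abs_cont_on a b G"
proof (rule abs_cont_onI_family)
  fix \<epsilon> :: real assume "\<epsilon> > 0"
  define e where "e = \<epsilon> / (3 * (C + 1))"
  have "e > 0"
    using \<open>\<epsilon> > 0\<close> \<open>C \<ge> 0\<close> by (simp add: e_def)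
  obtain \<delta>1 where "\<delta>1 > 0" and \<delta>1: "\<forall>(I :: nat set) l r. nonoverlapping a b I l r \<and>
      (\<Sum>i\<in>I. r i - l i) < \<delta>1 \<longrightarrow> (\<Sum>i\<in>I. norm (u (r i) - u (l i))) < e"
    using abs_cont_onD_family[OF u \<open>e > 0\<close>] by blast
  obtain \<delta>2 where "\<delta>2 > 0" and \<delta>2: "\<forall>(I :: nat set) l r. nonoverlapping a b I l r \<and>
      (\<Sum>i\<in>I. r i - l i) < \<delta>2 \<longrightarrow> (\<Sum>i\<in>I. norm (v (r i) - v (l i))) < e"
    using abs_cont_onD_family[OF v \<open>e > 0\<close>] by blast
  have "(\<Sum>i\<in>I. norm (G (r i) - G (l i))) < \<epsilon>"
    if I: "nonoverlapping a b I l r" and len: "(\<Sum>i\<in>I. r i - l i) < min e (min \<delta>1 \<delta>2)" for I :: "nat set" and l r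
  proof -
    have "(\<Sum>i\<in>I. norm (G (r i) - G (l i))) \<le>
        (\<Sum>i\<in>I. C * (norm (u (r i) - u (l i)) + norm (v (r i) - v (l i)) + (r i - l i)))"
      using I by (intro sum_mono dom) (auto simp: nonoverlapping_def)
    also have "\<dots> = C * ((\<Sum>i\<in>I. norm (u (r i) - u (l i))) + (\<Sum>i\<in>I. norm (v (r i) - v (l i)))
        + (\<Sum>i\<in>I. r i - l i))"
      by (simp only: sum.distrib distrib_left sum_distrib_left)
    also have "\<dots> \<le> C * (e + e + e)"
      using I len \<delta>1[rule_format, of I l r] \<delta>2[rule_format, of I l r] \<open>C \<ge> 0\<close>
      by (intro mult_left_mono add_mono) auto
    also have "\<dots> < (C + 1) * (3 * e)"
      using \<open>e > 0\<close> by (simp add: distrib_right)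
    also have "\<dots> = \<epsilon>"
      using \<open>C \<ge> 0\<close> unfolding e_def by (simp add: divide_simps del: distrib_left_numeral)
    finally show ?thesis .
  qed
  then show "\<exists>\<delta>>0. \<forall>(I :: nat set) l r. nonoverlapping a b I l r \<and> (\<Sum>i\<in>I. r i - l i) < \<delta> \<longrightarrow>
      (\<Sum>i\<in>I. norm (G (r i) - G (l i))) < \<epsilon>"
    using \<open>e > 0\<close> \<open>\<delta>1 > 0\<close> \<open>\<delta>2 > 0\<close> by (intro exI[of _ "min e (min \<delta>1 \<delta>2)"]) simp
qed

lemma abs_cont_on_bounded:
  assumes "abs_cont_on a b u" "a \<le> b"
  obtains B where "B \<ge> 0" "\<And>s. a \<le> s \<Longrightarrow> s \<le> b \<Longrightarrow> norm (u s) \<le> B"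
proof -
  obtain C where "C \<ge> 0" and C: "\<forall>(I :: unit set) l r. nonoverlapping a b I l r \<longrightarrow>
      (\<Sum>i\<in>I. norm (u (r i) - u (l i))) \<le> C"
    using abs_cont_on_variation_bound[OF assms] by blast
  show thesis
  proof (rule that[of "C + norm (u a)"])
    fix s assume s: "a \<le> s" "s \<le> b"
    have "norm (u s - u a) \<le> C"
      using C[rule_format, of UNIV "\<lambda>_. a" "\<lambda>_. s"] s by (simp add: nonoverlapping_def UNIV_unit)
    then show "norm (u s) \<le> C + norm (u a)"
      using norm_triangle_sub[of "u s" "u a"] by simp
  qed (use \<open>C \<ge> 0\<close> in simp)
qed

lemma abs_cont_on_continuous_on:
  assumes "abs_cont_on a b u"
  shows "continuous_on {a..b} u"
  unfolding continuous_on_iff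
proof (intro ballI allI impI)
  fix x \<epsilon> :: real assume x: "x \<in> {a..b}" and "\<epsilon> > 0"
  obtain \<delta> where "\<delta> > 0" and \<delta>: "\<forall>(I :: unit set) l r. nonoverlapping a b I l r \<and>
      (\<Sum>i\<in>I. r i - l i) < \<delta> \<longrightarrow> (\<Sum>i\<in>I. norm (u (r i) - u (l i))) < \<epsilon>"
    using abs_cont_onD_family[OF assms \<open>\<epsilon> > 0\<close>] by blast
  have "dist (u y) (u x) < \<epsilon>" if "y \<in> {a..b}" "dist y x < \<delta>" for y
  proof -
    have "min x y \<le> max x y" "max x y - min x y < \<delta>"
      using that by (auto simp: dist_real_def max_def min_def)
    then have "norm (u (max x y) - u (min x y)) < \<epsilon>"
      using \<delta>[rule_format, of UNIV "\<lambda>_. min x y" "\<lambda>_. max x y"] that x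
      by (auto simp: nonoverlapping_def UNIV_unit)
    then show ?thesis
      by (cases "x \<le> y") (auto simp: dist_norm norm_minus_commute max_def min_def split: if_splits)
  qed
  then show "\<exists>d>0. \<forall>x'\<in>{a..b}. dist x' x < d \<longrightarrow> dist (u x') (u x) < \<epsilon>"
    using \<open>\<delta> > 0\<close> by blast
qed

lemma loc_abs_cont_isCont:
  assumes "loc_abs_cont h" "0 < t"
  shows "isCont h t"
proof -
  have "continuous_on {t/2..t+1} h"
    using assms by (intro abs_cont_on_continuous_on) (auto simp: loc_abs_cont_def)
  then show ?thesis
    using assms(2) by (intro continuous_on_interior[of "{t/2..t+1}"]) auto
qed

lemma norm_sq_diff_le:
  fixes x y :: "'a::real_inner"
  assumes "norm x \<le> B" "norm y \<le> B"
  shows "\<bar>(norm x)\<^sup>2 - (norm y)\<^sup>2\<bar> \<le> 2 * B * norm (x - y)"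
proof -
  have "(norm x)\<^sup>2 - (norm y)\<^sup>2 = (norm x - norm y) * (norm x + norm y)"
    by (simp add: power2_eq_square algebra_simps)
  then have "\<bar>(norm x)\<^sup>2 - (norm y)\<^sup>2\<bar> = \<bar>norm x - norm y\<bar> * (norm x + norm y)"
    by (simp add: abs_mult)
  also have "\<dots> \<le> norm (x - y) * (2 * B)"
    using assms by (intro mult_mono norm_triangle_ineq3) auto
  finally show ?thesis
    by (simp add: mult_ac)
qed

lemma EVI_AE_real:
  assumes evi: "EVI_curve F l h0 h" and pos: "\<And>v. 0 \<le> F v" and ne: "eff_domain F \<noteq> {}"
  shows "AE t in lebesgue. 0 < t \<longrightarrow> h t \<in> eff_domain F \<and> (\<forall>v\<in>eff_domain F. \<exists>D.
    ((\<lambda>s. (norm (h s - v))\<^sup>2) has_real_derivative D) (at t) \<and>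
    D / 2 + l / 2 * (norm (h t - v))\<^sup>2 \<le> real_of_ereal (F v) - real_of_ereal (F (h t)))"
proof -
  have "AE t in lebesgue. 0 < t \<longrightarrow> (\<forall>v\<in>eff_domain F.
        \<exists>D. ((\<lambda>s. (norm (h s - v))\<^sup>2) has_real_derivative D) (at t) \<and>
            ereal (1/2 * D + l/2 * (norm (h t - v))\<^sup>2) \<le> F v - F (h t))"
    using evi by (simp add: EVI_curve_def)
  then show ?thesis
  proof eventually_elim
    case (elim t)
    show ?case
    proof (intro impI conjI ballI)
      assume "0 < t"
      obtain v0 where v0: "v0 \<in> eff_domain F"
        using ne by blast
      have fin: "\<bar>F v\<bar> \<noteq> \<infinity>" if "v \<in> eff_domain F" for v
        using that pos[of v] by (auto simp: eff_domain_def)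
      obtain D where "ereal (1/2 * D + l/2 * (norm (h t - v0))\<^sup>2) \<le> F v0 - F (h t)"
        using elim \<open>0 < t\<close> v0 by blast
      then show ht: "h t \<in> eff_domain F"
        using fin[OF v0] by (cases "F v0"; cases "F (h t)") (auto simp: eff_domain_def)
      fix v assume v: "v \<in> eff_domain F"
      obtain D where "((\<lambda>s. (norm (h s - v))\<^sup>2) has_real_derivative D) (at t)"
          "ereal (1/2 * D + l/2 * (norm (h t - v))\<^sup>2) \<le> F v - F (h t)"
        using elim \<open>0 < t\<close> v by blast
      then show "\<exists>D. ((\<lambda>s. (norm (h s - v))\<^sup>2) has_real_derivative D) (at t) \<and>
          D / 2 + l / 2 * (norm (h t - v))\<^sup>2 \<le> real_of_ereal (F v) - real_of_ereal (F (h t))"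
        using fin[OF v] fin[OF ht] by (cases "F v"; cases "F (h t)") auto
    qed
  qed
qed

lemma EVI_contraction:
  assumes u: "EVI_curve F l u0 u" and v: "EVI_curve F l v0 v"
    and pos: "\<And>v. 0 \<le> F v" and ne: "eff_domain F \<noteq> {}" and "0 \<le> l" "0 \<le> t"
  shows "norm (u t - v t) \<le> exp (- l * t) * norm (u0 - v0)"
proof (cases "t = 0")
  case True
  then show ?thesis
    using u v by (simp add: EVI_curve_def)
next
  case False
  then have "0 < t"
    using \<open>0 \<le> t\<close> by simp
  define G where "G s = exp (2 * l * s) * (norm (u s - v s))\<^sup>2" for s
  have mono: "G t \<le> G a" if a: "0 < a" "a \<le> t" for a
  proof (rule abs_cont_on_nonincreasing[OF a(2)])
    show ua: "abs_cont_on a t u"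
      using u a by (auto simp: EVI_curve_def loc_abs_cont_def)
    have va: "abs_cont_on a t v"
      using v a by (auto simp: EVI_curve_def loc_abs_cont_def)
    obtain Bu where Bu: "Bu \<ge> 0" "\<And>s. a \<le> s \<Longrightarrow> s \<le> t \<Longrightarrow> norm (u s) \<le> Bu"
      using abs_cont_on_bounded[OF ua a(2)] by blast
    obtain Bv where Bv: "Bv \<ge> 0" "\<And>s. a \<le> s \<Longrightarrow> s \<le> t \<Longrightarrow> norm (v s) \<le> Bv"
      using abs_cont_on_bounded[OF va a(2)] by blast
    define B where "B = Bu + Bv"
    have B: "norm (u s - v s) \<le> B" if "a \<le> s" "s \<le> t" for s
      using Bu(2)[OF that] Bv(2)[OF that] norm_triangle_ineq4[of "u s" "v s"] by (simp add: B_def)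
    have "B \<ge> 0"
      using Bu(1) Bv(1) by (simp add: B_def)
    define E where "E = exp (2 * l * t)"
    have "E > 0"
      by (simp add: E_def)
    have E: "exp (2 * l * s) \<le> E" if "s \<le> t" for s
      using that \<open>0 \<le> l\<close> by (simp add: E_def mult_left_mono)
    show "abs_cont_on a t G"
    proof (rule abs_cont_on_dominated[OF ua va])
      show "0 \<le> E * (2 * B) + E * (2 * l) * B\<^sup>2"
        using \<open>E > 0\<close> \<open>B \<ge> 0\<close> \<open>0 \<le> l\<close> by simp
      fix p q assume pq: "a \<le> p" "p \<le> q" "q \<le> t"
      have "\<bar>(norm (u q - v q))\<^sup>2 - (norm (u p - v p))\<^sup>2\<bar> \<le> 2 * B * norm ((u q - v q) - (u p - v p))"
        using pq by (intro norm_sq_diff_le B) auto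
      also have "\<dots> \<le> 2 * B * (norm (u q - u p) + norm (v q - v p))"
        using \<open>B \<ge> 0\<close> norm_triangle_ineq4[of "u q - u p" "v q - v p"]
        by (intro mult_left_mono) (auto simp: algebra_simps)
      finally have 1: "\<bar>(norm (u q - v q))\<^sup>2 - (norm (u p - v p))\<^sup>2\<bar> \<le> 2 * B * (norm (u q - u p) + norm (v q - v p))" .
      have "exp (2 * l * q) * (1 + (2 * l * p - 2 * l * q)) \<le> exp (2 * l * q) * exp (2 * l * p - 2 * l * q)"
        by (intro mult_left_mono) auto
      also have "\<dots> = exp (2 * l * p)"
        by (simp flip: exp_add)
      finally have "exp (2 * l * q) - exp (2 * l * p) \<le> exp (2 * l * q) * (2 * l * (q - p))"
        by (simp add: algebra_simps)
      also have "\<dots> \<le> E * (2 * l * (q - p))"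
        using pq \<open>0 \<le> l\<close> by (intro mult_right_mono E) auto
      finally have 2: "exp (2 * l * q) - exp (2 * l * p) \<le> E * (2 * l) * (q - p)"
        by (simp add: mult_ac)
      have 3: "exp (2 * l * p) \<le> exp (2 * l * q)"
        using pq \<open>0 \<le> l\<close> by (simp add: mult_left_mono)
      have "G q - G p = exp (2 * l * q) * ((norm (u q - v q))\<^sup>2 - (norm (u p - v p))\<^sup>2)
          + (exp (2 * l * q) - exp (2 * l * p)) * (norm (u p - v p))\<^sup>2"
        by (simp add: G_def algebra_simps)
      then have "norm (G q - G p) \<le> exp (2 * l * q) * \<bar>(norm (u q - v q))\<^sup>2 - (norm (u p - v p))\<^sup>2\<bar>
          + (exp (2 * l * q) - exp (2 * l * p)) * (norm (u p - v p))\<^sup>2"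
        using 3 by (auto simp: abs_mult intro!: order_trans[OF abs_triangle_ineq])
      also have "\<dots> \<le> E * (2 * B * (norm (u q - u p) + norm (v q - v p))) + (E * (2 * l) * (q - p)) * B\<^sup>2"
        using 1 2 3 pq \<open>B \<ge> 0\<close> \<open>E > 0\<close> \<open>0 \<le> l\<close> by (intro add_mono mult_mono E power_mono B) auto
      also have "\<dots> \<le> (E * (2 * B) + E * (2 * l) * B\<^sup>2) * (norm (u q - u p) + norm (v q - v p))
           + (E * (2 * B) + E * (2 * l) * B\<^sup>2) * (q - p)"
      proof (rule add_mono)
        show "E * (2 * B * (norm (u q - u p) + norm (v q - v p))) \<le> (E * (2 * B) + E * (2 * l) * B\<^sup>2) * (norm (u q - u p) + norm (v q - v p))"
          using \<open>E > 0\<close> \<open>0 \<le> l\<close> unfolding mult.assoc[symmetric] by (intro mult_right_mono) auto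
        have "E * (2 * l) * (q - p) * B\<^sup>2 = E * (2 * l) * B\<^sup>2 * (q - p)"
          by simp
        also have "\<dots> \<le> (E * (2 * B) + E * (2 * l) * B\<^sup>2) * (q - p)"
          using \<open>E > 0\<close> \<open>B \<ge> 0\<close> pq by (intro mult_right_mono) auto
        finally show "E * (2 * l) * (q - p) * B\<^sup>2 \<le> (E * (2 * B) + E * (2 * l) * B\<^sup>2) * (q - p)" .
      qed
      finally show "norm (G q - G p) \<le> (E * (2 * B) + E * (2 * l) * B\<^sup>2) * (norm (u q - u p) + norm (v q - v p) + (q - p))"
        by (simp add: distrib_left)
    qed
    show "AE x in lebesgue. a < x \<and> x < t \<longrightarrow>
      (\<exists>A D. (A has_real_derivative D) (at x) \<and> D \<le> 0 \<and>
        (\<forall>\<epsilon>>0. \<forall>\<^sub>F s in nhds x. \<bar>G s - A s\<bar> \<le> \<epsilon> * norm (u s - u x)))"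
      using EVI_AE_real[OF u pos ne] EVI_AE_real[OF v pos ne]
    proof eventually_elim
      case (elim x)
      show ?case
      proof
        assume x: "a < x \<and> x < t"
        then have "0 < x"
          using a by simp
        obtain D1 where D1: "((\<lambda>s. (norm (u s - v x))\<^sup>2) has_real_derivative D1) (at x)"
          "D1 / 2 + l / 2 * (norm (u x - v x))\<^sup>2 \<le> real_of_ereal (F (v x)) - real_of_ereal (F (u x))"
          using elim \<open>0 < x\<close> by blast
        obtain D2 where D2: "((\<lambda>s. (norm (v s - u x))\<^sup>2) has_real_derivative D2) (at x)"
          "D2 / 2 + l / 2 * (norm (v x - u x))\<^sup>2 \<le> real_of_ereal (F (u x)) - real_of_ereal (F (v x))"
          using elim \<open>0 < x\<close> by blast
        define A where "A s = exp (2 * l * s) *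
           ((norm (u s - v x))\<^sup>2 + (norm (v s - u x))\<^sup>2 - (norm (u x - v x))\<^sup>2)" for s
        define D where "D = exp (2 * l * x) * (D1 + D2) + exp (2 * l * x) * (2 * l) * (norm (u x - v x))\<^sup>2"
        have "(A has_real_derivative D) (at x)"
          unfolding A_def D_def
          by (rule D1(1) D2(1) derivative_eq_intros refl | simp add: norm_minus_commute algebra_simps)+
        moreover have "D \<le> 0"
        proof -
          have "D1 + D2 + 2 * l * (norm (u x - v x))\<^sup>2 \<le> 0"
            using D1(2) D2(2) by (simp add: norm_minus_commute)
          then have "exp (2 * l * x) * (D1 + D2 + 2 * l * (norm (u x - v x))\<^sup>2) \<le> 0"
            by (simp add: mult_le_0_iff)
          then show ?thesis
            by (simp add: D_def algebra_simps)
        qed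
        moreover have "\<forall>\<^sub>F s in nhds x. \<bar>G s - A s\<bar> \<le> \<epsilon> * norm (u s - u x)" if "\<epsilon> > 0" for \<epsilon>
        proof -
          have "isCont v x"
            using v \<open>0 < x\<close> by (auto simp: EVI_curve_def intro: loc_abs_cont_isCont)
          then have "(v \<longlongrightarrow> v x) (nhds x)"
            by (simp add: continuous_at tendsto_at_iff_tendsto_nhds)
          then have ev: "\<forall>\<^sub>F s in nhds x. dist (v s) (v x) < \<epsilon> / (2 * E)"
            using \<open>\<epsilon> > 0\<close> \<open>E > 0\<close> by (intro tendstoD) auto
          have "\<forall>\<^sub>F s in nhds x. s < t"
            using x eventually_nhds_in_open[of "{..<t}" x] by simp
          with ev show ?thesis
          proof eventually_elim
            case (elim s)
            have id: "(norm (x - y))\<^sup>2 - ((norm (x - y'))\<^sup>2 + (norm (y - x'))\<^sup>2 - (norm (x' - y'))\<^sup>2)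
               = - 2 * inner (x - x') (y - y')" for x y x' y' :: 'a
              by (simp add: power2_norm_eq_inner algebra_simps inner_commute)
            have "G s - A s = exp (2 * l * s) * (- 2 * inner (u s - u x) (v s - v x))"
              unfolding G_def A_def id[symmetric] by (simp add: algebra_simps)
            then have "\<bar>G s - A s\<bar> = exp (2 * l * s) * (2 * \<bar>inner (u s - u x) (v s - v x)\<bar>)"
              by (simp add: abs_mult)
            also have "\<dots> \<le> E * (2 * (norm (u s - u x) * norm (v s - v x)))"
              using elim \<open>E > 0\<close> by (intro mult_mono E Cauchy_Schwarz_ineq2) auto
            also have "\<dots> = (2 * E * norm (v s - v x)) * norm (u s - u x)"
              by simp
            also have "\<dots> \<le> \<epsilon> * norm (u s - u x)"
              using elim \<open>E > 0\<close> by (intro mult_right_mono) (auto simp: dist_norm field_simps)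
            finally show ?case .
          qed
        qed
        ultimately show "\<exists>A D. (A has_real_derivative D) (at x) \<and> D \<le> 0 \<and>
            (\<forall>\<epsilon>>0. \<forall>\<^sub>F s in nhds x. \<bar>G s - A s\<bar> \<le> \<epsilon> * norm (u s - u x))"
          by blast
      qed
    qed
  qed
  have "(u \<longlongrightarrow> u0) (at_right 0)" "(v \<longlongrightarrow> v0) (at_right 0)"
    using u v by (auto simp: EVI_curve_def)
  then have "(G \<longlongrightarrow> exp (2 * l * 0) * (norm (u0 - v0))\<^sup>2) (at_right 0)"
    unfolding G_def by (intro tendsto_intros)
  moreover have "\<forall>\<^sub>F a in at_right 0. G t \<le> G a"
    unfolding eventually_at_right[OF \<open>0 < t\<close>] using mono \<open>0 < t\<close> by (intro exI[of _ t]) auto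
  ultimately have "G t \<le> exp (2 * l * 0) * (norm (u0 - v0))\<^sup>2"
    by (intro tendsto_lowerbound) auto
  moreover have "exp (2 * l * t) = (exp (l * t))\<^sup>2"
    by (simp add: power2_eq_square flip: exp_add)
  ultimately have "(exp (l * t) * norm (u t - v t))\<^sup>2 \<le> (norm (u0 - v0))\<^sup>2"
    by (simp add: G_def power_mult_distrib)
  then have "exp (l * t) * norm (u t - v t) \<le> norm (u0 - v0)"
    using norm_ge_zero power2_le_imp_le by blast
  then show ?thesis
    by (simp add: exp_minus field_simps)
qed

lemma EVI_shift:
  assumes evi: "EVI_curve F l h0 h" and "0 \<le> r"
  shows "EVI_curve F l (h r) (\<lambda>t. h (t + r))"
proof (cases "r = 0")
  case True
  then show ?thesis
    using evi by (simp add: EVI_curve_def)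
next
  case False
  then have "0 < r"
    using \<open>0 \<le> r\<close> by simp
  have lac: "loc_abs_cont h"
    using evi by (simp add: EVI_curve_def)
  have "loc_abs_cont (\<lambda>t. h (t + r))"
    unfolding loc_abs_cont_def
  proof (intro allI impI)
    fix s t :: real assume st: "0 < s \<and> s \<le> t"
    then have *: "abs_cont_on (s + r) (t + r) h"
      using lac \<open>0 < r\<close> by (auto simp: loc_abs_cont_def)
    show "abs_cont_on s t (\<lambda>t. h (t + r))"
    proof (rule abs_cont_onI_family)
      fix \<epsilon> :: real assume "\<epsilon> > 0"
      obtain \<delta> where "\<delta> > 0" and \<delta>: "\<forall>(I :: nat set) a b. nonoverlapping (s + r) (t + r) I a b \<and>
          (\<Sum>i\<in>I. b i - a i) < \<delta> \<longrightarrow> (\<Sum>i\<in>I. norm (h (b i) - h (a i))) < \<epsilon>"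
        using abs_cont_onD_family[OF * \<open>\<epsilon> > 0\<close>] by blast
      have "nonoverlapping (s + r) (t + r) I (\<lambda>i. a i + r) (\<lambda>i. b i + r)"
        if ab: "nonoverlapping s t I a b" for I :: "nat set" and a b
      proof -
        have "{a i + r<..<b i + r} \<inter> {a j + r<..<b j + r} = {}" if ij: "i \<in> I" "j \<in> I" "i \<noteq> j" for i j
        proof -
          have "x - r \<in> {a i<..<b i} \<inter> {a j<..<b j}"
            if "x \<in> {a i + r<..<b i + r} \<inter> {a j + r<..<b j + r}" for x
            using that by auto
          then show ?thesis
            using ab ij unfolding nonoverlapping_def by blast
        qed
        then show ?thesis
          using ab by (simp add: nonoverlapping_def)
      qed
      then have "\<forall>(I :: nat set) a b. nonoverlapping s t I a b \<and> (\<Sum>i\<in>I. b i - a i) < \<delta> \<longrightarrow>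
          (\<Sum>i\<in>I. norm (h (b i + r) - h (a i + r))) < \<epsilon>"
        using \<delta>[rule_format, of _ "\<lambda>i. _ i + r" "\<lambda>i. _ i + r"] by simp
      then show "\<exists>\<delta>>0. \<forall>(I :: nat set) a b. nonoverlapping s t I a b \<and> (\<Sum>i\<in>I. b i - a i) < \<delta> \<longrightarrow>
          (\<Sum>i\<in>I. norm (h (b i + r) - h (a i + r))) < \<epsilon>"
        using \<open>\<delta> > 0\<close> by blast
    qed
  qed
  moreover have "((\<lambda>t. h (t + r)) \<longlongrightarrow> h r) (at_right 0)"
  proof -
    have "isCont h r"
      by (rule loc_abs_cont_isCont[OF lac \<open>0 < r\<close>])
    then have "((\<lambda>t. h (t + r)) \<longlongrightarrow> h (0 + r)) (at 0)"
      by (intro isCont_tendsto_compose[of _ h] tendsto_intros) simp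
    then have "((\<lambda>t. h (t + r)) \<longlongrightarrow> h (0 + r)) (at_right 0)"
      by (rule tendsto_within_subset) simp
    then show ?thesis
      by simp
  qed
  moreover have "AE t in lebesgue. 0 < t \<longrightarrow> (\<forall>v\<in>eff_domain F.
        \<exists>D. ((\<lambda>s. (norm (h (s + r) - v))\<^sup>2) has_real_derivative D) (at t) \<and>
            ereal (1/2 * D + l/2 * (norm (h (t + r) - v))\<^sup>2) \<le> F v - F (h (t + r)))"
  proof -
    define P where "P t \<longleftrightarrow> (0 < t \<longrightarrow> (\<forall>v\<in>eff_domain F.
        \<exists>D. ((\<lambda>s. (norm (h s - v))\<^sup>2) has_real_derivative D) (at t) \<and>
            ereal (1/2 * D + l/2 * (norm (h t - v))\<^sup>2) \<le> F v - F (h t)))" for t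
    have "AE t in lebesgue. P t"
      using evi by (simp add: EVI_curve_def P_def)
    then have "negligible {t. \<not> P t}"
      by (simp add: negligible_iff_null_sets completion.AE_iff_null_sets)
    then have "negligible ((+) (- r) ` {t. \<not> P t})"
      by (rule negligible_translation)
    moreover have "(+) (- r) ` {t. \<not> P t} = {t. \<not> P (t + r)}"
      by (force simp: image_iff)
    ultimately have "AE t in lebesgue. P (t + r)"
      by (simp add: negligible_iff_null_sets completion.AE_iff_null_sets)
    then show ?thesis
    proof eventually_elim
      case (elim t)
      show ?case
      proof (intro impI ballI)
        fix v assume "0 < t" "v \<in> eff_domain F"
        then show "\<exists>D. ((\<lambda>s. (norm (h (s + r) - v))\<^sup>2) has_real_derivative D) (at t) \<and>
            ereal (1/2 * D + l/2 * (norm (h (t + r) - v))\<^sup>2) \<le> F v - F (h (t + r))"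
          using elim \<open>0 < r\<close> DERIV_shift[of "\<lambda>s. (norm (h s - v))\<^sup>2" _ t r] by (auto simp: P_def)
      qed
    qed
  qed
  ultimately show ?thesis
    by (simp add: EVI_curve_def)
qed

lemma EVI_speed:
  assumes evi: "EVI_curve F l h0 h" and pos: "\<And>v. 0 \<le> F v" and "0 \<le> l"
    and \<xi>: "\<xi> \<in> subdiff F h0" and "0 \<le> t"
  shows "norm (h t - h0) \<le> t * norm \<xi>"
proof (cases "t = 0")
  case True
  then show ?thesis
    using evi by (simp add: EVI_curve_def)
next
  case False
  then have "0 < t"
    using \<open>0 \<le> t\<close> by simp
  have h0: "h0 \<in> eff_domain F"
    using \<xi> by (simp add: subdiff_def)
  then have ne: "eff_domain F \<noteq> {}"
    by blast
  have ineq: "real_of_ereal (F h0) - real_of_ereal (F v) \<le> norm \<xi> * norm (v - h0)"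
    if "v \<in> eff_domain F" for v
  proof -
    have "F h0 + ereal (inner \<xi> (v - h0)) \<le> F v"
      using \<xi> by (simp add: subdiff_def)
    then have "real_of_ereal (F h0) + inner \<xi> (v - h0) \<le> real_of_ereal (F v)"
      using that h0 pos[of v] pos[of h0] by (cases "F h0"; cases "F v") (auto simp: eff_domain_def)
    then show ?thesis
      using Cauchy_Schwarz_ineq2[of \<xi> "v - h0"] by linarith
  qed
  have lim: "(h \<longlongrightarrow> h0) (at_right 0)"
    using evi by (simp add: EVI_curve_def)
  have bound: "norm (h t - h0) \<le> t * norm \<xi> + \<epsilon>" if "\<epsilon> > 0" for \<epsilon>
  proof -
    define G where "G s = sqrt ((norm (h s - h0))\<^sup>2 + \<epsilon>\<^sup>2) - s * norm \<xi>" for s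
    have mono: "G t \<le> G a" if a: "0 < a" "a \<le> t" for a
    proof (rule abs_cont_on_nonincreasing[OF a(2)])
      show ha: "abs_cont_on a t h"
        using evi a by (auto simp: EVI_curve_def loc_abs_cont_def)
      show "abs_cont_on a t G"
      proof (rule abs_cont_on_dominated[OF ha ha])
        fix p q assume pq: "a \<le> p" "p \<le> q" "q \<le> t"
        have *: "sqrt (x\<^sup>2 + \<epsilon>\<^sup>2) - sqrt (y\<^sup>2 + \<epsilon>\<^sup>2) \<le> \<bar>x - y\<bar>" for x y
          using real_sqrt_sum_squares_triangle_ineq[of y "x - y" \<epsilon> 0] by simp
        have "\<bar>G q - G p\<bar> \<le> \<bar>norm (h q - h0) - norm (h p - h0)\<bar> + (q - p) * norm \<xi>"
        proof -
          have "\<bar>sqrt ((norm (h q - h0))\<^sup>2 + \<epsilon>\<^sup>2) - sqrt ((norm (h p - h0))\<^sup>2 + \<epsilon>\<^sup>2)\<bar>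
              \<le> \<bar>norm (h q - h0) - norm (h p - h0)\<bar>"
            using *[of "norm (h q - h0)" "norm (h p - h0)"] *[of "norm (h p - h0)" "norm (h q - h0)"]
            by linarith
          moreover have "0 \<le> (q - p) * norm \<xi>"
            using pq by simp
          ultimately show ?thesis
            unfolding G_def left_diff_distrib by linarith
        qed
        also have "\<dots> \<le> norm (h q - h p) + (q - p) * norm \<xi>"
          using norm_triangle_ineq3[of "h q - h0" "h p - h0"] by simp
        also have "\<dots> \<le> (1 + norm \<xi>) * norm (h q - h p) + (1 + norm \<xi>) * (q - p)"
          using pq by (simp add: algebra_simps add_increasing2)
        also have "\<dots> \<le> (1 + norm \<xi>) * (norm (h q - h p) + norm (h q - h p) + (q - p))"
          by (simp add: distrib_left)
        finally show "norm (G q - G p) \<le> (1 + norm \<xi>) * (norm (h q - h p) + norm (h q - h p) + (q - p))"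
          by simp
      qed simp
      show "AE x in lebesgue. a < x \<and> x < t \<longrightarrow>
        (\<exists>A D. (A has_real_derivative D) (at x) \<and> D \<le> 0 \<and>
          (\<forall>\<epsilon>>0. \<forall>\<^sub>F s in nhds x. \<bar>G s - A s\<bar> \<le> \<epsilon> * norm (h s - h x)))"
        using EVI_AE_real[OF evi pos ne]
      proof eventually_elim
        case (elim x)
        show ?case
        proof
          assume x: "a < x \<and> x < t"
          then have "0 < x"
            using a by simp
          then have hx: "h x \<in> eff_domain F"
            using elim by blast
          obtain D where D: "((\<lambda>s. (norm (h s - h0))\<^sup>2) has_real_derivative D) (at x)"
            "D / 2 + l / 2 * (norm (h x - h0))\<^sup>2 \<le> real_of_ereal (F h0) - real_of_ereal (F (h x))"
            using elim \<open>0 < x\<close> h0 by blast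
          define S where "S = sqrt ((norm (h x - h0))\<^sup>2 + \<epsilon>\<^sup>2)"
          have "S > 0"
            using \<open>\<epsilon> > 0\<close> by (simp add: S_def add_nonneg_pos)
          have "norm (h x - h0) \<le> S"
            unfolding S_def by (rule real_le_rsqrt) simp
          have pos_x: "0 < (norm (h x - h0))\<^sup>2 + \<epsilon>\<^sup>2"
            using \<open>\<epsilon> > 0\<close> by (simp add: add_nonneg_pos)
          have "((\<lambda>s. (norm (h s - h0))\<^sup>2 + \<epsilon>\<^sup>2) has_real_derivative D) (at x)"
            using DERIV_add[OF D(1) DERIV_const] by simp
          then have "((\<lambda>s. sqrt ((norm (h s - h0))\<^sup>2 + \<epsilon>\<^sup>2)) has_real_derivative inverse S / 2 * D) (at x)"
            unfolding S_def by (rule DERIV_chain2[where f = sqrt and g = "\<lambda>s. (norm (h s - h0))\<^sup>2 + \<epsilon>\<^sup>2", OF DERIV_real_sqrt[OF pos_x]])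
          moreover have "((\<lambda>s. s * norm \<xi>) has_real_derivative norm \<xi>) (at x)"
            using DERIV_cmult_right[OF DERIV_ident, of "norm \<xi>"] by simp
          ultimately have dG: "(G has_real_derivative (inverse S / 2 * D - norm \<xi>)) (at x)"
            unfolding G_def by (rule DERIV_diff)
          have "D / 2 \<le> norm \<xi> * S"
          proof -
            have "D / 2 \<le> norm \<xi> * norm (h x - h0)"
            proof -
              have "0 \<le> l / 2 * (norm (h x - h0))\<^sup>2"
                using \<open>0 \<le> l\<close> by simp
              then show ?thesis
                using D(2) ineq[OF hx] by linarith
            qed
            also have "\<dots> \<le> norm \<xi> * S"
              using \<open>norm (h x - h0) \<le> S\<close> by (intro mult_left_mono) auto
            finally show ?thesis .
          qed
          then have "inverse S * (D / 2) \<le> inverse S * (norm \<xi> * S)"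
            using \<open>S > 0\<close> by (intro mult_left_mono) auto
          moreover have "inverse S * (norm \<xi> * S) = norm \<xi>"
            using \<open>S > 0\<close> by simp
          ultimately have "inverse S / 2 * D - norm \<xi> \<le> 0"
            by linarith
          with dG show "\<exists>A D. (A has_real_derivative D) (at x) \<and> D \<le> 0 \<and>
              (\<forall>\<epsilon>>0. \<forall>\<^sub>F s in nhds x. \<bar>G s - A s\<bar> \<le> \<epsilon> * norm (h s - h x))"
            by (intro exI[of _ G] exI[of _ "inverse S / 2 * D - norm \<xi>"]) simp
        qed
      qed
    qed
    have "(G \<longlongrightarrow> sqrt ((norm (h0 - h0))\<^sup>2 + \<epsilon>\<^sup>2) - 0 * norm \<xi>) (at_right 0)"
      unfolding G_def by (intro tendsto_intros lim)
    moreover have "\<forall>\<^sub>F a in at_right 0. G t \<le> G a"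
      unfolding eventually_at_right[OF \<open>0 < t\<close>] using mono \<open>0 < t\<close> by (intro exI[of _ t]) auto
    ultimately have "G t \<le> sqrt ((norm (h0 - h0))\<^sup>2 + \<epsilon>\<^sup>2) - 0 * norm \<xi>"
      by (intro tendsto_lowerbound) auto
    then have "sqrt ((norm (h t - h0))\<^sup>2 + \<epsilon>\<^sup>2) \<le> t * norm \<xi> + \<epsilon>"
      using \<open>\<epsilon> > 0\<close> by (simp add: G_def)
    moreover have "norm (h t - h0) \<le> sqrt ((norm (h t - h0))\<^sup>2 + \<epsilon>\<^sup>2)"
      by (rule real_le_rsqrt) simp
    ultimately show ?thesis
      by linarith
  qed
  then show ?thesis
    by (rule field_le_epsilon)
qed

lemma EVI_lipschitz:
  assumes evi: "EVI_curve F l h0 h" and pos: "\<And>v. 0 \<le> F v" and "0 \<le> l"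
    and \<xi>: "\<xi> \<in> subdiff F h0" and st: "0 \<le> s" "s \<le> t"
  shows "norm (h t - h s) \<le> exp (- l * s) * norm \<xi> * (t - s)"
proof -
  have ne: "eff_domain F \<noteq> {}"
    using \<xi> by (auto simp: subdiff_def)
  have "norm (h (s + (t - s)) - h s) \<le> exp (- l * s) * norm (h (t - s) - h0)"
    using st by (intro EVI_contraction[OF EVI_shift[OF evi] evi pos ne \<open>0 \<le> l\<close>]) auto
  also have "\<dots> \<le> exp (- l * s) * ((t - s) * norm \<xi>)"
    using st by (intro mult_left_mono EVI_speed[OF evi pos \<open>0 \<le> l\<close> \<xi>]) auto
  finally show ?thesis
    by (simp add: mult_ac)
qed

lemma EVI_slope:
  assumes evi: "EVI_curve F l h0 h" and pos: "\<And>v. 0 \<le> F v" and "0 \<le> l"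
    and \<xi>: "\<xi> \<in> subdiff F h0"
  shows "AE t in lebesgue. 0 < t \<longrightarrow> h t \<in> eff_domain F \<and>
    (\<forall>v. F (h t) \<le> F v + ereal (exp (- l * t) * norm \<xi> * norm (v - h t)))"
proof -
  have ne: "eff_domain F \<noteq> {}"
    using \<xi> by (auto simp: subdiff_def)
  show ?thesis
    using EVI_AE_real[OF evi pos ne]
  proof eventually_elim
    case (elim t)
    show ?case
    proof (intro impI conjI allI)
      assume "0 < t"
      then show ht: "h t \<in> eff_domain F"
        using elim by blast
      fix v
      show "F (h t) \<le> F v + ereal (exp (- l * t) * norm \<xi> * norm (v - h t))"
      proof (cases "v \<in> eff_domain F")
        case False
        then show ?thesis
          by (simp add: eff_domain_def)
      next
        case True
        define L where "L = exp (- l * t) * norm \<xi>"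
        obtain D where D: "((\<lambda>s. (norm (h s - v))\<^sup>2) has_real_derivative D) (at t)"
          "D / 2 + l / 2 * (norm (h t - v))\<^sup>2 \<le> real_of_ereal (F v) - real_of_ereal (F (h t))"
          using elim \<open>0 < t\<close> True by blast
        have lim: "((\<lambda>s. ((norm (h s - v))\<^sup>2 - (norm (h t - v))\<^sup>2) / (s - t)) \<longlongrightarrow> D) (at_right t)"
          using D(1) unfolding has_field_derivative_iff by (rule tendsto_within_subset) simp
        have "\<forall>\<^sub>F s in at_right t. - (2 * L * norm (v - h t)) \<le>
           ((norm (h s - v))\<^sup>2 - (norm (h t - v))\<^sup>2) / (s - t)"
          using eventually_at_right_less
        proof eventually_elim
          case (elim s)
          have "norm (h s - h t) \<le> L * (s - t)"
            using elim \<open>0 < t\<close> unfolding L_def by (intro EVI_lipschitz[OF evi pos \<open>0 \<le> l\<close> \<xi>]) auto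
          then have "norm (h s - h t) * norm (h t - v) \<le> L * (s - t) * norm (h t - v)"
            by (intro mult_right_mono) auto
          moreover have "(norm (h s - v))\<^sup>2 - (norm (h t - v))\<^sup>2 =
              (norm (h s - h t))\<^sup>2 + 2 * inner (h s - h t) (h t - v)"
            by (simp add: power2_norm_eq_inner algebra_simps inner_commute)
          ultimately have "- (2 * (L * (s - t) * norm (h t - v))) \<le> (norm (h s - v))\<^sup>2 - (norm (h t - v))\<^sup>2"
            using Cauchy_Schwarz_ineq2[of "h s - h t" "h t - v"] zero_le_power2[of "norm (h s - h t)"]
            by linarith
          then show ?case
            using elim by (simp add: pos_le_divide_eq norm_minus_commute mult_ac)
        qed
        then have "- (2 * L * norm (v - h t)) \<le> D"
          using lim by (intro tendsto_lowerbound) auto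
        have "real_of_ereal (F (h t)) \<le> real_of_ereal (F v) + L * norm (v - h t)"
        proof -
          have "0 \<le> l / 2 * (norm (h t - v))\<^sup>2"
            using \<open>0 \<le> l\<close> by simp
          then show ?thesis
            using D(2) \<open>- (2 * L * norm (v - h t)) \<le> D\<close> by linarith
        qed
        then show ?thesis
          using True ht pos[of v] pos[of "h t"] unfolding L_def
          by (cases "F v"; cases "F (h t)") (auto simp: eff_domain_def)
      qed
    qed
  qed
qed

lemma EVI_weak_derivative:
  assumes evi: "EVI_curve F l h0 h" and pos: "\<And>v. 0 \<le> F v" and "0 \<le> l"
    and ne: "eff_domain F \<noteq> {}"
  shows "AE t in lebesgue. 0 < t \<longrightarrow> (\<forall>\<eta>. (\<forall>\<epsilon>. h t + \<epsilon> *\<^sub>R \<eta> \<in> eff_domain F) \<longrightarrow>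
    (\<exists>d. ((\<lambda>s. inner (h s) \<eta>) has_real_derivative d) (at t) \<and>
       (\<forall>\<epsilon>. - \<epsilon> * d \<le> real_of_ereal (F (h t + \<epsilon> *\<^sub>R \<eta>)) - real_of_ereal (F (h t)))))"
  using EVI_AE_real[OF evi pos ne]
proof eventually_elim
  case (elim t)
  show ?case
  proof (intro impI allI)
    fix \<eta> assume "0 < t" and dom: "\<forall>\<epsilon>. h t + \<epsilon> *\<^sub>R \<eta> \<in> eff_domain F"
    have "h t \<in> eff_domain F"
      using elim \<open>0 < t\<close> by blast
    then obtain D0 where D0: "((\<lambda>s. (norm (h s - h t))\<^sup>2) has_real_derivative D0) (at t)"
      using elim \<open>0 < t\<close> by blast
    have "D0 = 0"
      using DERIV_local_min[OF D0, of 1] by simp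
    have ex: "\<exists>D. ((\<lambda>s. (norm (h s - (h t + \<epsilon> *\<^sub>R \<eta>)))\<^sup>2) has_real_derivative D) (at t) \<and>
      D / 2 \<le> real_of_ereal (F (h t + \<epsilon> *\<^sub>R \<eta>)) - real_of_ereal (F (h t))" for \<epsilon>
    proof -
      have "h t + \<epsilon> *\<^sub>R \<eta> \<in> eff_domain F"
        using dom by blast
      then obtain D where "((\<lambda>s. (norm (h s - (h t + \<epsilon> *\<^sub>R \<eta>)))\<^sup>2) has_real_derivative D) (at t)"
        "D / 2 + l / 2 * (norm (h t - (h t + \<epsilon> *\<^sub>R \<eta>)))\<^sup>2 \<le>
         real_of_ereal (F (h t + \<epsilon> *\<^sub>R \<eta>)) - real_of_ereal (F (h t))"
        using elim \<open>0 < t\<close> by blast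
      moreover have "0 \<le> l / 2 * (norm (h t - (h t + \<epsilon> *\<^sub>R \<eta>)))\<^sup>2"
        using \<open>0 \<le> l\<close> by simp
      ultimately show ?thesis
        by (intro exI[of _ D]) linarith
    qed
    have expand: "(norm (x - (y + \<epsilon> *\<^sub>R \<eta>)))\<^sup>2 = (norm (x - y))\<^sup>2 - 2 * \<epsilon> * (inner x \<eta> - inner y \<eta>) + \<epsilon>\<^sup>2 * (norm \<eta>)\<^sup>2"
      for x y \<epsilon>
      unfolding power2_norm_eq_inner by (simp add: power2_eq_square algebra_simps inner_commute)
    obtain D1 where D1: "((\<lambda>s. (norm (h s - (h t + 1 *\<^sub>R \<eta>)))\<^sup>2) has_real_derivative D1) (at t)"
      using ex by blast
    define d where "d = - D1 / 2"
    have eq: "(\<lambda>s. inner (h s) \<eta>) =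
        (\<lambda>s. ((norm (h s - h t))\<^sup>2 - (norm (h s - (h t + 1 *\<^sub>R \<eta>)))\<^sup>2 + (norm \<eta>)\<^sup>2) / 2 + inner (h t) \<eta>)"
      unfolding expand by (simp add: field_simps)
    have d: "((\<lambda>s. inner (h s) \<eta>) has_real_derivative d) (at t)"
      unfolding d_def by (subst eq) (rule D0 D1 derivative_eq_intros refl | simp add: \<open>D0 = 0\<close>)+
    have "- \<epsilon> * d \<le> real_of_ereal (F (h t + \<epsilon> *\<^sub>R \<eta>)) - real_of_ereal (F (h t))" for \<epsilon>
    proof -
      obtain D where D: "((\<lambda>s. (norm (h s - (h t + \<epsilon> *\<^sub>R \<eta>)))\<^sup>2) has_real_derivative D) (at t)"
        "D / 2 \<le> real_of_ereal (F (h t + \<epsilon> *\<^sub>R \<eta>)) - real_of_ereal (F (h t))"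
        using ex by blast
      have "((\<lambda>s. (norm (h s - (h t + \<epsilon> *\<^sub>R \<eta>)))\<^sup>2) has_real_derivative (- 2 * \<epsilon> * d)) (at t)"
        unfolding expand by (rule D0 d derivative_eq_intros refl | simp add: \<open>D0 = 0\<close>)+
      then have "D = - 2 * \<epsilon> * d"
        using D(1) DERIV_unique by blast
      then show ?thesis
        using D(2) by simp
    qed
    then show "\<exists>d. ((\<lambda>s. inner (h s) \<eta>) has_real_derivative d) (at t) \<and>
       (\<forall>\<epsilon>. - \<epsilon> * d \<le> real_of_ereal (F (h t + \<epsilon> *\<^sub>R \<eta>)) - real_of_ereal (F (h t)))"
      using d by blast
  qed
qed

section \<open>The Hilbert space of mean-zero functions\<close>

lemma space_torus [simp]: "space torus = {0..1}"
  by (simp add: torus_def)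

lemma measure_torus: "measure torus {0..1} = 1"
  by (simp add: torus_def measure_restrict_space measure_completion)

lemma integrable_torus_const [simp]: "integrable torus (\<lambda>x. c :: real)"
  using finite_measure.integrable_const[OF finite_measure_torus] .

lemma integral_torus_const [simp]: "(\<integral>x. c \<partial>torus) = (c :: real)"
  by (simp add: measure_torus)

lemma abs_H_rep_H [simp]: "abs_H (rep_H u) = u"
  using Quotient3_abs_rep[OF Quotient3_H] .

lemma H_eqI: "AE x in torus. rep_H u x = rep_H v x \<Longrightarrow> u = v"
  using abs_H_eqI[OF rep_H_carrier rep_H_carrier] by (metis abs_H_rep_H)

lemma rep_H_measurable [measurable]: "rep_H u \<in> borel_measurable torus"
  using rep_H_carrier[of u] by (simp add: H_carrier_def L2_torus_def)

lemma rep_H_L2: "rep_H u \<in> L2_torus"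
  by (rule H_carrier_L2[OF rep_H_carrier])

lemma rep_H_integrable: "integrable torus (rep_H u)"
  by (rule L2_integrable[OF rep_H_L2])

lemma rep_H_mult_integrable: "integrable torus (\<lambda>x. rep_H u x * rep_H v x)"
  by (rule L2_mult_integrable[OF rep_H_L2 rep_H_L2])

lemma rep_H_mean_zero: "(\<integral>x. rep_H u x \<partial>torus) = 0"
  using rep_H_carrier[of u] by (simp add: H_carrier_def)

lemma rep_H_plus: "AE x in torus. rep_H (u + v) x = rep_H u x + rep_H v x"
proof -
  have "u + v = abs_H (rep_H u) + abs_H (rep_H v)"
    by simp
  also have "\<dots> = abs_H (\<lambda>x. rep_H u x + rep_H v x)"
    by (rule plus_H.abs_eq) (rule H_rel_rep)+
  finally show ?thesis
    using rep_H_abs[OF H_carrier_add[OF rep_H_carrier rep_H_carrier]] by metis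
qed

lemma rep_H_scaleR: "AE x in torus. rep_H (c *\<^sub>R u) x = c * rep_H u x"
proof -
  have "c *\<^sub>R u = c *\<^sub>R abs_H (rep_H u)"
    by simp
  also have "\<dots> = abs_H (\<lambda>x. c * rep_H u x)"
    by (rule scaleR_H.abs_eq) (rule H_rel_rep)
  finally show ?thesis
    using rep_H_abs[OF H_carrier_cmult[OF rep_H_carrier]] by metis
qed

lemma rep_H_minus: "AE x in torus. rep_H (u - v) x = rep_H u x - rep_H v x"
proof -
  have "u - v = abs_H (rep_H u) - abs_H (rep_H v)"
    by simp
  also have "\<dots> = abs_H (\<lambda>x. rep_H u x - rep_H v x)"
    by (rule minus_H.abs_eq) (rule H_rel_rep)+
  finally show ?thesis
    using rep_H_abs[OF H_carrier_diff[OF rep_H_carrier rep_H_carrier]] by metis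
qed

lemma rep_H_zero: "AE x in torus. rep_H 0 x = 0"
  unfolding zero_H.abs_eq by (rule rep_H_abs[OF H_carrier_zero])

lemma inner_H_eq: "inner u v = (\<integral>x. rep_H u x * rep_H v x \<partial>torus)"
proof -
  have "inner u v = inner (abs_H (rep_H u)) (abs_H (rep_H v))"
    by simp
  also have "\<dots> = (\<integral>x. rep_H u x * rep_H v x \<partial>torus)"
    by (rule inner_H.abs_eq) (rule H_rel_rep)+
  finally show ?thesis .
qed

lemma norm_H_sq: "(norm u)\<^sup>2 = (\<integral>x. (rep_H u x)\<^sup>2 \<partial>torus)"
  unfolding power2_norm_eq_inner inner_H_eq by (simp add: power2_eq_square)

lemma rep_H_sq_integrable: "integrable torus (\<lambda>x. (rep_H u x)\<^sup>2)"
  using rep_H_mult_integrable[of u u] by (simp add: power2_eq_square)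

lemma L1_le_L2:
  assumes f: "integrable torus (f :: real \<Rightarrow> real)" and f2: "integrable torus (\<lambda>x. (f x)\<^sup>2)"
  shows "((\<integral>x. \<bar>f x\<bar> \<partial>torus))\<^sup>2 \<le> (\<integral>x. (f x)\<^sup>2 \<partial>torus)"
proof -
  define c where "c = (\<integral>x. \<bar>f x\<bar> \<partial>torus)"
  have int: "integrable torus (\<lambda>x. \<bar>f x\<bar>)"
    using f by simp
  have "0 \<le> (\<integral>x. (\<bar>f x\<bar> - c)\<^sup>2 \<partial>torus)"
    by simp
  also have "(\<lambda>x. (\<bar>f x\<bar> - c)\<^sup>2) = (\<lambda>x. (f x)\<^sup>2 - 2 * c * \<bar>f x\<bar> + c\<^sup>2)"
    by (simp add: power2_diff fun_eq_iff mult_ac)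
  also have "(\<integral>x. (f x)\<^sup>2 - 2 * c * \<bar>f x\<bar> + c\<^sup>2 \<partial>torus) = (\<integral>x. (f x)\<^sup>2 \<partial>torus) - 2 * c * c + c\<^sup>2"
    using f2 int by (simp add: c_def measure_torus)
  finally show ?thesis
    unfolding c_def[symmetric] by (simp add: power2_eq_square)
qed

lemma rep_H_L1_le_norm: "(\<integral>x. \<bar>rep_H u x\<bar> \<partial>torus) \<le> norm u"
proof (rule power2_le_imp_le)
  show "(\<integral>x. \<bar>rep_H u x\<bar> \<partial>torus)\<^sup>2 \<le> (norm u)\<^sup>2"
    unfolding norm_H_sq by (intro L1_le_L2 rep_H_integrable rep_H_sq_integrable)
qed simp

lemma norm_H_le_of_AE_bound:
  assumes "AE x in torus. \<bar>rep_H u x\<bar> \<le> B" "0 \<le> B"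
  shows "norm u \<le> B"
proof (rule power2_le_imp_le)
  have "(\<integral>x. (rep_H u x)\<^sup>2 \<partial>torus) \<le> (\<integral>x. B\<^sup>2 \<partial>torus)"
    using assms(1) by (intro integral_mono_AE rep_H_sq_integrable) (auto elim!: eventually_mono intro!: abs_le_square_iff[THEN iffD1])
  then show "(norm u)\<^sup>2 \<le> B\<^sup>2"
    by (simp add: norm_H_sq measure_torus)
qed (rule assms(2))

lemma H_AE_subseq:
  assumes "X \<longlonglongrightarrow> (L :: H)"
  obtains r where "strict_mono r" "AE x in torus. (\<lambda>n. rep_H (X (r n)) x) \<longlonglongrightarrow> rep_H L x"
proof -
  have "(\<lambda>n. \<integral>x. norm (rep_H (X n - L) x) \<partial>torus) \<longlonglongrightarrow> 0"
  proof (rule tendsto_sandwich[OF always_eventually always_eventually])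
    show "\<forall>n. 0 \<le> (\<integral>x. norm (rep_H (X n - L) x) \<partial>torus)"
      by simp
    show "\<forall>n. (\<integral>x. norm (rep_H (X n - L) x) \<partial>torus) \<le> norm (X n - L)"
      using rep_H_L1_le_norm by simp
    show "(\<lambda>n. norm (X n - L)) \<longlonglongrightarrow> 0"
      using assms by (simp add: LIM_zero tendsto_norm_zero)
  qed simp
  then obtain r where r: "strict_mono r" "AE x in torus. (\<lambda>n. rep_H (X (r n) - L) x) \<longlonglongrightarrow> 0"
    using tendsto_L1_AE_subseq[of torus "\<lambda>n. rep_H (X n - L)"] rep_H_integrable by blast
  have "AE x in torus. \<forall>n. rep_H (X (r n) - L) x = rep_H (X (r n)) x - rep_H L x"
    by (subst AE_all_countable) (simp add: rep_H_minus)
  with r(2) have "AE x in torus. (\<lambda>n. rep_H (X (r n)) x) \<longlonglongrightarrow> rep_H L x"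
  proof eventually_elim
    case (elim x)
    then show ?case
      by (simp add: LIM_zero_iff)
  qed
  with r(1) show thesis
    by (rule that)
qed

lemma nn_integral_rep_H_sq: "(\<integral>\<^sup>+x. ennreal ((rep_H u x)\<^sup>2) \<partial>torus) = ennreal ((norm u)\<^sup>2)"
  unfolding norm_H_sq by (intro nn_integral_eq_integral rep_H_sq_integrable) simp

lemma H_complete:
  assumes "Cauchy (X :: nat \<Rightarrow> H)"
  obtains L where "X \<longlonglongrightarrow> L"
proof -
  have minus: "AE x in torus. \<forall>i j. rep_H (X i - X j) x = rep_H (X i) x - rep_H (X j) x"
    by (simp add: AE_all_countable rep_H_minus)
  have "\<exists>N. \<forall>i\<ge>N. \<forall>j\<ge>N. (\<integral>x. norm (rep_H (X i) x - rep_H (X j) x) \<partial>torus) < e" if e: "e > 0" for e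
  proof -
    obtain N where N: "\<And>i j. i \<ge> N \<Longrightarrow> j \<ge> N \<Longrightarrow> norm (X i - X j) < e"
      using CauchyD[OF assms e] by blast
    have eq: "(\<integral>x. norm (rep_H (X i) x - rep_H (X j) x) \<partial>torus) = (\<integral>x. \<bar>rep_H (X i - X j) x\<bar> \<partial>torus)" for i j
      using rep_H_minus[of "X i" "X j"] by (intro integral_cong_AE) (auto elim!: eventually_mono)
    show ?thesis
      unfolding eq by (intro exI[of _ N] allI impI order_le_less_trans[OF rep_H_L1_le_norm] N)
  qed
  then obtain r where r: "strict_mono r" "AE x in torus. Cauchy (\<lambda>i. rep_H (X (r i)) x)"
    using cauchy_L1_AE_cauchy_subseq[of torus "\<lambda>n. rep_H (X n)"] rep_H_integrable by blast
  define f where "f x = lim (\<lambda>i. rep_H (X (r i)) x)" for x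
  have f_meas [measurable]: "f \<in> borel_measurable torus"
    unfolding f_def by measurable
  have lim: "AE x in torus. (\<lambda>i. rep_H (X (r i)) x) \<longlonglongrightarrow> f x"
    using r(2) by eventually_elim (simp add: f_def Cauchy_convergent_iff convergent_LIMSEQ_iff)
  have bound: "(\<integral>\<^sup>+x. ennreal ((rep_H (X m) x - f x)\<^sup>2) \<partial>torus) \<le> ennreal (e\<^sup>2)"
    if m: "\<And>j. j \<ge> N \<Longrightarrow> norm (X m - X j) \<le> e" for m N and e :: real
  proof -
    have "(\<integral>\<^sup>+x. ennreal ((rep_H (X m) x - f x)\<^sup>2) \<partial>torus) \<le>
      (\<integral>\<^sup>+x. liminf (\<lambda>i. ennreal ((rep_H (X m - X (r i)) x)\<^sup>2)) \<partial>torus)"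
    proof (rule nn_integral_mono_AE)
      show "AE x in torus. ennreal ((rep_H (X m) x - f x)\<^sup>2) \<le>
        liminf (\<lambda>i. ennreal ((rep_H (X m - X (r i)) x)\<^sup>2))"
        using lim minus
      proof eventually_elim
        case (elim x)
        have "(\<lambda>i. (rep_H (X m - X (r i)) x)\<^sup>2) \<longlonglongrightarrow> (rep_H (X m) x - f x)\<^sup>2"
          using elim by (auto intro!: tendsto_intros)
        then have "(\<lambda>i. ennreal ((rep_H (X m - X (r i)) x)\<^sup>2)) \<longlonglongrightarrow> ennreal ((rep_H (X m) x - f x)\<^sup>2)"
          by (rule tendsto_ennrealI)
        from lim_imp_Liminf[OF trivial_limit_sequentially this] show ?case
          by (rule eq_refl[OF sym])
      qed
    qed
    also have "\<dots> \<le> liminf (\<lambda>i. \<integral>\<^sup>+x. ennreal ((rep_H (X m - X (r i)) x)\<^sup>2) \<partial>torus)"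
      by (rule nn_integral_liminf) simp
    also have "\<dots> \<le> limsup (\<lambda>i. \<integral>\<^sup>+x. ennreal ((rep_H (X m - X (r i)) x)\<^sup>2) \<partial>torus)"
      by (rule Liminf_le_Limsup) simp
    also have "\<dots> \<le> ennreal (e\<^sup>2)"
    proof (rule Limsup_bounded, rule eventually_sequentiallyI)
      fix i assume "i \<ge> N"
      then have "r i \<ge> N"
        using seq_suble[OF r(1), of i] by linarith
      then show "(\<integral>\<^sup>+x. ennreal ((rep_H (X m - X (r i)) x)\<^sup>2) \<partial>torus) \<le> ennreal (e\<^sup>2)"
        unfolding nn_integral_rep_H_sq using m by (intro ennreal_leI power_mono) auto
    qed
    finally show ?thesis .
  qed
  have diff_L2: "(\<lambda>x. rep_H (X m) x - f x) \<in> L2_torus"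
    if "\<And>j. j \<ge> N \<Longrightarrow> norm (X m - X j) \<le> e" for m N and e :: real
  proof -
    have "(\<integral>\<^sup>+x. ennreal ((rep_H (X m) x - f x)\<^sup>2) \<partial>torus) \<le> ennreal (e\<^sup>2)"
      using that by (rule bound)
    then have "integrable torus (\<lambda>x. (rep_H (X m) x - f x)\<^sup>2)"
      by (intro integrableI_bounded) (auto intro: le_less_trans)
    then show ?thesis
      by (simp add: L2_torus_def)
  qed
  obtain N1 where N1: "\<And>i j. i \<ge> N1 \<Longrightarrow> j \<ge> N1 \<Longrightarrow> norm (X i - X j) < 1"
    using CauchyD[OF assms zero_less_one] by blast
  have "(\<lambda>x. rep_H (X N1) x - f x) \<in> L2_torus"
    by (rule diff_L2[of N1 _ 1]) (rule less_imp_le[OF N1[OF order_refl]])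
  then have "(\<lambda>x. rep_H (X N1) x + (-1) * (rep_H (X N1) x - f x)) \<in> L2_torus"
    by (intro L2_add L2_cmult rep_H_L2)
  then have f_L2: "f \<in> L2_torus"
    by simp
  have small: "(\<integral>x. (rep_H (X m) x - f x)\<^sup>2 \<partial>torus) \<le> e\<^sup>2"
    if "\<And>j. j \<ge> N \<Longrightarrow> norm (X m - X j) \<le> e" for m N and e :: real
  proof -
    have "(\<lambda>x. rep_H (X m) x - f x) \<in> L2_torus"
      using that by (rule diff_L2)
    then have "(\<integral>\<^sup>+x. ennreal ((rep_H (X m) x - f x)\<^sup>2) \<partial>torus) = ennreal (\<integral>x. (rep_H (X m) x - f x)\<^sup>2 \<partial>torus)"
      by (intro nn_integral_eq_integral) (auto simp: L2_torus_def)
    moreover have "(\<integral>\<^sup>+x. ennreal ((rep_H (X m) x - f x)\<^sup>2) \<partial>torus) \<le> ennreal (e\<^sup>2)"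
      using that by (rule bound)
    ultimately show ?thesis
      by (simp add: ennreal_le_iff)
  qed
  have mean: "(\<integral>x. f x \<partial>torus) = 0"
  proof -
    have "\<bar>\<integral>x. f x \<partial>torus\<bar> \<le> e" if e: "e > 0" for e
    proof -
      obtain N where N: "\<And>i j. i \<ge> N \<Longrightarrow> j \<ge> N \<Longrightarrow> norm (X i - X j) < e"
        using CauchyD[OF assms e] by blast
      have N': "norm (X N - X j) \<le> e" if "j \<ge> N" for j
        using N[of N j] that by simp
      have L2: "(\<lambda>x. rep_H (X N) x - f x) \<in> L2_torus"
        using N' by (rule diff_L2)
      have "(\<integral>x. \<bar>rep_H (X N) x - f x\<bar> \<partial>torus)\<^sup>2 \<le> (\<integral>x. (rep_H (X N) x - f x)\<^sup>2 \<partial>torus)"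
        using L2 L2_integrable[OF L2] by (intro L1_le_L2) (auto simp: L2_torus_def)
      also have "\<dots> \<le> e\<^sup>2"
        using N' by (rule small)
      finally have "(\<integral>x. \<bar>rep_H (X N) x - f x\<bar> \<partial>torus) \<le> e"
        using \<open>e > 0\<close> by (rule power2_le_imp_le[OF _ less_imp_le])
      moreover have "\<bar>\<integral>x. rep_H (X N) x - f x \<partial>torus\<bar> \<le> (\<integral>x. \<bar>rep_H (X N) x - f x\<bar> \<partial>torus)"
        by (rule integral_abs_bound)
      moreover have "(\<integral>x. rep_H (X N) x - f x \<partial>torus) = - (\<integral>x. f x \<partial>torus)"
        using rep_H_integrable L2_integrable[OF f_L2] by (simp add: rep_H_mean_zero)
      ultimately show ?thesis
        by simp
    qed
    then have "\<bar>\<integral>x. f x \<partial>torus\<bar> \<le> 0"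
      by (rule field_le_epsilon) simp
    then show ?thesis
      by simp
  qed
  have f_H: "f \<in> H_carrier"
    using f_L2 mean by (simp add: H_carrier_def)
  have "X \<longlonglongrightarrow> abs_H f"
  proof (rule LIMSEQ_I)
    fix e :: real assume "e > 0"
    then obtain N where N: "\<And>i j. i \<ge> N \<Longrightarrow> j \<ge> N \<Longrightarrow> norm (X i - X j) < e / 2"
      using CauchyD[OF assms half_gt_zero[OF \<open>e > 0\<close>]] by blast
    have "norm (X n - abs_H f) < e" if "n \<ge> N" for n
    proof -
      have "AE x in torus. rep_H (X n - abs_H f) x = rep_H (X n) x - f x"
        using rep_H_minus[of "X n" "abs_H f"] rep_H_abs[OF f_H] by eventually_elim simp
      then have "(norm (X n - abs_H f))\<^sup>2 = (\<integral>x. (rep_H (X n) x - f x)\<^sup>2 \<partial>torus)"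
        unfolding norm_H_sq by (intro integral_cong_AE) (measurable, auto elim!: eventually_mono)
      also have "\<dots> \<le> (e / 2)\<^sup>2"
        by (rule small[of N]) (rule less_imp_le[OF N[OF that]])
      finally have "norm (X n - abs_H f) \<le> e / 2"
        using \<open>e > 0\<close> by (rule power2_le_imp_le[OF _ less_imp_le[OF half_gt_zero]])
      then show ?thesis
        using \<open>e > 0\<close> by simp
    qed
    then show "\<exists>no. \<forall>n\<ge>no. norm (X n - abs_H f) < e"
      by blast
  qed
  then show thesis
    by (rule that)
qed

text \<open>
  The representing vector is the limit of \<open>K z\<^sub>n\<close> for a minimising sequence \<open>z\<^sub>n\<close> of \<open>\<parallel>K z\<parallel>\<^sup>2 / 2 - l z\<close>;
  no completeness of the range of \<open>K\<close> is needed.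
\<close>

lemma riesz_on_range:
  fixes K :: "'b::real_vector \<Rightarrow> H" and l :: "'b \<Rightarrow> real"
  assumes K: "linear K" and Z: "subspace Z"
    and add: "\<And>x y. x \<in> Z \<Longrightarrow> y \<in> Z \<Longrightarrow> l (x + y) = l x + l y"
    and scale: "\<And>c x. x \<in> Z \<Longrightarrow> l (c *\<^sub>R x) = c * l x"
    and bnd: "\<And>x. x \<in> Z \<Longrightarrow> l x \<le> L * norm (K x)"
    and "0 \<le> L"
  obtains \<xi> z where "\<And>n. z n \<in> Z" "(\<lambda>n. K (z n)) \<longlonglongrightarrow> \<xi>" "norm \<xi> \<le> L"
    "\<And>x. x \<in> Z \<Longrightarrow> l x = inner \<xi> (K x)"
proof -
  define J where "J x = (norm (K x))\<^sup>2 / 2 - l x" for x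
  have J_lower: "- L\<^sup>2 / 2 \<le> J x" if "x \<in> Z" for x
  proof -
    have "0 \<le> (norm (K x) - L)\<^sup>2"
      by simp
    then have "2 * (L * norm (K x)) \<le> (norm (K x))\<^sup>2 + L\<^sup>2"
      by (simp add: power2_diff mult_ac)
    then show ?thesis
      using bnd[OF that] unfolding J_def by linarith
  qed
  define m where "m = Inf (J ` Z)"
  have bb: "bdd_below (J ` Z)"
    using J_lower by (intro bdd_belowI2[of _ "- L\<^sup>2 / 2"]) auto
  have ne: "J ` Z \<noteq> {}"
    using subspace_0[OF Z] by blast
  have m_le: "m \<le> J x" if "x \<in> Z" for x
    unfolding m_def using bb that by (intro cInf_lower) auto
  have "\<exists>x\<in>Z. J x < m + 1 / (real n + 1)" for n
  proof -
    have "Inf (J ` Z) < m + 1 / (real n + 1)"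
      by (simp add: m_def)
    then show ?thesis
      using cInf_lessD[OF ne] by blast
  qed
  then obtain z where zZ: "\<And>n. z n \<in> Z" and z: "\<And>n. J (z n) < m + 1 / (real n + 1)"
    by metis
  have Kadd: "K (x + y) = K x + K y" and Kscale: "K (c *\<^sub>R x) = c *\<^sub>R K x" for x y c
    using K by (auto simp: linear_add linear_scale)
  have Jmin: "0 \<le> \<epsilon>\<^sup>2 * (norm (K x))\<^sup>2 / 2 + \<epsilon> * (inner (K (z n)) (K x) - l x) + 1 / (real n + 1)"
    if "x \<in> Z" for x \<epsilon> n
  proof -
    have *: "\<epsilon> *\<^sub>R x \<in> Z"
      using Z that by (simp add: subspace_scale)
    have "m \<le> J (z n + \<epsilon> *\<^sub>R x)"
      using Z zZ * by (intro m_le subspace_add)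
    also have "\<dots> = J (z n) + \<epsilon>\<^sup>2 * (norm (K x))\<^sup>2 / 2 + \<epsilon> * (inner (K (z n)) (K x) - l x)"
    proof -
      have "l (z n + \<epsilon> *\<^sub>R x) = l (z n) + \<epsilon> * l x"
        using add[OF zZ *] scale[OF that] by simp
      moreover have "(norm (a + \<epsilon> *\<^sub>R b))\<^sup>2 / 2 = (norm a)\<^sup>2 / 2 + \<epsilon>\<^sup>2 * (norm b)\<^sup>2 / 2 + \<epsilon> * inner a b" for a b :: H
        unfolding power2_norm_eq_inner inner_add_left inner_add_right
          inner_scaleR_left inner_scaleR_right inner_commute[of b a] by (simp add: power2_eq_square algebra_simps)
      ultimately show ?thesis
        unfolding J_def Kadd Kscale by (simp add: right_diff_distrib)
    qed
    finally show ?thesis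
      using z[of n] by linarith
  qed
  have close: "(norm (K (z i) - K (z j)))\<^sup>2 \<le> 4 * (1 / (real i + 1) + 1 / (real j + 1))" for i j
  proof -
    have mid: "(1/2) *\<^sub>R z i + (1/2) *\<^sub>R z j \<in> Z"
      using Z zZ by (intro subspace_add subspace_scale)
    have "m \<le> J ((1/2) *\<^sub>R z i + (1/2) *\<^sub>R z j)"
      by (rule m_le[OF mid])
    also have "\<dots> = J (z i) / 2 + J (z j) / 2 - (norm (K (z i) - K (z j)))\<^sup>2 / 8"
    proof -
      have "l ((1/2) *\<^sub>R z i + (1/2) *\<^sub>R z j) = l (z i) / 2 + l (z j) / 2"
        using add[OF subspace_scale[OF Z zZ] subspace_scale[OF Z zZ]] scale[OF zZ] by simp
      moreover have "(norm ((1/2) *\<^sub>R a + (1/2) *\<^sub>R b))\<^sup>2 / 2 = (norm a)\<^sup>2 / 4 + (norm b)\<^sup>2 / 4 - (norm (a - b))\<^sup>2 / 8" for a b :: H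
        unfolding power2_norm_eq_inner inner_add_left inner_add_right inner_diff_left inner_diff_right
          inner_scaleR_left inner_scaleR_right inner_commute[of b a] by (simp add: field_simps)
      ultimately show ?thesis
        unfolding J_def Kadd Kscale by (simp add: diff_divide_distrib add_divide_distrib)
    qed
    finally show ?thesis
      using z[of i] z[of j] by simp
  qed
  have "Cauchy (\<lambda>n. K (z n))"
  proof (rule CauchyI)
    fix e :: real assume "e > 0"
    obtain N where N: "8 / e\<^sup>2 < real N"
      using reals_Archimedean2 by blast
    have "norm (K (z i) - K (z j)) < e" if "i \<ge> N" "j \<ge> N" for i j
    proof -
      have N': "8 / e\<^sup>2 < real N + 1" "real N + 1 > 0"
        using N by auto
      have "1 / (real i + 1) \<le> 1 / (real N + 1)" "1 / (real j + 1) \<le> 1 / (real N + 1)"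
        using that by (simp_all add: frac_le)
      then have "(norm (K (z i) - K (z j)))\<^sup>2 \<le> 8 / (real N + 1)"
        using close[of i j] by simp
      also have "\<dots> < e\<^sup>2"
      proof -
        have "8 < (real N + 1) * e\<^sup>2"
          using N'(1) \<open>e > 0\<close> by (simp add: pos_divide_less_eq)
        then show ?thesis
          by (simp add: pos_divide_less_eq mult.commute)
      qed
      finally show ?thesis
        using \<open>e > 0\<close> by (simp add: power2_less_imp_less)
    qed
    then show "\<exists>M. \<forall>i\<ge>M. \<forall>j\<ge>M. norm (K (z i) - K (z j)) < e"
      by blast
  qed
  then obtain \<xi> where lim: "(\<lambda>n. K (z n)) \<longlonglongrightarrow> \<xi>"
    by (rule H_complete)
  have inv: "(\<lambda>n. 1 / (real n + 1)) \<longlonglongrightarrow> 0"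
    using LIMSEQ_inverse_real_of_nat by (simp add: inverse_eq_divide add.commute)
  have rep: "l x = inner \<xi> (K x)" if "x \<in> Z" for x
  proof -
    define a where "a = inner \<xi> (K x) - l x"
    have ineq: "0 \<le> \<epsilon>\<^sup>2 * (norm (K x))\<^sup>2 / 2 + \<epsilon> * a" for \<epsilon>
    proof (rule tendsto_lowerbound)
      show "(\<lambda>n. \<epsilon>\<^sup>2 * (norm (K x))\<^sup>2 / 2 + \<epsilon> * (inner (K (z n)) (K x) - l x) + 1 / (real n + 1))
         \<longlonglongrightarrow> \<epsilon>\<^sup>2 * (norm (K x))\<^sup>2 / 2 + \<epsilon> * a"
        using tendsto_add[OF _ inv, of "\<lambda>n. \<epsilon>\<^sup>2 * (norm (K x))\<^sup>2 / 2 + \<epsilon> * (inner (K (z n)) (K x) - l x)"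
            "\<epsilon>\<^sup>2 * (norm (K x))\<^sup>2 / 2 + \<epsilon> * a"]
        unfolding a_def by (simp add: tendsto_intros lim)
    qed (use Jmin[OF that] in auto)
    have "a = 0"
    proof (rule ccontr)
      assume "a \<noteq> 0"
      define \<epsilon> where "\<epsilon> = - a / ((norm (K x))\<^sup>2 + 1)"
      have q: "(norm (K x))\<^sup>2 + 1 > 0"
        by (simp add: add_nonneg_pos)
      have "\<epsilon>\<^sup>2 * (norm (K x))\<^sup>2 / 2 + \<epsilon> * a < \<epsilon>\<^sup>2 * ((norm (K x))\<^sup>2 + 1) + \<epsilon> * a"
      proof -
        have "\<epsilon>\<^sup>2 > 0"
          using \<open>a \<noteq> 0\<close> q by (simp add: \<epsilon>_def)
        moreover have "0 \<le> \<epsilon>\<^sup>2 * (norm (K x))\<^sup>2"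
          by simp
        ultimately show ?thesis
          unfolding distrib_left by linarith
      qed
      also have "\<dots> = 0"
        using q unfolding \<epsilon>_def power2_eq_square[of "_ / _"] by simp
      finally show False
        using ineq[of \<epsilon>] by simp
    qed
    then show ?thesis
      by (simp add: a_def)
  qed
  have "norm \<xi> \<le> L"
  proof -
    have "inner \<xi> \<xi> \<le> L * norm \<xi>"
    proof (rule tendsto_le[OF trivial_limit_sequentially])
      show "(\<lambda>n. inner \<xi> (K (z n))) \<longlonglongrightarrow> inner \<xi> \<xi>" "(\<lambda>n. L * norm (K (z n))) \<longlonglongrightarrow> L * norm \<xi>"
        by (intro tendsto_intros lim)+
      show "\<forall>\<^sub>F n in sequentially. inner \<xi> (K (z n)) \<le> L * norm (K (z n))"
        using rep[OF zZ] bnd[OF zZ] by (simp add: always_eventually)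
    qed
    then have "norm \<xi> * norm \<xi> \<le> L * norm \<xi>"
      by (simp add: norm_eq_sqrt_inner)
    then show ?thesis
      using \<open>0 \<le> L\<close> by (cases "norm \<xi> = 0") (auto simp: mult_le_cancel_right)
  qed
  then show thesis
    using that zZ lim rep by blast
qed

section \<open>The inverse of the second derivative\<close>

definition antider :: "(real \<Rightarrow> real) \<Rightarrow> real \<Rightarrow> real" where
  "antider f x = (\<integral>y. (if y \<le> x then f y else 0) \<partial>torus)"

definition antider0 :: "(real \<Rightarrow> real) \<Rightarrow> real \<Rightarrow> real" where
  "antider0 f x = antider f x - (\<integral>y. antider f y \<partial>torus)"

lemma ident_measurable_torus [measurable]: "(\<lambda>x. x) \<in> borel_measurable torus"
  using id_borel_measurable_lebesgue_on[of "{0..1 :: real}"] by (simp add: torus_def id_def)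

lemma continuous_measurable_torus: "continuous_on UNIV f \<Longrightarrow> f \<in> borel_measurable torus"
  for f :: "real \<Rightarrow> real"
  using measurable_compose[OF ident_measurable_torus borel_measurable_continuous_onI] by simp

lemma bounded_integrable_torus:
  assumes "f \<in> borel_measurable torus" "AE x in torus. \<bar>f x\<bar> \<le> (B :: real)"
  shows "integrable torus f"
  using assms by (intro Bochner_Integration.integrable_bound[OF integrable_torus_const[of B]]) (auto elim!: eventually_mono)

lemma bounded_L2_torus:
  assumes "f \<in> borel_measurable torus" "AE x in torus. \<bar>f x\<bar> \<le> (B :: real)"
  shows "f \<in> L2_torus"
proof -
  have "integrable torus (\<lambda>x. (f x)\<^sup>2)"
  proof (rule bounded_integrable_torus)
    show "AE x in torus. \<bar>(f x)\<^sup>2\<bar> \<le> \<bar>B\<bar>\<^sup>2"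
      using assms(2)
    proof eventually_elim
      case (elim x)
      then show ?case
        using power_mono[of "\<bar>f x\<bar>" "\<bar>B\<bar>" 2] by simp
    qed
  qed (use assms in measurable)
  then show ?thesis
    using assms by (simp add: L2_torus_def)
qed

lemma cutoff_integrable:
  assumes "integrable torus f"
  shows "integrable torus (\<lambda>y. if y \<le> x then f y else 0 :: real)"
  using assms by (intro Bochner_Integration.integrable_bound[OF assms]) auto

lemma antider_bound:
  assumes "integrable torus f"
  shows "\<bar>antider f x\<bar> \<le> (\<integral>y. \<bar>f y\<bar> \<partial>torus)"
proof -
  have "\<bar>antider f x\<bar> \<le> (\<integral>y. \<bar>if y \<le> x then f y else 0\<bar> \<partial>torus)"
    unfolding antider_def by (rule integral_abs_bound)
  also have "\<dots> \<le> (\<integral>y. \<bar>f y\<bar> \<partial>torus)"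
    using assms cutoff_integrable[OF assms] by (intro integral_mono) auto
  finally show ?thesis .
qed

lemma sigma_finite_torus: "sigma_finite_measure torus"
  using finite_measure_torus by (rule finite_measure.axioms)

lemma triangle_measurable:
  assumes [measurable]: "f \<in> borel_measurable torus" "g \<in> borel_measurable torus"
  shows "(\<lambda>(x, y). (if y \<le> x then f y else 0) * g x :: real) \<in> borel_measurable (torus \<Otimes>\<^sub>M torus)"
  by measurable

lemma antider_measurable:
  assumes "f \<in> borel_measurable torus"
  shows "antider f \<in> borel_measurable torus"
proof -
  interpret sigma_finite_measure torus
    by (rule sigma_finite_torus)
  have "(\<lambda>(x, y). (if y \<le> x then f y else 0) * 1) \<in> borel_measurable (torus \<Otimes>\<^sub>M torus)"
    using assms by (intro triangle_measurable) auto
  then show ?thesis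
    unfolding antider_def[abs_def] by (intro borel_measurable_lebesgue_integral) simp
qed

lemma antider_integrable:
  assumes "integrable torus f"
  shows "integrable torus (antider f)"
  using assms antider_bound[OF assms]
  by (intro bounded_integrable_torus antider_measurable) auto

lemma product_integrable:
  assumes f: "integrable torus f" and g: "integrable torus g"
  shows "integrable (torus \<Otimes>\<^sub>M torus) (\<lambda>(x, y). (if y \<le> x then f y else 0) * g x :: real)"
proof -
  interpret pair_sigma_finite torus torus
    by (intro pair_sigma_finite.intro sigma_finite_torus)
  have "integrable (torus \<Otimes>\<^sub>M torus) (\<lambda>(x, y). g x * f y)"
  proof (rule Fubini_integrable)
    show "(\<lambda>(x, y). g x * f y) \<in> borel_measurable (torus \<Otimes>\<^sub>M torus)"
      using f g by measurable
    show "integrable torus (\<lambda>x. \<integral>y. norm (case (x, y) of (x, y) \<Rightarrow> g x * f y) \<partial>torus)"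
      using g by (simp add: abs_mult)
    show "AE x in torus. integrable torus (\<lambda>y. case (x, y) of (x, y) \<Rightarrow> g x * f y)"
      using f by simp
  qed
  then show ?thesis
    by (rule Bochner_Integration.integrable_bound)
      (use f g in \<open>auto intro!: triangle_measurable AE_I2 split: prod.splits simp: abs_mult\<close>)
qed

lemma AE_torus_neq: "AE x in torus. x \<noteq> c"
proof -
  have "{c} \<inter> {0..1} \<in> null_sets torus"
    unfolding torus_def
    by (rule null_sets_restrict_space[THEN iffD2]) (auto simp flip: negligible_iff_null_sets intro: negligible_subset[of "{c}"])
  then show ?thesis
    by (rule AE_I') auto
qed

lemma antider_antisym:
  assumes f: "integrable torus f" and g: "integrable torus g" and g0: "(\<integral>x. g x \<partial>torus) = 0"
  shows "(\<integral>x. antider f x * g x \<partial>torus) = - (\<integral>x. f x * antider g x \<partial>torus)"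
proof -
  interpret pair_sigma_finite torus torus
    by (intro pair_sigma_finite.intro sigma_finite_torus)
  have "(\<integral>x. antider f x * g x \<partial>torus) = (\<integral>x. (\<integral>y. (if y \<le> x then f y else 0) * g x \<partial>torus) \<partial>torus)"
    by (simp add: antider_def)
  also have "\<dots> = (\<integral>y. (\<integral>x. (if y \<le> x then f y else 0) * g x \<partial>torus) \<partial>torus)"
    using Fubini_integral[OF product_integrable[OF f g]] by simp
  also have "\<dots> = (\<integral>y. - (f y * antider g y) \<partial>torus)"
  proof (rule Bochner_Integration.integral_cong[OF refl])
    fix y
    have "(\<integral>x. (if y \<le> x then f y else 0) * g x \<partial>torus) = (\<integral>x. f y * (g x - (if x \<le> y then g x else 0)) \<partial>torus)"
    proof (rule integral_cong_AE)
      show "AE x in torus. (if y \<le> x then f y else 0) * g x = f y * (g x - (if x \<le> y then g x else 0))"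
        using AE_torus_neq[of y] by eventually_elim auto
    qed (use f g in measurable)
    also have "\<dots> = f y * ((\<integral>x. g x \<partial>torus) - antider g y)"
      using g cutoff_integrable[OF g] by (simp add: antider_def)
    finally show "(\<integral>x. (if y \<le> x then f y else 0) * g x \<partial>torus) = - (f y * antider g y)"
      using g0 by simp
  qed
  finally show ?thesis
    by simp
qed

lemma antider0_measurable: "f \<in> borel_measurable torus \<Longrightarrow> antider0 f \<in> borel_measurable torus"
  unfolding antider0_def[abs_def] using antider_measurable[of f] by simp

lemma antider0_bound:
  assumes f: "integrable torus f"
  shows "\<bar>antider0 f x\<bar> \<le> 2 * (\<integral>y. \<bar>f y\<bar> \<partial>torus)"
proof -
  have "\<bar>\<integral>y. antider f y \<partial>torus\<bar> \<le> (\<integral>y. \<bar>antider f y\<bar> \<partial>torus)"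
    by (rule integral_abs_bound)
  also have "\<dots> \<le> (\<integral>y. (\<integral>y. \<bar>f y\<bar> \<partial>torus) \<partial>torus)"
    using antider_integrable[OF f] antider_bound[OF f] by (intro integral_mono) auto
  also have "\<dots> = (\<integral>y. \<bar>f y\<bar> \<partial>torus)"
    by (simp add: measure_torus)
  finally show ?thesis
    using antider_bound[OF f, of x] unfolding antider0_def by linarith
qed

lemma antider0_H_carrier:
  assumes f: "integrable torus f"
  shows "antider0 f \<in> H_carrier"
proof -
  have "antider0 f \<in> L2_torus"
    using f antider0_bound[OF f] by (intro bounded_L2_torus antider0_measurable) auto
  moreover have "(\<integral>x. antider0 f x \<partial>torus) = 0"
    unfolding antider0_def using antider_integrable[OF f] by (simp add: measure_torus)
  ultimately show ?thesis
    by (simp add: H_carrier_def)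
qed

definition antideriv_H :: "H \<Rightarrow> H" where
  "antideriv_H u = abs_H (antider0 (rep_H u))"

lemma rep_antideriv_H: "AE x in torus. rep_H (antideriv_H u) x = antider0 (rep_H u) x"
  unfolding antideriv_H_def by (rule rep_H_abs[OF antider0_H_carrier[OF rep_H_integrable]])

lemma antideriv_H_bound: "AE x in torus. \<bar>rep_H (antideriv_H u) x\<bar> \<le> 2 * norm u"
  using rep_antideriv_H[of u]
proof eventually_elim
  case (elim x)
  then show ?case
    using antider0_bound[OF rep_H_integrable, of u x] rep_H_L1_le_norm[of u] by simp
qed

lemma inner_antideriv_H: "inner (antideriv_H u) v = - inner u (antideriv_H v)"
proof -
  have *: "inner (antideriv_H u) v = (\<integral>x. antider (rep_H u) x * rep_H v x \<partial>torus)" for u v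
  proof -
    note [measurable] = antider_measurable[OF rep_H_measurable]
    define c where "c = (\<integral>y. antider (rep_H u) y \<partial>torus)"
    have int: "integrable torus (\<lambda>x. antider (rep_H u) x * rep_H v x)"
    proof (rule L2_mult_integrable[OF _ rep_H_L2], rule bounded_L2_torus)
      show "AE x in torus. \<bar>antider (rep_H u) x\<bar> \<le> (\<integral>y. \<bar>rep_H u y\<bar> \<partial>torus)"
        using antider_bound[OF rep_H_integrable] by simp
    qed (simp add: antider_measurable)
    have "inner (antideriv_H u) v = (\<integral>x. antider (rep_H u) x * rep_H v x - c * rep_H v x \<partial>torus)"
      unfolding inner_H_eq using rep_antideriv_H[of u]
      by (intro integral_cong_AE) (measurable, auto elim!: eventually_mono simp: antider0_def c_def left_diff_distrib)
    also have "\<dots> = (\<integral>x. antider (rep_H u) x * rep_H v x \<partial>torus)"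
      using int rep_H_integrable[of v] by (simp add: rep_H_mean_zero)
    finally show ?thesis .
  qed
  have "inner u (antideriv_H v) = (\<integral>x. antider (rep_H v) x * rep_H u x \<partial>torus)"
    unfolding inner_commute[of u] by (rule *)
  also have "\<dots> = - (\<integral>x. rep_H v x * antider (rep_H u) x \<partial>torus)"
    by (intro antider_antisym rep_H_integrable rep_H_mean_zero)
  also have "\<dots> = - inner (antideriv_H u) v"
    unfolding * by (simp add: mult.commute)
  finally show ?thesis
    by simp
qed

lemma linear_antideriv_H: "linear antideriv_H"
proof (rule linearI)
  fix u v :: H and c :: real
  show "antideriv_H (u + v) = antideriv_H u + antideriv_H v"
    by (subst vector_eq_rdot[symmetric]) (auto simp: inner_antideriv_H inner_add_left)
  show "antideriv_H (c *\<^sub>R u) = c *\<^sub>R antideriv_H u"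
    by (subst vector_eq_rdot[symmetric]) (auto simp: inner_antideriv_H)
qed

lemma torus_test_deriv: "torus_test \<psi> \<Longrightarrow> torus_test (deriv \<psi>)"
  unfolding torus_test_def
proof (intro conjI allI)
  fix k x assume \<psi>: "(\<forall>x. \<psi> (x + 1) = \<psi> x) \<and> (\<forall>k x. (deriv ^^ k) \<psi> differentiable at x)"
  show "deriv \<psi> (x + 1) = deriv \<psi> x"
  proof -
    have "(\<psi> has_field_derivative deriv \<psi> (x + 1)) (at (x + 1))"
      using \<psi>[THEN conjunct2, rule_format, of 0 "x + 1"] by (simp add: DERIV_deriv_iff_real_differentiable)
    then have "((\<lambda>x. \<psi> (x + 1)) has_field_derivative deriv \<psi> (x + 1)) (at x)"
      by (simp add: DERIV_shift)
    then show ?thesis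
      using \<psi> by (auto intro: DERIV_imp_deriv[symmetric])
  qed
  show "(deriv ^^ k) (deriv \<psi>) differentiable at x"
    using \<psi>[THEN conjunct2, rule_format, of "Suc k" x] by (simp only: funpow_Suc_right o_apply)
qed

lemma torus_test_DERIV: "torus_test \<psi> \<Longrightarrow> (\<psi> has_field_derivative deriv \<psi> x) (at x)"
  unfolding torus_test_def DERIV_deriv_iff_real_differentiable by (metis funpow_0)

lemma torus_test_continuous: "torus_test \<psi> \<Longrightarrow> continuous_on S \<psi>"
  using torus_test_DERIV by (meson DERIV_isCont continuous_at_imp_continuous_on)

lemma torus_test_L2: "torus_test \<psi> \<Longrightarrow> \<psi> \<in> L2_torus"
proof -
  assume \<psi>: "torus_test \<psi>"
  have "compact (\<psi> ` {0..1})"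
    using \<psi> by (intro compact_continuous_image torus_test_continuous) auto
  then obtain B where B: "\<And>x. x \<in> {0..1} \<Longrightarrow> \<bar>\<psi> x\<bar> \<le> B"
    using compact_imp_bounded bounded_iff by (metis image_eqI real_norm_def)
  then show ?thesis
    using \<psi> by (intro bounded_L2_torus continuous_measurable_torus torus_test_continuous AE_I2) auto
qed

lemma antider_deriv_test:
  assumes \<psi>: "torus_test \<psi>" and x: "x \<in> {0..1}"
  shows "antider (deriv \<psi>) x = \<psi> x - \<psi> 0"
proof -
  have int: "integrable torus (deriv \<psi>)"
    by (intro L2_integrable torus_test_L2 torus_test_deriv \<psi>)
  have "antider (deriv \<psi>) x = integral {0..1} (\<lambda>y. if y \<le> x then deriv \<psi> y else 0)"
    using cutoff_integrable[OF int, of x] unfolding antider_def torus_def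
    by (intro lebesgue_integral_eq_integral) auto
  also have "\<dots> = integral {0..1} (\<lambda>y. if y \<in> {0..x} then deriv \<psi> y else 0)"
    by (intro Henstock_Kurzweil_Integration.integral_cong) auto
  also have "\<dots> = integral {0..x} (deriv \<psi>)"
  proof -
    have eq: "{0..x} \<inter> {0..1} = {0..x}"
      using x by auto
    show ?thesis
      unfolding Henstock_Kurzweil_Integration.integral_restrict_Int eq ..
  qed
  also have "\<dots> = \<psi> x - \<psi> 0"
    using x torus_test_DERIV[OF \<psi>]
    by (intro integral_unique fundamental_theorem_of_calculus)
       (auto simp: has_real_derivative_iff_has_vector_derivative[symmetric] intro: has_field_derivative_at_within)
  finally show ?thesis .
qed

lemma deriv_test_H_carrier:
  assumes \<psi>: "torus_test \<psi>"
  shows "deriv \<psi> \<in> H_carrier"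
proof -
  have "(\<integral>x. deriv \<psi> x \<partial>torus) = antider (deriv \<psi>) 1"
    unfolding antider_def by (rule Bochner_Integration.integral_cong) auto
  also have "\<dots> = \<psi> 1 - \<psi> 0"
    using \<psi> by (rule antider_deriv_test) simp
  also have "\<dots> = 0"
    using \<psi> unfolding torus_test_def by (metis add_0 diff_self)
  finally show ?thesis
    using torus_test_L2[OF torus_test_deriv[OF \<psi>]] by (simp add: H_carrier_def)
qed

lemma integral_antideriv_H_test:
  assumes \<psi>: "torus_test \<psi>"
  shows "(\<integral>x. rep_H (antideriv_H u) x * deriv \<psi> x \<partial>torus) = - (\<integral>x. rep_H u x * \<psi> x \<partial>torus)"
proof -
  define d where "d = abs_H (deriv \<psi>)"
  have d: "AE x in torus. rep_H d x = deriv \<psi> x"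
    unfolding d_def by (rule rep_H_abs[OF deriv_test_H_carrier[OF \<psi>]])
  have meas [measurable]: "deriv \<psi> \<in> borel_measurable torus" "\<psi> \<in> borel_measurable torus"
    using torus_test_L2[OF \<psi>] torus_test_L2[OF torus_test_deriv[OF \<psi>]] by (auto simp: L2_torus_def)
  define c where "c = \<psi> 0 + (\<integral>y. antider (rep_H d) y \<partial>torus)"
  have anti: "antider (rep_H d) x = antider (deriv \<psi>) x" for x
    unfolding antider_def using d by (intro integral_cong_AE) (auto elim!: eventually_mono)
  have "(\<integral>x. rep_H (antideriv_H u) x * deriv \<psi> x \<partial>torus) = inner (antideriv_H u) d"
    unfolding inner_H_eq using d by (intro integral_cong_AE) (auto elim!: eventually_mono)
  also have "\<dots> = - inner u (antideriv_H d)"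
    by (rule inner_antideriv_H)
  also have "inner u (antideriv_H d) = (\<integral>x. rep_H u x * \<psi> x - c * rep_H u x \<partial>torus)"
    unfolding inner_H_eq
  proof (intro integral_cong_AE)
    have "AE x in torus. x \<in> {0..1}"
      by (rule AE_I2) simp
    with rep_antideriv_H[of d]
    show "AE x in torus. rep_H u x * rep_H (antideriv_H d) x = rep_H u x * \<psi> x - c * rep_H u x"
    proof eventually_elim
      case (elim x)
      have "rep_H (antideriv_H d) x = \<psi> x - c"
        using elim anti[of x] antider_deriv_test[OF \<psi>, of x] by (simp add: antider0_def c_def)
      then show ?case
        by (simp add: right_diff_distrib mult.commute)
    qed
  qed measurable
  also have "\<dots> = (\<integral>x. rep_H u x * \<psi> x \<partial>torus)"
    using L2_mult_integrable[OF rep_H_L2[of u] torus_test_L2[OF \<psi>]] rep_H_integrable[of u]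
    by (simp add: rep_H_mean_zero)
  finally show ?thesis .
qed

definition inv_dxx :: "H \<Rightarrow> H" where
  "inv_dxx u = antideriv_H (antideriv_H u)"

lemma linear_inv_dxx: "linear inv_dxx"
  using linear_compose[OF linear_antideriv_H linear_antideriv_H] by (simp add: inv_dxx_def[abs_def] o_def)

lemma inner_inv_dxx: "inner (inv_dxx u) v = inner u (inv_dxx v)"
  by (simp add: inv_dxx_def inner_antideriv_H)

lemma norm_antideriv_H_le: "norm (antideriv_H u) \<le> 2 * norm u"
  by (rule norm_H_le_of_AE_bound[OF antideriv_H_bound]) simp

lemma inv_dxx_bound: "AE x in torus. \<bar>rep_H (inv_dxx u) x\<bar> \<le> 4 * norm u"
  using antideriv_H_bound[of "antideriv_H u"]
proof eventually_elim
  case (elim x)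
  then show ?case
    using norm_antideriv_H_le[of u] by (simp add: inv_dxx_def)
qed

lemma norm_inv_dxx_le: "norm (inv_dxx u) \<le> 4 * norm u"
  by (rule norm_H_le_of_AE_bound[OF inv_dxx_bound]) simp

lemma integral_inv_dxx_test:
  assumes "torus_test \<psi>"
  shows "(\<integral>x. rep_H (inv_dxx u) x * deriv (deriv \<psi>) x \<partial>torus) = (\<integral>x. rep_H u x * \<psi> x \<partial>torus)"
  unfolding inv_dxx_def
  by (simp add: integral_antideriv_H_test[OF torus_test_deriv[OF assms]] integral_antideriv_H_test[OF assms])

lemma weak_deriv_inv_dxx:
  "weak_deriv 1 (rep_H (inv_dxx u)) (rep_H (antideriv_H u))"
  "weak_deriv 2 (rep_H (inv_dxx u)) (rep_H u)"
  using rep_H_integrable integral_antideriv_H_test[of _ "antideriv_H u"] integral_inv_dxx_test[of _ u]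
  by (auto simp: weak_deriv_def inv_dxx_def numeral_2_eq_2)

section \<open>Density of trigonometric polynomials\<close>

lemma deriv_funpow_trig:
  "\<exists>a' b'. (deriv ^^ n) (\<lambda>x :: real. a * cos (c * x) + b * sin (c * x)) = (\<lambda>x. a' * cos (c * x) + b' * sin (c * x))"
proof (induction n arbitrary: a b)
  case (Suc n)
  have "deriv (\<lambda>x :: real. a * cos (c * x) + b * sin (c * x)) = (\<lambda>x. (b * c) * cos (c * x) + (- (a * c)) * sin (c * x))"
    by (rule ext, rule DERIV_imp_deriv) (auto intro!: derivative_eq_intros)
  then show ?case
    using Suc.IH[of "b * c" "- (a * c)"] by (simp only: funpow_Suc_right o_apply)
qed auto

lemma torus_test_trig:
  "torus_test (\<lambda>x. a * cos (2 * pi * real_of_int k * x) + b * sin (2 * pi * real_of_int k * x))"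
  unfolding torus_test_def
proof (intro conjI allI)
  fix n :: nat and x :: real
  have "cos (2 * pi * real_of_int k * (x + 1)) = cos (2 * pi * real_of_int k * x)"
    "sin (2 * pi * real_of_int k * (x + 1)) = sin (2 * pi * real_of_int k * x)"
    using cos_int_2pin[of k] sin_int_2pin[of k] by (simp_all add: distrib_left cos_add sin_add)
  then show "a * cos (2 * pi * real_of_int k * (x + 1)) + b * sin (2 * pi * real_of_int k * (x + 1))
     = a * cos (2 * pi * real_of_int k * x) + b * sin (2 * pi * real_of_int k * x)"
    by simp
  obtain a' b' where eq: "(deriv ^^ n) (\<lambda>x. a * cos (2 * pi * real_of_int k * x) + b * sin (2 * pi * real_of_int k * x))
      = (\<lambda>x. a' * cos (2 * pi * real_of_int k * x) + b' * sin (2 * pi * real_of_int k * x))"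
    using deriv_funpow_trig by blast
  show "(deriv ^^ n) (\<lambda>x. a * cos (2 * pi * real_of_int k * x) + b * sin (2 * pi * real_of_int k * x)) differentiable at x"
    unfolding eq real_differentiable_def by (auto intro!: exI derivative_eq_intros)
qed

inductive_set trig_poly :: "(real \<Rightarrow> real) set" where
  trig_cos: "(\<lambda>x. cos (2 * pi * real_of_int k * x)) \<in> trig_poly"
| trig_sin: "(\<lambda>x. sin (2 * pi * real_of_int k * x)) \<in> trig_poly"
| trig_add: "p \<in> trig_poly \<Longrightarrow> q \<in> trig_poly \<Longrightarrow> (\<lambda>x. p x + q x) \<in> trig_poly"
| trig_cmult: "p \<in> trig_poly \<Longrightarrow> (\<lambda>x. c * p x) \<in> trig_poly"

lemma trig_poly_continuous: "p \<in> trig_poly \<Longrightarrow> continuous_on S p"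
  by (induction rule: trig_poly.induct) (auto intro!: continuous_intros)

lemma trig_const: "(\<lambda>x. c) \<in> trig_poly"
  using trig_cmult[OF trig_cos[of 0], of c] by simp

lemma trig_cos_mult: "p \<in> trig_poly \<Longrightarrow> (\<lambda>x. cos (2 * pi * real_of_int k * x) * p x) \<in> trig_poly"
proof (induction rule: trig_poly.induct)
  case (trig_cos j)
  have eq: "(\<lambda>x. cos (2 * pi * real_of_int k * x) * cos (2 * pi * real_of_int j * x)) =
    (\<lambda>x. (1/2) * (cos (2 * pi * real_of_int (k - j) * x) + cos (2 * pi * real_of_int (k + j) * x)))"
  proof (rule ext)
    fix x :: real
    define A B where "A = 2 * pi * real_of_int k * x" and "B = 2 * pi * real_of_int j * x"
    have e: "2 * pi * real_of_int (k - j) * x = A - B" "2 * pi * real_of_int (k + j) * x = A + B"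
      by (simp_all add: A_def B_def algebra_simps)
    show "cos (2 * pi * real_of_int k * x) * cos (2 * pi * real_of_int j * x) = (1/2) * (cos (2 * pi * real_of_int (k - j) * x) + cos (2 * pi * real_of_int (k + j) * x))"
      unfolding e A_def[symmetric] B_def[symmetric] by (simp add: cos_add cos_diff sin_add sin_diff field_simps)
  qed
  show ?case
    unfolding eq by (intro trig_poly.intros)
next
  case (trig_sin j)
  have eq: "(\<lambda>x. cos (2 * pi * real_of_int k * x) * sin (2 * pi * real_of_int j * x)) =
    (\<lambda>x. (1/2) * (sin (2 * pi * real_of_int (k + j) * x) + (- 1) * sin (2 * pi * real_of_int (k - j) * x)))"
  proof (rule ext)
    fix x :: real
    define A B where "A = 2 * pi * real_of_int k * x" and "B = 2 * pi * real_of_int j * x"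
    have e: "2 * pi * real_of_int (k - j) * x = A - B" "2 * pi * real_of_int (k + j) * x = A + B"
      by (simp_all add: A_def B_def algebra_simps)
    show "cos (2 * pi * real_of_int k * x) * sin (2 * pi * real_of_int j * x) = (1/2) * (sin (2 * pi * real_of_int (k + j) * x) + (- 1) * sin (2 * pi * real_of_int (k - j) * x))"
      unfolding e A_def[symmetric] B_def[symmetric] by (simp add: cos_add cos_diff sin_add sin_diff field_simps)
  qed
  show ?case
    unfolding eq by (intro trig_poly.intros)
next
  case (trig_add p q)
  then show ?case
    using trig_poly.trig_add by (simp add: distrib_left)
next
  case (trig_cmult p c)
  then show ?case
    using trig_poly.trig_cmult[OF trig_cmult.IH, of c] by (simp add: mult.left_commute)
qed

lemma trig_sin_mult: "p \<in> trig_poly \<Longrightarrow> (\<lambda>x. sin (2 * pi * real_of_int k * x) * p x) \<in> trig_poly"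
proof (induction rule: trig_poly.induct)
  case (trig_cos j)
  show ?case
    using trig_cos_mult[OF trig_poly.trig_sin[of k], of j] by (simp add: mult.commute)
next
  case (trig_sin j)
  have eq: "(\<lambda>x. sin (2 * pi * real_of_int k * x) * sin (2 * pi * real_of_int j * x)) =
    (\<lambda>x. (1/2) * (cos (2 * pi * real_of_int (k - j) * x) + (- 1) * cos (2 * pi * real_of_int (k + j) * x)))"
  proof (rule ext)
    fix x :: real
    define A B where "A = 2 * pi * real_of_int k * x" and "B = 2 * pi * real_of_int j * x"
    have e: "2 * pi * real_of_int (k - j) * x = A - B" "2 * pi * real_of_int (k + j) * x = A + B"
      by (simp_all add: A_def B_def algebra_simps)
    show "sin (2 * pi * real_of_int k * x) * sin (2 * pi * real_of_int j * x) = (1/2) * (cos (2 * pi * real_of_int (k - j) * x) + (- 1) * cos (2 * pi * real_of_int (k + j) * x))"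
      unfolding e A_def[symmetric] B_def[symmetric] by (simp add: cos_add cos_diff sin_add sin_diff field_simps)
  qed
  show ?case
    unfolding eq by (intro trig_poly.intros)
next
  case (trig_add p q)
  then show ?case
    using trig_poly.trig_add by (simp add: distrib_left)
next
  case (trig_cmult p c)
  then show ?case
    using trig_poly.trig_cmult[OF trig_cmult.IH, of c] by (simp add: mult.left_commute)
qed

lemma trig_mult:
  assumes "p \<in> trig_poly" "q \<in> trig_poly"
  shows "(\<lambda>x. p x * q x) \<in> trig_poly"
  using assms(1)
proof (induction rule: trig_poly.induct)
  case (trig_cos k)
  show ?case
    by (rule trig_cos_mult[OF assms(2)])
next
  case (trig_sin k)
  show ?case
    by (rule trig_sin_mult[OF assms(2)])
next
  case (trig_add p p')
  then show ?case
    using trig_poly.trig_add by (simp add: distrib_right)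
next
  case (trig_cmult p c)
  then show ?case
    using trig_poly.trig_cmult[OF trig_cmult.IH, of c] by (simp add: mult.assoc)
qed

lemma trig_approximation:
  fixes c :: "real \<Rightarrow> real"
  assumes c: "continuous_on {0..1} c" "c 0 = c 1" and "e > 0"
  shows "\<exists>p\<in>trig_poly. \<forall>x\<in>{0..1}. \<bar>c x - p x\<bar> < e"
proof -
  define F where "F = c \<circ> (\<lambda>z. Arg2pi z / (2 * pi))"
  have "homotopic_loops UNIV c c"
    using c by (simp add: homotopic_loops_refl path_def pathfinish_def pathstart_def)
  then have "continuous_on (sphere 0 1) F"
    unfolding F_def using homotopic_loops_imp_homotopic_circlemaps homotopic_with_imp_continuous by blast
  then obtain g where g: "real_polynomial_function g" "\<And>z. z \<in> sphere 0 1 \<Longrightarrow> \<bar>F z - g z\<bar> < e"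
    using Stone_Weierstrass_real_polynomial_function[of "sphere 0 1" F e] \<open>e > 0\<close> by auto
  define p where "p x = g (cis (2 * pi * x))" for x
  have "(\<lambda>x. g (cis (2 * pi * x))) \<in> trig_poly"
    using g(1)
  proof (induction rule: real_polynomial_function.induct)
    case (linear f)
    interpret bounded_linear f
      by (rule linear)
    have "f (cis \<theta>) = f 1 * cos \<theta> + f \<i> * sin \<theta>" for \<theta>
    proof -
      have "cis \<theta> = cos \<theta> *\<^sub>R 1 + sin \<theta> *\<^sub>R \<i>"
        by (simp add: complex_eq_iff)
      then show ?thesis
        by (simp add: add scaleR)
    qed
    then show ?case
      using trig_add[OF trig_cmult[OF trig_cos[of 1], of "f 1"] trig_cmult[OF trig_sin[of 1], of "f \<i>"]] by simp
  next
    case (const c)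
    show ?case
      by (rule trig_const)
  next
    case (add f g)
    then show ?case
      by (intro trig_add)
  next
    case (mult f g)
    then show ?case
      by (intro trig_mult)
  qed
  then have "p \<in> trig_poly"
    by (simp add: p_def[abs_def])
  moreover have lt: "\<bar>c x - p x\<bar> < e" if "0 \<le> x" "x < 1" for x
  proof -
    have "Arg2pi (cis (2 * pi * x)) = 2 * pi * x"
      using that by (intro Arg2pi_unique[of 1]) (auto simp: cis_conv_exp)
    then have "F (cis (2 * pi * x)) = c x"
      by (simp add: F_def)
    then show ?thesis
      using g(2)[of "cis (2 * pi * x)"] by (simp add: p_def)
  qed
  moreover have "\<bar>c 1 - p 1\<bar> < e"
    using lt[of 0] c(2) by (simp add: p_def)
  ultimately show ?thesis
  proof -
    have "\<bar>c x - p x\<bar> < e" if "x \<in> {0..1}" for x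
      using that lt[of x] \<open>\<bar>c 1 - p 1\<bar> < e\<close> by (cases "x = 1") auto
    then show ?thesis
      using \<open>p \<in> trig_poly\<close> by blast
  qed
qed

lemma AE_torus_not_negligible: "negligible N \<Longrightarrow> AE x in torus. x \<notin> N"
  unfolding torus_def
  by (subst AE_restrict_space_iff) (auto simp: negligible_iff_null_sets intro: AE_not_in eventually_mono)

lemma H_eq_0_if_orthogonal_trig:
  assumes orth: "\<And>p. p \<in> trig_poly \<Longrightarrow> (\<integral>x. rep_H u x * p x \<partial>torus) = 0"
  shows "u = 0"
proof -
  have loops: "(\<integral>x. rep_H u x * c x \<partial>torus) = 0" if c: "continuous_on UNIV c" "c 0 = c 1" for c
  proof -
    have bnd: "\<bar>\<integral>x. rep_H u x * c x \<partial>torus\<bar> \<le> e * (\<integral>x. \<bar>rep_H u x\<bar> \<partial>torus)" if e: "e > 0" for e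
    proof -
      obtain p where p: "p \<in> trig_poly" "\<And>x. x \<in> {0..1} \<Longrightarrow> \<bar>c x - p x\<bar> < e"
        using trig_approximation[OF continuous_on_subset[OF c(1)] c(2) e] by auto
      have L2: "f \<in> L2_torus" if f: "continuous_on UNIV f" for f :: "real \<Rightarrow> real"
      proof -
        have "compact (f ` {0..1})"
          using f by (intro compact_continuous_image) (auto intro: continuous_on_subset)
        then obtain B where "\<And>x. x \<in> {0..1} \<Longrightarrow> \<bar>f x\<bar> \<le> B"
          using compact_imp_bounded bounded_iff by (metis image_eqI real_norm_def)
        then show ?thesis
          using f by (intro bounded_L2_torus continuous_measurable_torus AE_I2) auto
      qed
      have int: "integrable torus (\<lambda>x. rep_H u x * c x)" "integrable torus (\<lambda>x. rep_H u x * p x)"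
        using c p trig_poly_continuous[OF p(1)] by (auto intro!: L2_mult_integrable rep_H_L2 L2)
      have "(\<integral>x. rep_H u x * c x \<partial>torus) = (\<integral>x. rep_H u x * c x - rep_H u x * p x \<partial>torus)"
        using int orth[OF p(1)] by simp
      then have "\<bar>\<integral>x. rep_H u x * c x \<partial>torus\<bar> \<le> (\<integral>x. \<bar>rep_H u x * c x - rep_H u x * p x\<bar> \<partial>torus)"
        by (simp add: integral_abs_bound)
      also have "\<dots> \<le> (\<integral>x. e * \<bar>rep_H u x\<bar> \<partial>torus)"
      proof (rule integral_mono)
        show "\<bar>rep_H u x * c x - rep_H u x * p x\<bar> \<le> e * \<bar>rep_H u x\<bar>" if "x \<in> space torus" for x
        proof -
          have "\<bar>rep_H u x * c x - rep_H u x * p x\<bar> = \<bar>rep_H u x\<bar> * \<bar>c x - p x\<bar>"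
            by (simp add: right_diff_distrib flip: abs_mult)
          also have "\<dots> \<le> \<bar>rep_H u x\<bar> * e"
            using p(2)[of x] that by (intro mult_left_mono) auto
          finally show ?thesis
            by (simp add: mult.commute)
        qed
      qed (use int rep_H_integrable in auto)
      finally show ?thesis
        using rep_H_integrable by simp
    qed
    define I where "I = (\<integral>x. \<bar>rep_H u x\<bar> \<partial>torus)"
    have "I \<ge> 0"
      by (simp add: I_def)
    have "\<bar>\<integral>x. rep_H u x * c x \<partial>torus\<bar> \<le> 0"
    proof (rule field_le_epsilon)
      fix e :: real assume "e > 0"
      have "\<bar>\<integral>x. rep_H u x * c x \<partial>torus\<bar> \<le> e / (I + 1) * I"
      proof -
        have "0 < e / (I + 1)"
          using \<open>e > 0\<close> \<open>I \<ge> 0\<close> by (intro divide_pos_pos) auto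
        then show ?thesis
          unfolding I_def by (rule bnd)
      qed
      also have "\<dots> \<le> e / (I + 1) * (I + 1)"
        using \<open>e > 0\<close> \<open>I \<ge> 0\<close> by (intro mult_left_mono) auto
      also have "\<dots> = e"
        using \<open>I \<ge> 0\<close> by simp
      finally show "\<bar>\<integral>x. rep_H u x * c x \<partial>torus\<bar> \<le> 0 + e"
        by simp
    qed
    then show ?thesis
      by simp
  qed
  have "(\<lambda>x. sgn (rep_H u x)) \<in> borel_measurable (lebesgue_on {0..1})"
    using rep_H_measurable[of u] by (simp flip: torus_def)
  then have "(\<lambda>x. sgn (rep_H u x)) measurable_on {0..1}"
    by (subst measurable_on_iff_borel_measurable) auto
  then obtain N g where "negligible N" and g: "\<And>n. continuous_on UNIV (g n)"
    and lim: "\<And>x. x \<notin> N \<Longrightarrow> (\<lambda>n. g n x) \<longlonglongrightarrow> (if x \<in> {0..1} then sgn (rep_H u x) else 0)"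
    unfolding measurable_on_def by blast
  define c where "c n x = max (-1) (min 1 (g n x)) * min 1 (real n * (x * (1 - x)))" for n :: nat and x :: real
  have cont: "continuous_on UNIV (c n)" for n
    unfolding c_def by (intro continuous_intros g)
  have c_bound: "\<bar>c n x\<bar> \<le> 1" if "x \<in> {0..1}" for n x
  proof -
    have "\<bar>max (-1) (min 1 (g n x))\<bar> \<le> 1" "\<bar>min 1 (real n * (x * (1 - x)))\<bar> \<le> 1"
      using that by (auto simp: max_def min_def)
    then show ?thesis
      unfolding c_def abs_mult by (simp add: mult_le_one)
  qed
  have c_lim: "(\<lambda>n. c n x) \<longlonglongrightarrow> sgn (rep_H u x)" if "x \<notin> N" "0 < x" "x < 1" for x
  proof -
    have "(\<lambda>n. max (-1) (min 1 (g n x))) \<longlonglongrightarrow> max (-1) (min 1 (sgn (rep_H u x)))"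
      using lim[OF that(1)] that by (intro tendsto_intros) simp
    moreover have "max (-1) (min 1 (sgn (rep_H u x))) = sgn (rep_H u x)"
      by (simp add: sgn_if)
    moreover have "(\<lambda>n. min 1 (real n * (x * (1 - x)))) \<longlonglongrightarrow> 1"
    proof (rule tendsto_eventually)
      obtain n0 :: nat where "1 / (x * (1 - x)) < real n0"
        using reals_Archimedean2 by blast
      then have "1 \<le> real n * (x * (1 - x))" if "n \<ge> n0" for n
      proof -
        have pos: "0 < x * (1 - x)"
          using \<open>0 < x\<close> \<open>x < 1\<close> by simp
        have "1 / (x * (1 - x)) \<le> real n"
          using \<open>1 / (x * (1 - x)) < real n0\<close> that by simp
        then show ?thesis
          using pos by (simp only: pos_divide_le_eq)
      qed
      then show "\<forall>\<^sub>F n in sequentially. min 1 (real n * (x * (1 - x))) = 1"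
        by (intro eventually_sequentiallyI[of n0]) (simp add: min_def)
    qed
    ultimately show ?thesis
      using tendsto_mult[of "\<lambda>n. max (-1) (min 1 (g n x))" "sgn (rep_H u x)" sequentially
          "\<lambda>n. min 1 (real n * (x * (1 - x)))" 1]
      unfolding c_def by simp
  qed
  have "(\<lambda>n. \<integral>x. rep_H u x * c n x \<partial>torus) \<longlonglongrightarrow> (\<integral>x. \<bar>rep_H u x\<bar> \<partial>torus)"
  proof (rule integral_dominated_convergence[where w = "\<lambda>x. \<bar>rep_H u x\<bar>"])
    show "integrable torus (\<lambda>x. \<bar>rep_H u x\<bar>)"
      using rep_H_integrable by simp
    show "(\<lambda>x. rep_H u x * c n x) \<in> borel_measurable torus" for n
      using continuous_measurable_torus[OF cont] by simp
    show "AE x in torus. norm (rep_H u x * c n x) \<le> \<bar>rep_H u x\<bar>" for n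
      using c_bound by (intro AE_I2) (simp add: abs_mult mult_left_le)
    have "AE x in torus. x \<in> {0..1}"
      by (rule AE_I2) simp
    with AE_torus_not_negligible[OF \<open>negligible N\<close>] AE_torus_neq[of 0] AE_torus_neq[of 1]
    show "AE x in torus. (\<lambda>n. rep_H u x * c n x) \<longlonglongrightarrow> \<bar>rep_H u x\<bar>"
    proof eventually_elim
      case (elim x)
      then have "(\<lambda>n. rep_H u x * c n x) \<longlonglongrightarrow> rep_H u x * sgn (rep_H u x)"
        by (intro tendsto_intros c_lim) auto
      then show ?case
        by (simp add: abs_sgn)
    qed
  qed simp
  moreover have "(\<integral>x. rep_H u x * c n x \<partial>torus) = 0" for n
    by (intro loops cont) (simp add: c_def)
  ultimately have "(\<integral>x. \<bar>rep_H u x\<bar> \<partial>torus) = 0"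
    using LIMSEQ_unique[OF _ tendsto_const[of 0]] by simp
  then have "AE x in torus. \<bar>rep_H u x\<bar> = 0"
    using rep_H_integrable by (subst (asm) integral_nonneg_eq_0_iff_AE) auto
  with rep_H_zero have "AE x in torus. rep_H u x = rep_H 0 x"
    by eventually_elim simp
  then show ?thesis
    by (rule H_eqI)
qed

lemma H_eq_0_if_orthogonal:
  assumes "\<And>k. (\<integral>x. rep_H u x * cos (2 * pi * real_of_int k * x) \<partial>torus) = 0"
    and "\<And>k. (\<integral>x. rep_H u x * sin (2 * pi * real_of_int k * x) \<partial>torus) = 0"
  shows "u = 0"
proof (rule H_eq_0_if_orthogonal_trig)
  fix p assume "p \<in> trig_poly"
  then have "integrable torus (\<lambda>x. rep_H u x * p x) \<and> (\<integral>x. rep_H u x * p x \<partial>torus) = 0"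
  proof (induction rule: trig_poly.induct)
    case (trig_cos k)
    then show ?case
      using assms(1) L2_mult_integrable[OF rep_H_L2[of u] torus_test_L2[OF torus_test_trig[of 1 k 0]]] by simp
  next
    case (trig_sin k)
    then show ?case
      using assms(2) L2_mult_integrable[OF rep_H_L2[of u] torus_test_L2[OF torus_test_trig[of 0 k 1]]] by simp
  next
    case (trig_add p q)
    then show ?case
      by (simp add: distrib_left)
  next
    case (trig_cmult p c)
    then show ?case
      by (simp add: mult.left_commute)
  qed
  then show "(\<integral>x. rep_H u x * p x \<partial>torus) = 0"
    by simp
qed

lemma H_eq_0_if_orthogonal_dxx_test:
  assumes "\<And>\<psi>. torus_test \<psi> \<Longrightarrow> (\<integral>x. rep_H u x * deriv (deriv \<psi>) x \<partial>torus) = 0"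
  shows "u = 0"
proof (rule H_eq_0_if_orthogonal)
  fix k :: int
  have d2: "deriv (deriv (\<lambda>x. a * cos (2 * pi * real_of_int k * x) + b * sin (2 * pi * real_of_int k * x))) =
    (\<lambda>x. - (2 * pi * real_of_int k)\<^sup>2 * (a * cos (2 * pi * real_of_int k * x) + b * sin (2 * pi * real_of_int k * x)))" for a b
  proof -
    define c where "c = 2 * pi * real_of_int k"
    have d: "deriv (\<lambda>x :: real. a * cos (c * x) + b * sin (c * x)) = (\<lambda>x. (b * c) * cos (c * x) + (- (a * c)) * sin (c * x))" for a b
      by (rule ext, rule DERIV_imp_deriv) (auto intro!: derivative_eq_intros)
    show ?thesis
      unfolding c_def[symmetric] d by (simp add: fun_eq_iff algebra_simps power2_eq_square)
  qed
  have "(\<integral>x. rep_H u x * (a * cos (2 * pi * real_of_int k * x) + b * sin (2 * pi * real_of_int k * x)) \<partial>torus) = 0"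
    if "k \<noteq> 0" for a b
  proof -
    define q where "q x = a * cos (2 * pi * real_of_int k * x) + b * sin (2 * pi * real_of_int k * x)" for x
    have "(\<integral>x. rep_H u x * (- (2 * pi * real_of_int k)\<^sup>2 * q x) \<partial>torus) = 0"
      using assms[OF torus_test_trig[of a k b]] unfolding d2 q_def .
    also have "(\<lambda>x. rep_H u x * (- (2 * pi * real_of_int k)\<^sup>2 * q x)) = (\<lambda>x. - (2 * pi * real_of_int k)\<^sup>2 * (rep_H u x * q x))"
      by (rule ext) (rule mult.left_commute)
    finally show ?thesis
      using that unfolding q_def[symmetric] by simp
  qed
  from this[of 1 0] this[of 0 1]
  show "(\<integral>x. rep_H u x * cos (2 * pi * real_of_int k * x) \<partial>torus) = 0"
    "(\<integral>x. rep_H u x * sin (2 * pi * real_of_int k * x) \<partial>torus) = 0"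
    by (cases "k = 0"; simp add: rep_H_mean_zero)+
qed

lemma antideriv_H_eq_0: "antideriv_H u = 0 \<Longrightarrow> u = 0"
proof (rule H_eq_0_if_orthogonal_dxx_test)
  fix \<psi> assume "antideriv_H u = 0" "torus_test \<psi>"
  have "(\<integral>x. rep_H u x * deriv (deriv \<psi>) x \<partial>torus) =
      - (\<integral>x. rep_H (antideriv_H u) x * deriv (deriv (deriv \<psi>)) x \<partial>torus)"
    by (simp add: integral_antideriv_H_test torus_test_deriv \<open>torus_test \<psi>\<close>)
  also have "(\<integral>x. rep_H (antideriv_H u) x * deriv (deriv (deriv \<psi>)) x \<partial>torus) = (\<integral>x. 0 \<partial>torus)"
    unfolding \<open>antideriv_H u = 0\<close> using rep_H_zero torus_test_L2[OF torus_test_deriv[OF torus_test_deriv[OF torus_test_deriv[OF \<open>torus_test \<psi>\<close>]]]]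
    by (intro integral_cong_AE) (auto elim!: eventually_mono simp: L2_torus_def)
  finally show "(\<integral>x. rep_H u x * deriv (deriv \<psi>) x \<partial>torus) = 0"
    by simp
qed

lemma inv_dxx_eq_0: "inv_dxx u = 0 \<Longrightarrow> u = 0"
  unfolding inv_dxx_def by (rule antideriv_H_eq_0, rule antideriv_H_eq_0)

lemma inv_dxx_inject: "inv_dxx u = inv_dxx v \<Longrightarrow> u = v"
  using inv_dxx_eq_0[of "u - v"] linear_diff[OF linear_inv_dxx, of u v] by simp

lemma weak_dxx_imp_inv_dxx:
  assumes g: "g \<in> L2_torus" and w: "weak_deriv 2 (rep_H u) g"
  shows "g \<in> H_carrier" "u = inv_dxx (abs_H g)"
proof -
  have w': "(\<integral>x. rep_H u x * deriv (deriv \<psi>) x \<partial>torus) = (\<integral>x. g x * \<psi> x \<partial>torus)" if "torus_test \<psi>" for \<psi>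
    using w that by (simp add: weak_deriv_def numeral_2_eq_2)
  have "torus_test (\<lambda>x. 1)"
    using torus_test_trig[of 1 0 0] by simp
  from w'[OF this] have "(\<integral>x. g x \<partial>torus) = 0"
    by simp
  then show gH: "g \<in> H_carrier"
    using g by (simp add: H_carrier_def)
  have "u - inv_dxx (abs_H g) = 0"
  proof (rule H_eq_0_if_orthogonal_dxx_test)
    fix \<psi> assume \<psi>: "torus_test \<psi>"
    define \<psi>2 where "\<psi>2 = deriv (deriv \<psi>)"
    have L2: "\<psi>2 \<in> L2_torus"
      unfolding \<psi>2_def by (intro torus_test_L2 torus_test_deriv \<psi>)
    have [measurable]: "\<psi>2 \<in> borel_measurable torus" "\<psi> \<in> borel_measurable torus" "g \<in> borel_measurable torus"
      using L2 torus_test_L2[OF \<psi>] g by (auto simp: L2_torus_def)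
    have "(\<integral>x. rep_H (u - inv_dxx (abs_H g)) x * \<psi>2 x \<partial>torus)
       = (\<integral>x. rep_H u x * \<psi>2 x - rep_H (inv_dxx (abs_H g)) x * \<psi>2 x \<partial>torus)"
      using rep_H_minus[of u "inv_dxx (abs_H g)"]
      by (intro integral_cong_AE) (measurable, auto elim!: eventually_mono simp: left_diff_distrib)
    also have "\<dots> = (\<integral>x. rep_H u x * \<psi>2 x \<partial>torus) - (\<integral>x. rep_H (inv_dxx (abs_H g)) x * \<psi>2 x \<partial>torus)"
      by (intro Bochner_Integration.integral_diff L2_mult_integrable rep_H_L2 L2)
    also have "(\<integral>x. rep_H (inv_dxx (abs_H g)) x * \<psi>2 x \<partial>torus) = (\<integral>x. rep_H (abs_H g) x * \<psi> x \<partial>torus)"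
      unfolding \<psi>2_def by (rule integral_inv_dxx_test[OF \<psi>])
    also have "\<dots> = (\<integral>x. g x * \<psi> x \<partial>torus)"
      using rep_H_abs[OF gH] by (intro integral_cong_AE) (measurable, auto elim!: eventually_mono)
    finally show "(\<integral>x. rep_H (u - inv_dxx (abs_H g)) x * deriv (deriv \<psi>) x \<partial>torus) = 0"
      using w'[OF \<psi>] by (simp add: \<psi>2_def)
  qed
  then show "u = inv_dxx (abs_H g)"
    by simp
qed

lemma inv_dxx_V_space: "inv_dxx g \<in> V_space"
  using weak_deriv_inv_dxx[of g] rep_H_L2 by (auto simp: V_space_def H2_torus_def)

lemma V_space_eq: "V_space = range inv_dxx"
proof (intro equalityI subsetI)
  fix u assume "u \<in> V_space"
  then obtain g where "g \<in> L2_torus" "weak_deriv 2 (rep_H u) g"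
    by (auto simp: V_space_def H2_torus_def)
  then show "u \<in> range inv_dxx"
    using weak_dxx_imp_inv_dxx(2) by blast
qed (auto simp: inv_dxx_V_space)

lemma dxx_inv_dxx: "AE x in torus. dxx (inv_dxx g) x = rep_H g x" "dxx (inv_dxx g) \<in> borel_measurable torus"
proof -
  have "\<exists>f. f \<in> L2_torus \<and> weak_deriv 2 (rep_H (inv_dxx g)) f"
    using weak_deriv_inv_dxx(2) rep_H_L2 by blast
  then have d: "dxx (inv_dxx g) \<in> L2_torus" "weak_deriv 2 (rep_H (inv_dxx g)) (dxx (inv_dxx g))"
    using someI_ex[of "\<lambda>f. f \<in> L2_torus \<and> weak_deriv 2 (rep_H (inv_dxx g)) f"] unfolding dxx_def by blast+
  note * = weak_dxx_imp_inv_dxx[OF d]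
  have "abs_H (dxx (inv_dxx g)) = g"
    using inv_dxx_inject[OF *(2)] by simp
  then show "AE x in torus. dxx (inv_dxx g) x = rep_H g x"
    using rep_H_abs[OF *(1)] by (auto elim!: eventually_mono)
  show "dxx (inv_dxx g) \<in> borel_measurable torus"
    using d(1) by (simp add: L2_torus_def)
qed

section \<open>The functional and its subdifferential\<close>

lemma exp_remainder_le: "exp x - 1 - x \<le> x\<^sup>2 * exp \<bar>x\<bar>" for x :: real
proof (cases "x \<ge> 0")
  case True
  have "(1 - x) * exp x \<le> exp (- x) * exp x"
    using exp_ge_add_one_self[of "- x"] by (intro mult_right_mono) auto
  then have 1: "(1 - x) * exp x \<le> 1"
    by (simp flip: exp_add)
  have "exp x - 1 - x \<le> x * (exp x - 1)"
    using 1 by (simp add: algebra_simps)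
  also have "\<dots> \<le> x * (x * exp x)"
    using 1 True by (intro mult_left_mono) (auto simp: algebra_simps)
  finally show ?thesis
    using True by (simp add: power2_eq_square mult.assoc)
next
  case False
  then have "1 - x > 0"
    by simp
  have "(1 - x) * exp x \<le> exp (- x) * exp x"
    using exp_ge_add_one_self[of "- x"] by (intro mult_right_mono) auto
  then have "(1 - x) * exp x \<le> 1"
    by (simp flip: exp_add)
  then have "(1 - x) * (exp x - 1 - x) \<le> x\<^sup>2"
    by (simp add: algebra_simps power2_eq_square)
  also have "\<dots> \<le> (1 - x) * x\<^sup>2"
    using False by (simp add: mult_right_mono[of 1 "1 - x" "x\<^sup>2", simplified])
  finally have "exp x - 1 - x \<le> x\<^sup>2"
    using \<open>1 - x > 0\<close> by (simp add: mult_le_cancel_left_pos)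
  also have "\<dots> \<le> x\<^sup>2 * exp \<bar>x\<bar>"
    using mult_left_mono[of 1 "exp \<bar>x\<bar>" "x\<^sup>2"] by simp
  finally show ?thesis .
qed

lemma abs_sinh_le_cosh: "\<bar>sinh x\<bar> \<le> cosh (x :: real)"
  by (simp add: sinh_def cosh_def abs_le_iff)

lemma cosh_add_expansion:
  fixes w a :: real
  shows "cosh (w + a) \<le> cosh w + sinh w * a + a\<^sup>2 * exp \<bar>a\<bar> * cosh w"
proof -
  have "cosh a - 1 + \<bar>sinh a - a\<bar> \<le> a\<^sup>2 * exp \<bar>a\<bar>"
  proof -
    have "cosh a - 1 + (sinh a - a) \<le> a\<^sup>2 * exp \<bar>a\<bar>"
      using exp_remainder_le[of a] cosh_plus_sinh[of a] by linarith
    moreover have "cosh a - 1 - (sinh a - a) \<le> a\<^sup>2 * exp \<bar>a\<bar>"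
      using exp_remainder_le[of "- a"] cosh_minus_sinh[of a] by simp
    ultimately show ?thesis
      by linarith
  qed
  then have "cosh w * (cosh a - 1 + \<bar>sinh a - a\<bar>) \<le> cosh w * (a\<^sup>2 * exp \<bar>a\<bar>)"
    by (intro mult_left_mono) auto
  moreover have "sinh w * (sinh a - a) \<le> cosh w * \<bar>sinh a - a\<bar>"
  proof -
    have "sinh w * (sinh a - a) \<le> \<bar>sinh w\<bar> * \<bar>sinh a - a\<bar>"
      by (metis abs_ge_self abs_mult)
    also have "\<dots> \<le> cosh w * \<bar>sinh a - a\<bar>"
      by (intro mult_right_mono abs_sinh_le_cosh) auto
    finally show ?thesis .
  qed
  ultimately show ?thesis
    by (simp add: cosh_add algebra_simps)
qed

lemma cosh_add_le: "cosh (w + a) \<le> cosh w * exp \<bar>a\<bar>" for w a :: real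
proof -
  have "sinh w * sinh a \<le> cosh w * \<bar>sinh a\<bar>"
  proof -
    have "sinh w * sinh a \<le> \<bar>sinh w\<bar> * \<bar>sinh a\<bar>"
      by (metis abs_ge_self abs_mult)
    also have "\<dots> \<le> cosh w * \<bar>sinh a\<bar>"
      by (intro mult_right_mono abs_sinh_le_cosh) auto
    finally show ?thesis .
  qed
  then have "cosh (w + a) \<le> cosh w * (cosh a + \<bar>sinh a\<bar>)"
    by (simp add: cosh_add distrib_left)
  also have "cosh a + \<bar>sinh a\<bar> = exp \<bar>a\<bar>"
    by (auto simp: cosh_def sinh_def abs_if field_simps)
  finally show ?thesis .
qed

lemma sinh_diff_mvt:
  fixes a b :: real
  obtains z where "sinh a - sinh b = cosh z * (a - b)" "\<bar>z\<bar> \<le> max \<bar>a\<bar> \<bar>b\<bar>"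
proof -
  have der: "(sinh has_real_derivative cosh x) (at x)" for x :: real
    by (auto intro!: derivative_eq_intros)
  show thesis
  proof (cases a b rule: linorder_cases)
    case less
    obtain z where "a < z" "z < b" "sinh b - sinh a = (b - a) * cosh z"
      using MVT2[OF less, of sinh cosh] der by blast
    then show thesis
      by (intro that[of z]) (auto simp: algebra_simps)
  next
    case equal
    then show thesis
      by (intro that[of a]) auto
  next
    case greater
    obtain z where "b < z" "z < a" "sinh a - sinh b = (a - b) * cosh z"
      using MVT2[OF greater, of sinh cosh] der by blast
    then show thesis
      by (intro that[of z]) (auto simp: algebra_simps)
  qed
qed

lemma sinh_strongly_monotone: "(a - b)\<^sup>2 \<le> (sinh a - sinh b) * (a - b)" for a b :: real
proof -
  obtain z where "sinh a - sinh b = cosh z * (a - b)"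
    using sinh_diff_mvt by blast
  then have "(sinh a - sinh b) * (a - b) = cosh z * (a - b)\<^sup>2"
    by (simp add: power2_eq_square)
  then show ?thesis
    using mult_right_mono[of 1 "cosh z" "(a - b)\<^sup>2"] cosh_real_ge_1[of z] by simp
qed

lemma abs_le_abs_sinh: "\<bar>x\<bar> \<le> \<bar>sinh x\<bar>" for x :: real
proof -
  obtain z where "sinh x - sinh 0 = cosh z * (x - 0)"
    using sinh_diff_mvt by blast
  then have "\<bar>sinh x\<bar> = cosh z * \<bar>x\<bar>"
    by (simp add: abs_mult)
  then show ?thesis
    using mult_right_mono[of 1 "cosh z" "\<bar>x\<bar>"] cosh_real_ge_1[of z] by simp
qed

lemma sinh_lipschitz:
  fixes a b :: real
  assumes "\<bar>a\<bar> \<le> M" "\<bar>b\<bar> \<le> M"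
  shows "\<bar>sinh a - sinh b\<bar> \<le> cosh M * \<bar>a - b\<bar>"
proof -
  obtain z where z: "sinh a - sinh b = cosh z * (a - b)" "\<bar>z\<bar> \<le> max \<bar>a\<bar> \<bar>b\<bar>"
    by (rule sinh_diff_mvt)
  have "cosh z = cosh \<bar>z\<bar>"
    by simp
  also have "\<dots> \<le> cosh M"
    using z(2) assms by (subst cosh_real_nonneg_le_iff) auto
  finally have "cosh z \<le> cosh M" .
  then have "cosh z * \<bar>a - b\<bar> \<le> cosh M * \<bar>a - b\<bar>"
    by (intro mult_right_mono) auto
  then show ?thesis
    unfolding z(1) abs_mult by simp
qed

lemma continuous_on_cosh_sinh: "continuous_on UNIV (cosh :: real \<Rightarrow> real)" "continuous_on UNIV (sinh :: real \<Rightarrow> real)"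
  by (intro continuous_intros)+

lemma cosh_sinh_measurable [measurable (raw)]:
  assumes "f \<in> borel_measurable M"
  shows "(\<lambda>x. cosh (f x :: real)) \<in> borel_measurable M" "(\<lambda>x. sinh (f x :: real)) \<in> borel_measurable M"
  using assms continuous_on_cosh_sinh by (auto intro: borel_measurable_continuous_on)

definition cosh_integrable :: "H \<Rightarrow> bool" where
  "cosh_integrable g \<longleftrightarrow> integrable torus (\<lambda>x. cosh (rep_H g x))"

definition cosh_integral :: "H \<Rightarrow> real" where
  "cosh_integral g = (\<integral>x. cosh (rep_H g x) \<partial>torus)"

lemma phi_inv_dxx: "\<phi> (inv_dxx g) = enn2ereal (\<integral>\<^sup>+x. ennreal (cosh (rep_H g x)) \<partial>torus)"
proof -
  have "(\<integral>\<^sup>+x. ennreal (cosh (dxx (inv_dxx g) x)) \<partial>torus) = (\<integral>\<^sup>+x. ennreal (cosh (rep_H g x)) \<partial>torus)"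
    using dxx_inv_dxx(1)[of g] by (intro nn_integral_cong_AE) (auto elim!: eventually_mono)
  then show ?thesis
    using inv_dxx_V_space[of g] by (simp add: \<phi>_def)
qed

lemma phi_nonneg: "0 \<le> \<phi> v"
  by (simp add: \<phi>_def)

lemma phi_inv_dxx_integrable: "cosh_integrable g \<Longrightarrow> \<phi> (inv_dxx g) = ereal (cosh_integral g)"
  unfolding cosh_integrable_def cosh_integral_def phi_inv_dxx
  by (subst nn_integral_eq_integral) (auto simp: enn2ereal_ennreal)

lemma eff_domain_phi: "eff_domain \<phi> = inv_dxx ` {g. cosh_integrable g}"
proof (intro equalityI subsetI)
  fix u assume "u \<in> eff_domain \<phi>"
  then have fin: "\<phi> u < \<infinity>"
    by (simp add: eff_domain_def)
  then have "u \<in> V_space"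
    by (auto simp: \<phi>_def split: if_splits)
  then obtain g where g: "u = inv_dxx g"
    unfolding V_space_eq by blast
  have "(\<integral>\<^sup>+x. ennreal (cosh (rep_H g x)) \<partial>torus) < \<infinity>"
    using fin unfolding g phi_inv_dxx by (auto simp: top.not_eq_extremum[symmetric])
  then have "cosh_integrable g"
    unfolding cosh_integrable_def by (intro integrableI_bounded) auto
  then show "u \<in> inv_dxx ` {g. cosh_integrable g}"
    using g by blast
qed (auto simp: eff_domain_def phi_inv_dxx_integrable)

definition Linf :: "H set" where
  "Linf = {u. \<exists>B. AE x in torus. \<bar>rep_H u x\<bar> \<le> B}"

lemma subspace_Linf: "subspace Linf"
  unfolding subspace_def
proof (intro conjI ballI allI)
  show "0 \<in> Linf"
    using rep_H_zero by (auto simp: Linf_def intro!: exI[of _ 0] elim!: eventually_mono)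
next
  fix u v assume "u \<in> Linf" "v \<in> Linf"
  then obtain A B where "AE x in torus. \<bar>rep_H u x\<bar> \<le> A" "AE x in torus. \<bar>rep_H v x\<bar> \<le> B"
    by (auto simp: Linf_def)
  with rep_H_plus[of u v] have "AE x in torus. \<bar>rep_H (u + v) x\<bar> \<le> A + B"
    by eventually_elim simp
  then show "u + v \<in> Linf"
    by (auto simp: Linf_def)
next
  fix c u assume "u \<in> Linf"
  then obtain A where "AE x in torus. \<bar>rep_H u x\<bar> \<le> A"
    by (auto simp: Linf_def)
  with rep_H_scaleR[of c u] have "AE x in torus. \<bar>rep_H (c *\<^sub>R u) x\<bar> \<le> \<bar>c\<bar> * A"
    by eventually_elim (simp add: abs_mult mult_left_mono)
  then show "c *\<^sub>R u \<in> Linf"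
    by (auto simp: Linf_def)
qed

lemma Linf_bound:
  assumes "\<zeta> \<in> Linf"
  obtains B where "B \<ge> 0" "AE x in torus. \<bar>rep_H \<zeta> x\<bar> \<le> B"
proof -
  obtain B where "AE x in torus. \<bar>rep_H \<zeta> x\<bar> \<le> B"
    using assms by (auto simp: Linf_def)
  then have "AE x in torus. \<bar>rep_H \<zeta> x\<bar> \<le> \<bar>B\<bar>"
    by eventually_elim simp
  then show thesis
    by (intro that[of "\<bar>B\<bar>"]) auto
qed

lemma inv_dxx_Linf: "inv_dxx u \<in> Linf"
  using inv_dxx_bound by (auto simp: Linf_def)

lemma rep_H_add_scaleR: "AE x in torus. rep_H (g + \<epsilon> *\<^sub>R \<zeta>) x = rep_H g x + \<epsilon> * rep_H \<zeta> x"
  using rep_H_plus[of g "\<epsilon> *\<^sub>R \<zeta>"] rep_H_scaleR[of \<epsilon> \<zeta>] by eventually_elim simp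

lemma cosh_integrable_add:
  assumes g: "cosh_integrable g" and \<zeta>: "\<zeta> \<in> Linf"
  shows "cosh_integrable (g + \<epsilon> *\<^sub>R \<zeta>)"
proof -
  obtain B where B: "B \<ge> 0" "AE x in torus. \<bar>rep_H \<zeta> x\<bar> \<le> B"
    using \<zeta> by (rule Linf_bound)
  have "integrable torus (\<lambda>x. exp (\<bar>\<epsilon>\<bar> * B) * cosh (rep_H g x))"
    using g by (simp add: cosh_integrable_def)
  then show ?thesis
    unfolding cosh_integrable_def
  proof (rule Bochner_Integration.integrable_bound)
    show "AE x in torus. norm (cosh (rep_H (g + \<epsilon> *\<^sub>R \<zeta>) x)) \<le> norm (exp (\<bar>\<epsilon>\<bar> * B) * cosh (rep_H g x))"
      using rep_H_add_scaleR[of g \<epsilon> \<zeta>] B(2)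
    proof eventually_elim
      case (elim x)
      have "cosh (rep_H g x + \<epsilon> * rep_H \<zeta> x) \<le> cosh (rep_H g x) * exp \<bar>\<epsilon> * rep_H \<zeta> x\<bar>"
        by (rule cosh_add_le)
      also have "\<dots> \<le> cosh (rep_H g x) * exp (\<bar>\<epsilon>\<bar> * B)"
        using elim by (intro mult_left_mono) (auto simp: abs_mult mult_left_mono)
      finally show ?case
        using elim by (simp add: mult.commute)
    qed
  qed simp
qed

lemma sinh_mult_integrable:
  assumes g: "cosh_integrable g" and \<zeta>: "\<zeta> \<in> Linf"
  shows "integrable torus (\<lambda>x. sinh (rep_H g x) * rep_H \<zeta> x)"
proof -
  obtain B where B: "B \<ge> 0" "AE x in torus. \<bar>rep_H \<zeta> x\<bar> \<le> B"
    using \<zeta> by (rule Linf_bound)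
  have "integrable torus (\<lambda>x. cosh (rep_H g x) * B)"
    using g by (simp add: cosh_integrable_def)
  then show ?thesis
  proof (rule Bochner_Integration.integrable_bound)
    show "AE x in torus. norm (sinh (rep_H g x) * rep_H \<zeta> x) \<le> norm (cosh (rep_H g x) * B)"
      using B(2)
    proof eventually_elim
      case (elim x)
      then have "\<bar>sinh (rep_H g x)\<bar> * \<bar>rep_H \<zeta> x\<bar> \<le> cosh (rep_H g x) * B"
        by (intro mult_mono abs_sinh_le_cosh) auto
      then show ?case
        using B(1) by (simp add: abs_mult)
    qed
  qed simp
qed

lemma sinh_integrable: "cosh_integrable g \<Longrightarrow> integrable torus (\<lambda>x. sinh (rep_H g x))"
  unfolding cosh_integrable_def
  by (erule Bochner_Integration.integrable_bound) (auto simp: abs_sinh_le_cosh)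

lemma cosh_integral_gateaux:
  assumes g: "cosh_integrable g" and \<zeta>: "\<zeta> \<in> Linf"
  obtains C where "C \<ge> 0" "\<And>\<epsilon>. \<bar>\<epsilon>\<bar> \<le> 1 \<Longrightarrow> cosh_integral (g + \<epsilon> *\<^sub>R \<zeta>) \<le>
      cosh_integral g + \<epsilon> * (\<integral>x. sinh (rep_H g x) * rep_H \<zeta> x \<partial>torus) + \<epsilon>\<^sup>2 * C"
proof -
  obtain B where B: "B \<ge> 0" "AE x in torus. \<bar>rep_H \<zeta> x\<bar> \<le> B"
    using \<zeta> by (rule Linf_bound)
  have intg: "integrable torus (\<lambda>x. cosh (rep_H g x))"
    using g by (simp add: cosh_integrable_def)
  show thesis
  proof (rule that)
    show "0 \<le> B\<^sup>2 * exp B * cosh_integral g"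
      unfolding cosh_integral_def by simp
    fix \<epsilon> :: real assume \<epsilon>: "\<bar>\<epsilon>\<bar> \<le> 1"
    have "cosh_integral (g + \<epsilon> *\<^sub>R \<zeta>) \<le> (\<integral>x. cosh (rep_H g x) + \<epsilon> * (sinh (rep_H g x) * rep_H \<zeta> x)
        + \<epsilon>\<^sup>2 * (B\<^sup>2 * exp B) * cosh (rep_H g x) \<partial>torus)"
      unfolding cosh_integral_def
    proof (rule integral_mono_AE)
      show "integrable torus (\<lambda>x. cosh (rep_H (g + \<epsilon> *\<^sub>R \<zeta>) x))"
        using cosh_integrable_add[OF g \<zeta>] by (simp add: cosh_integrable_def)
      show "integrable torus (\<lambda>x. cosh (rep_H g x) + \<epsilon> * (sinh (rep_H g x) * rep_H \<zeta> x)
        + \<epsilon>\<^sup>2 * (B\<^sup>2 * exp B) * cosh (rep_H g x))"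
        using intg sinh_mult_integrable[OF g \<zeta>] by simp
      show "AE x in torus. cosh (rep_H (g + \<epsilon> *\<^sub>R \<zeta>) x) \<le> cosh (rep_H g x) + \<epsilon> * (sinh (rep_H g x) * rep_H \<zeta> x)
        + \<epsilon>\<^sup>2 * (B\<^sup>2 * exp B) * cosh (rep_H g x)"
        using rep_H_add_scaleR[of g \<epsilon> \<zeta>] B(2)
      proof eventually_elim
        case (elim x)
        define a where "a = \<epsilon> * rep_H \<zeta> x"
        have a: "\<bar>a\<bar> \<le> B"
          using mult_mono[OF \<epsilon> elim(2)] by (simp add: a_def abs_mult)
        have "cosh (rep_H g x + a) \<le> cosh (rep_H g x) + sinh (rep_H g x) * a + a\<^sup>2 * exp \<bar>a\<bar> * cosh (rep_H g x)"
          by (rule cosh_add_expansion)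
        also have "a\<^sup>2 * exp \<bar>a\<bar> * cosh (rep_H g x) \<le> (\<epsilon>\<^sup>2 * B\<^sup>2) * exp B * cosh (rep_H g x)"
        proof (intro mult_right_mono mult_mono)
          show "a\<^sup>2 \<le> \<epsilon>\<^sup>2 * B\<^sup>2"
            unfolding a_def power_mult_distrib
            using elim(2) B(1) by (intro mult_left_mono abs_le_square_iff[THEN iffD1]) auto
        qed (use a in auto)
        finally show ?case
          using elim(1) by (simp add: a_def mult_ac)
      qed
    qed
    also have "\<dots> = cosh_integral g + \<epsilon> * (\<integral>x. sinh (rep_H g x) * rep_H \<zeta> x \<partial>torus)
        + \<epsilon>\<^sup>2 * (B\<^sup>2 * exp B * cosh_integral g)"
      using intg sinh_mult_integrable[OF g \<zeta>] by (simp add: cosh_integral_def)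
    finally show "cosh_integral (g + \<epsilon> *\<^sub>R \<zeta>) \<le>
      cosh_integral g + \<epsilon> * (\<integral>x. sinh (rep_H g x) * rep_H \<zeta> x \<partial>torus) + \<epsilon>\<^sup>2 * (B\<^sup>2 * exp B * cosh_integral g)" .
  qed
qed

lemma le_sinh_integral_if_slope:
  assumes g: "cosh_integrable g" and \<zeta>: "\<zeta> \<in> Linf"
    and slope: "\<And>\<epsilon>. 0 < \<epsilon> \<Longrightarrow> cosh_integral g + \<epsilon> * a \<le> cosh_integral (g + \<epsilon> *\<^sub>R \<zeta>)"
  shows "a \<le> (\<integral>x. sinh (rep_H g x) * rep_H \<zeta> x \<partial>torus)"
proof -
  define b where "b = (\<integral>x. sinh (rep_H g x) * rep_H \<zeta> x \<partial>torus)"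
  obtain C where C: "C \<ge> 0" "\<And>\<epsilon>. \<bar>\<epsilon>\<bar> \<le> 1 \<Longrightarrow> cosh_integral (g + \<epsilon> *\<^sub>R \<zeta>) \<le> cosh_integral g + \<epsilon> * b + \<epsilon>\<^sup>2 * C"
    using cosh_integral_gateaux[OF g \<zeta>] unfolding b_def by blast
  have "a \<le> b"
  proof (rule field_le_epsilon)
    fix e :: real assume "e > 0"
    define \<epsilon> where "\<epsilon> = min 1 (e / (C + 1))"
    have \<epsilon>: "0 < \<epsilon>" "\<epsilon> \<le> 1" "\<epsilon> \<le> e / (C + 1)"
      using \<open>e > 0\<close> C(1) by (auto simp: \<epsilon>_def)
    have "\<epsilon> * a \<le> \<epsilon> * b + \<epsilon>\<^sup>2 * C"
      using slope[OF \<epsilon>(1)] C(2)[of \<epsilon>] \<epsilon> by simp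
    then have "\<epsilon> * a \<le> \<epsilon> * (b + \<epsilon> * C)"
      by (simp add: distrib_left power2_eq_square mult_ac)
    then have "a \<le> b + \<epsilon> * C"
      using \<epsilon>(1) by simp
    moreover have "\<epsilon> * C \<le> e"
    proof -
      have "\<epsilon> * C \<le> e / (C + 1) * (C + 1)"
        using \<epsilon> C(1) \<open>e > 0\<close> by (intro mult_mono) auto
      then show ?thesis
        using C(1) by simp
    qed
    ultimately show "a \<le> b + e"
      by simp
  qed
  then show ?thesis
    by (simp add: b_def)
qed

lemma AE_const_if_orthogonal:
  assumes m: "integrable torus m"
    and orth: "\<And>\<zeta>. \<zeta> \<in> Linf \<Longrightarrow> (\<integral>x. m x * rep_H \<zeta> x \<partial>torus) = 0"
  shows "AE x in torus. m x = (\<integral>x. m x \<partial>torus)"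
proof -
  define c where "c = (\<integral>x. m x \<partial>torus)"
  have [measurable]: "m \<in> borel_measurable torus"
    using m by simp
  define s where "s x = sgn (m x - c)" for x
  have s_meas [measurable]: "s \<in> borel_measurable torus"
    unfolding s_def by measurable
  have s_bound: "\<bar>s x\<bar> \<le> 1" for x
    by (simp add: s_def sgn_if)
  have s_int: "integrable torus s"
    using s_bound by (intro bounded_integrable_torus[of _ 1]) auto
  define d where "d = (\<integral>x. s x \<partial>torus)"
  have L2: "(\<lambda>x. s x - d) \<in> L2_torus"
  proof (rule bounded_L2_torus[of _ "1 + \<bar>d\<bar>"])
    show "AE x in torus. \<bar>s x - d\<bar> \<le> 1 + \<bar>d\<bar>"
    proof (rule AE_I2)
      show "\<bar>s x - d\<bar> \<le> 1 + \<bar>d\<bar>" for x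
        using s_bound[of x] by linarith
    qed
  qed measurable
  moreover have "(\<integral>x. s x - d \<partial>torus) = 0"
    using s_int by (simp add: d_def measure_torus)
  ultimately have sH: "(\<lambda>x. s x - d) \<in> H_carrier"
    by (simp add: H_carrier_def)
  define \<zeta> where "\<zeta> = abs_H (\<lambda>x. s x - d)"
  have \<zeta>: "AE x in torus. rep_H \<zeta> x = s x - d"
    unfolding \<zeta>_def by (rule rep_H_abs[OF sH])
  then have "AE x in torus. \<bar>rep_H \<zeta> x\<bar> \<le> 1 + \<bar>d\<bar>"
  proof eventually_elim
    case (elim x)
    then show ?case
      using s_bound[of x] by linarith
  qed
  then have "\<zeta> \<in> Linf"
    by (auto simp: Linf_def)
  have ms: "integrable torus (\<lambda>x. m x * s x)"
    using m by (rule Bochner_Integration.integrable_bound) (auto simp: abs_mult s_bound mult_left_le)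
  have "0 = (\<integral>x. m x * rep_H \<zeta> x \<partial>torus)"
    using orth[OF \<open>\<zeta> \<in> Linf\<close>] by simp
  also have "\<dots> = (\<integral>x. \<bar>m x - c\<bar> + (c * s x - d * m x) \<partial>torus)"
  proof (rule integral_cong_AE)
    show "AE x in torus. m x * rep_H \<zeta> x = \<bar>m x - c\<bar> + (c * s x - d * m x)"
      using \<zeta>
    proof eventually_elim
      case (elim x)
      have "\<bar>m x - c\<bar> = (m x - c) * s x"
        by (simp add: s_def abs_sgn)
      then show ?case
        unfolding elim by (simp add: algebra_simps)
    qed
  qed measurable
  also have "\<dots> = (\<integral>x. \<bar>m x - c\<bar> \<partial>torus) + (c * d - d * c)"
    using m s_int by (simp add: c_def[symmetric] d_def[symmetric])
  finally have "(\<integral>x. \<bar>m x - c\<bar> \<partial>torus) = 0"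
    by simp
  then have "AE x in torus. \<bar>m x - c\<bar> = 0"
    using m by (subst (asm) integral_nonneg_eq_0_iff_AE) auto
  then show ?thesis
    unfolding c_def[symmetric] by eventually_elim simp
qed

lemma sinh_eq_if_dual:
  assumes g: "cosh_integrable g"
    and dual: "\<And>\<zeta>. \<zeta> \<in> Linf \<Longrightarrow> (\<integral>x. sinh (rep_H g x) * rep_H \<zeta> x \<partial>torus) = inner \<xi> (inv_dxx \<zeta>)"
  shows "\<exists>c. AE x in torus. sinh (rep_H g x) = c + rep_H (inv_dxx \<xi>) x"
proof -
  define m where "m x = sinh (rep_H g x) - rep_H (inv_dxx \<xi>) x" for x
  have "AE x in torus. m x = (\<integral>x. m x \<partial>torus)"
  proof (rule AE_const_if_orthogonal)
    show "integrable torus m"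
      unfolding m_def using sinh_integrable[OF g] rep_H_integrable by simp
    fix \<zeta> assume \<zeta>: "\<zeta> \<in> Linf"
    have "(\<integral>x. m x * rep_H \<zeta> x \<partial>torus) =
        (\<integral>x. sinh (rep_H g x) * rep_H \<zeta> x \<partial>torus) - inner (inv_dxx \<xi>) \<zeta>"
      unfolding m_def inner_H_eq left_diff_distrib
      by (intro Bochner_Integration.integral_diff sinh_mult_integrable[OF g \<zeta>] rep_H_mult_integrable)
    then show "(\<integral>x. m x * rep_H \<zeta> x \<partial>torus) = 0"
      using dual[OF \<zeta>] by (simp add: inner_inv_dxx)
  qed
  then show ?thesis
    by (intro exI[of _ "\<integral>x. m x \<partial>torus"]) (auto elim!: eventually_mono simp: m_def)
qed

lemma inv_dxx_add_scaleR: "inv_dxx (g + \<epsilon> *\<^sub>R \<zeta>) = inv_dxx g + \<epsilon> *\<^sub>R inv_dxx \<zeta>"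
  using linear_inv_dxx by (simp add: linear_add linear_scale)

lemma subdiff_imp_sinh_eq:
  assumes \<xi>: "\<xi> \<in> subdiff \<phi> u"
  obtains g c where "u = inv_dxx g" "cosh_integrable g"
    "AE x in torus. sinh (rep_H g x) = c + rep_H (inv_dxx \<xi>) x"
proof -
  have "u \<in> eff_domain \<phi>" and sub: "\<And>v. \<phi> u + ereal (inner \<xi> (v - u)) \<le> \<phi> v"
    using \<xi> by (auto simp: subdiff_def)
  then obtain g where g: "cosh_integrable g" "u = inv_dxx g"
    unfolding eff_domain_phi by blast
  have le: "inner \<xi> (inv_dxx \<zeta>) \<le> (\<integral>x. sinh (rep_H g x) * rep_H \<zeta> x \<partial>torus)" if \<zeta>: "\<zeta> \<in> Linf" for \<zeta>
  proof (rule le_sinh_integral_if_slope[OF g(1) \<zeta>])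
    fix \<epsilon> :: real
    show "cosh_integral g + \<epsilon> * inner \<xi> (inv_dxx \<zeta>) \<le> cosh_integral (g + \<epsilon> *\<^sub>R \<zeta>)"
      using sub[of "inv_dxx (g + \<epsilon> *\<^sub>R \<zeta>)"]
      unfolding g(2) phi_inv_dxx_integrable[OF g(1)] phi_inv_dxx_integrable[OF cosh_integrable_add[OF g(1) \<zeta>]]
      by (simp add: inv_dxx_add_scaleR)
  qed
  have "(\<integral>x. sinh (rep_H g x) * rep_H \<zeta> x \<partial>torus) = inner \<xi> (inv_dxx \<zeta>)" if \<zeta>: "\<zeta> \<in> Linf" for \<zeta>
  proof -
    have neg: "(- 1) *\<^sub>R \<zeta> \<in> Linf"
      using subspace_scale[OF subspace_Linf \<zeta>] .
    have "(\<integral>x. sinh (rep_H g x) * rep_H ((- 1) *\<^sub>R \<zeta>) x \<partial>torus) = (\<integral>x. - (sinh (rep_H g x) * rep_H \<zeta> x) \<partial>torus)"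
      using rep_H_scaleR[of "- 1" \<zeta>] by (intro integral_cong_AE) (measurable, auto elim!: eventually_mono)
    then have "inner \<xi> (inv_dxx \<zeta>) \<ge> (\<integral>x. sinh (rep_H g x) * rep_H \<zeta> x \<partial>torus)"
      using le[OF neg] linear_scale[OF linear_inv_dxx, of "- 1" \<zeta>] by simp
    with le[OF \<zeta>] show ?thesis
      by simp
  qed
  then obtain c where "AE x in torus. sinh (rep_H g x) = c + rep_H (inv_dxx \<xi>) x"
    using sinh_eq_if_dual[OF g(1)] by blast
  with g show thesis
    using that by blast
qed

lemma slope_imp_sinh_eq:
  assumes g: "cosh_integrable g" and "L \<ge> 0"
    and slope: "\<And>v. \<phi> (inv_dxx g) \<le> \<phi> v + ereal (L * norm (v - inv_dxx g))"
  obtains \<xi> c where "norm \<xi> \<le> L" "AE x in torus. sinh (rep_H g x) = c + rep_H (inv_dxx \<xi>) x"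
proof -
  define l where "l \<zeta> = (\<integral>x. sinh (rep_H g x) * rep_H \<zeta> x \<partial>torus)" for \<zeta>
  have add: "l (x + y) = l x + l y" if "x \<in> Linf" "y \<in> Linf" for x y
  proof -
    have "l (x + y) = (\<integral>t. sinh (rep_H g t) * rep_H x t + sinh (rep_H g t) * rep_H y t \<partial>torus)"
      unfolding l_def using rep_H_plus[of x y]
      by (intro integral_cong_AE) (measurable, auto elim!: eventually_mono simp: distrib_left)
    then show ?thesis
      unfolding l_def using sinh_mult_integrable[OF g that(1)] sinh_mult_integrable[OF g that(2)] by simp
  qed
  have scale: "l (c *\<^sub>R x) = c * l x" for c x
  proof -
    have "l (c *\<^sub>R x) = (\<integral>t. c * (sinh (rep_H g t) * rep_H x t) \<partial>torus)"
      unfolding l_def using rep_H_scaleR[of c x]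
      by (intro integral_cong_AE) (measurable, auto elim!: eventually_mono simp: mult.left_commute)
    then show ?thesis
      by (simp add: l_def)
  qed
  have bnd: "l \<zeta> \<le> L * norm (inv_dxx \<zeta>)" if \<zeta>: "\<zeta> \<in> Linf" for \<zeta>
  proof -
    have neg: "(- 1) *\<^sub>R \<zeta> \<in> Linf"
      using subspace_scale[OF subspace_Linf \<zeta>] .
    have "- (L * norm (inv_dxx \<zeta>)) \<le> l ((- 1) *\<^sub>R \<zeta>)"
      unfolding l_def
    proof (rule le_sinh_integral_if_slope[OF g neg])
      fix \<epsilon> :: real assume "0 < \<epsilon>"
      then have "norm (inv_dxx (g + \<epsilon> *\<^sub>R (- 1) *\<^sub>R \<zeta>) - inv_dxx g) = \<epsilon> * norm (inv_dxx \<zeta>)"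
        using linear_scale[OF linear_inv_dxx, of "- 1" \<zeta>] unfolding inv_dxx_add_scaleR by simp
      then show "cosh_integral g + \<epsilon> * - (L * norm (inv_dxx \<zeta>)) \<le> cosh_integral (g + \<epsilon> *\<^sub>R (- 1) *\<^sub>R \<zeta>)"
        using slope[of "inv_dxx (g + \<epsilon> *\<^sub>R (- 1) *\<^sub>R \<zeta>)"]
        unfolding phi_inv_dxx_integrable[OF g] phi_inv_dxx_integrable[OF cosh_integrable_add[OF g neg]]
        by (simp add: mult.left_commute)
    qed
    then show ?thesis
      using scale[of "- 1" \<zeta>] by simp
  qed
  obtain \<xi> where \<xi>: "norm \<xi> \<le> L" "\<And>\<zeta>. \<zeta> \<in> Linf \<Longrightarrow> l \<zeta> = inner \<xi> (inv_dxx \<zeta>)"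
    using riesz_on_range[OF linear_inv_dxx subspace_Linf, of l L] add scale bnd \<open>L \<ge> 0\<close> by metis
  then obtain c where "AE x in torus. sinh (rep_H g x) = c + rep_H (inv_dxx \<xi>) x"
    using sinh_eq_if_dual[OF g, of \<xi>] unfolding l_def by blast
  with \<xi>(1) show thesis
    by (rule that)
qed

lemma not_AE_torus_False: "\<not> (AE x in torus. False)"
proof
  assume "AE x in torus. False"
  then have "emeasure torus (space torus) = 0"
    by (subst (asm) AE_iff_measurable[OF sets.top]) auto
  then show False
    using measure_torus by (simp add: measure_def)
qed

lemma rep_H_not_pos: "\<not> (AE x in torus. 0 < rep_H g x)"
proof
  assume pos: "AE x in torus. 0 < rep_H g x"
  then have "AE x in torus. 0 \<le> rep_H g x"
    by eventually_elim simp
  then have "AE x in torus. rep_H g x = 0"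
    using integral_nonneg_eq_0_iff_AE[OF rep_H_integrable] rep_H_mean_zero by simp
  with pos have "AE x in torus. False"
    by eventually_elim simp
  then show False
    using not_AE_torus_False by blast
qed

lemma rep_H_not_neg: "\<not> (AE x in torus. rep_H g x < 0)"
proof
  assume "AE x in torus. rep_H g x < 0"
  with rep_H_scaleR[of "- 1" g] have "AE x in torus. 0 < rep_H ((- 1) *\<^sub>R g) x"
    by eventually_elim simp
  then show False
    using rep_H_not_pos by blast
qed

definition dual_pair :: "H \<Rightarrow> H \<Rightarrow> bool" where
  "dual_pair g \<xi> \<longleftrightarrow> (\<exists>c. AE x in torus. sinh (rep_H g x) = c + rep_H (inv_dxx \<xi>) x)"

text \<open>
  The constant is controlled because \<open>g\<close> has mean zero and hence cannot have a strict sign.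
\<close>

lemma dual_pair_sinh_bound:
  assumes "dual_pair g \<xi>"
  shows "AE x in torus. \<bar>sinh (rep_H g x)\<bar> \<le> 8 * norm \<xi>"
proof -
  obtain c where c: "AE x in torus. sinh (rep_H g x) = c + rep_H (inv_dxx \<xi>) x"
    using assms by (auto simp: dual_pair_def)
  have "c \<le> 4 * norm \<xi>"
  proof (rule ccontr)
    assume neg: "\<not> c \<le> 4 * norm \<xi>"
    have "AE x in torus. 0 < rep_H g x"
      using c inv_dxx_bound[of \<xi>]
    proof eventually_elim
      case (elim x)
      then have "0 < sinh (rep_H g x)"
        using neg by linarith
      then show ?case
        by simp
    qed
    then show False
      using rep_H_not_pos by blast
  qed
  moreover have "- (4 * norm \<xi>) \<le> c"
  proof (rule ccontr)
    assume neg: "\<not> - (4 * norm \<xi>) \<le> c"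
    have "AE x in torus. rep_H g x < 0"
      using c inv_dxx_bound[of \<xi>]
    proof eventually_elim
      case (elim x)
      then have "sinh (rep_H g x) < 0"
        using neg by linarith
      then show ?case
        by simp
    qed
    then show False
      using rep_H_not_neg by blast
  qed
  ultimately have abs_c: "\<bar>c\<bar> \<le> 4 * norm \<xi>"
    by simp
  show ?thesis
    using c inv_dxx_bound[of \<xi>]
  proof eventually_elim
    case (elim x)
    then show ?case
      using abs_c by linarith
  qed
qed

lemma dual_pair_cosh_integrable:
  assumes "dual_pair g \<xi>"
  shows "cosh_integrable g"
  unfolding cosh_integrable_def
proof (rule bounded_integrable_torus)
  show "AE x in torus. \<bar>cosh (rep_H g x)\<bar> \<le> 1 + 8 * norm \<xi>"
    using dual_pair_sinh_bound[OF assms]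
  proof eventually_elim
    case (elim x)
    have "cosh y \<le> 1 + \<bar>sinh y\<bar>" for y :: real
    proof -
      have "cosh y - \<bar>sinh y\<bar> = exp (- \<bar>y\<bar>)"
        using cosh_minus_sinh[of "\<bar>y\<bar>"] by (cases "0 \<le> y") auto
      moreover have "exp (- \<bar>y\<bar>) \<le> 1"
        by simp
      ultimately show ?thesis
        by linarith
    qed
    then show ?case
      using elim by (smt (verit) cosh_real_nonneg)
  qed
qed measurable

lemma DERIV_cosh: "(cosh has_real_derivative sinh x) (at x)" for x :: real
  by (auto intro!: derivative_eq_intros)

lemma cosh_convex: "cosh a + sinh a * (b - a) \<le> cosh b" for a b :: real
proof (cases a b rule: linorder_cases)
  case less
  then obtain z where z: "a < z" "z < b" "cosh b - cosh a = (b - a) * sinh z"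
    using MVT2[OF less, of cosh sinh] DERIV_cosh by blast
  have "(b - a) * sinh a \<le> (b - a) * sinh z"
    using z sinh_real_strict_mono less by (intro mult_left_mono) (auto simp: strict_mono_less_eq)
  then show ?thesis
    using z(3) by (simp add: mult.commute)
next
  case greater
  then obtain z where z: "b < z" "z < a" "cosh a - cosh b = (a - b) * sinh z"
    using MVT2[OF greater, of cosh sinh] DERIV_cosh by blast
  have "(a - b) * sinh z \<le> (a - b) * sinh a"
    using z sinh_real_strict_mono greater by (intro mult_left_mono) (auto simp: strict_mono_less_eq)
  then show ?thesis
    using z(3) by (simp add: algebra_simps)
qed simp

lemma dual_pair_imp_subdiff:
  assumes "dual_pair g \<xi>"
  shows "\<xi> \<in> subdiff \<phi> (inv_dxx g)"
proof -
  have g: "cosh_integrable g"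
    by (rule dual_pair_cosh_integrable[OF assms])
  obtain c where c: "AE x in torus. sinh (rep_H g x) = c + rep_H (inv_dxx \<xi>) x"
    using assms by (auto simp: dual_pair_def)
  have "\<phi> (inv_dxx g) + ereal (inner \<xi> (v - inv_dxx g)) \<le> \<phi> v" for v
  proof (cases "v \<in> eff_domain \<phi>")
    case False
    then show ?thesis
      by (simp add: eff_domain_def)
  next
    case True
    then obtain f where f: "cosh_integrable f" and v: "v = inv_dxx f"
      unfolding eff_domain_phi by blast
    have "inner \<xi> (v - inv_dxx g) = inner (inv_dxx \<xi>) (f - g)"
      unfolding v linear_diff[OF linear_inv_dxx, symmetric] by (simp add: inner_inv_dxx)
    also have "\<dots> = (\<integral>x. c * rep_H (f - g) x + rep_H (inv_dxx \<xi>) x * rep_H (f - g) x \<partial>torus)"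
      using rep_H_integrable rep_H_mult_integrable by (simp add: inner_H_eq rep_H_mean_zero)
    finally have "cosh_integral g + inner \<xi> (v - inv_dxx g) =
       (\<integral>x. cosh (rep_H g x) + (c * rep_H (f - g) x + rep_H (inv_dxx \<xi>) x * rep_H (f - g) x) \<partial>torus)"
      using g rep_H_integrable rep_H_mult_integrable by (simp add: cosh_integral_def cosh_integrable_def)
    also have "\<dots> \<le> (\<integral>x. cosh (rep_H f x) \<partial>torus)"
    proof (rule integral_mono_AE)
      show "integrable torus (\<lambda>x. cosh (rep_H g x) + (c * rep_H (f - g) x + rep_H (inv_dxx \<xi>) x * rep_H (f - g) x))"
        using g rep_H_integrable rep_H_mult_integrable by (simp add: cosh_integrable_def)
      show "AE x in torus. cosh (rep_H g x) + (c * rep_H (f - g) x + rep_H (inv_dxx \<xi>) x * rep_H (f - g) x) \<le> cosh (rep_H f x)"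
        using c rep_H_minus[of f g]
      proof eventually_elim
        case (elim x)
        have "c * rep_H (f - g) x + rep_H (inv_dxx \<xi>) x * rep_H (f - g) x = sinh (rep_H g x) * (rep_H f x - rep_H g x)"
          unfolding elim by (simp add: distrib_right)
        then show ?case
          using cosh_convex[of "rep_H g x" "rep_H f x"] by linarith
      qed
    qed (use f in \<open>simp add: cosh_integrable_def\<close>)
    finally show ?thesis
      unfolding v phi_inv_dxx_integrable[OF f] phi_inv_dxx_integrable[OF g] by (simp add: cosh_integral_def)
  qed
  moreover have "inv_dxx g \<in> eff_domain \<phi>"
    using g by (auto simp: eff_domain_phi)
  ultimately show ?thesis
    by (simp add: subdiff_def)
qed

lemma subdiff_phi_iff: "\<xi> \<in> subdiff \<phi> u \<longleftrightarrow> (\<exists>g. u = inv_dxx g \<and> dual_pair g \<xi>)"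
  using dual_pair_imp_subdiff subdiff_imp_sinh_eq by (metis dual_pair_def)

lemma inner_dual_pair_diff:
  assumes 1: "dual_pair g1 \<xi>1" and 2: "dual_pair g2 \<xi>2"
  shows "inner (\<xi>1 - \<xi>2) (inv_dxx \<eta>) = (\<integral>x. (sinh (rep_H g1 x) - sinh (rep_H g2 x)) * rep_H \<eta> x \<partial>torus)"
    and "integrable torus (\<lambda>x. (sinh (rep_H g1 x) - sinh (rep_H g2 x)) * rep_H \<eta> x)"
proof -
  obtain c1 where c1: "AE x in torus. sinh (rep_H g1 x) = c1 + rep_H (inv_dxx \<xi>1) x"
    using 1 by (auto simp: dual_pair_def)
  obtain c2 where c2: "AE x in torus. sinh (rep_H g2 x) = c2 + rep_H (inv_dxx \<xi>2) x"
    using 2 by (auto simp: dual_pair_def)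
  have eq: "AE x in torus. (sinh (rep_H g1 x) - sinh (rep_H g2 x)) * rep_H \<eta> x =
     (c1 - c2) * rep_H \<eta> x + (rep_H (inv_dxx \<xi>1) x * rep_H \<eta> x - rep_H (inv_dxx \<xi>2) x * rep_H \<eta> x)"
    using c1 c2 by eventually_elim (simp add: algebra_simps)
  have int: "integrable torus (\<lambda>x. (c1 - c2) * rep_H \<eta> x + (rep_H (inv_dxx \<xi>1) x * rep_H \<eta> x - rep_H (inv_dxx \<xi>2) x * rep_H \<eta> x))"
    using rep_H_integrable rep_H_mult_integrable by simp
  show "integrable torus (\<lambda>x. (sinh (rep_H g1 x) - sinh (rep_H g2 x)) * rep_H \<eta> x)"
    using int by (subst integrable_cong_AE[OF _ _ eq]) measurable
  have "inner (\<xi>1 - \<xi>2) (inv_dxx \<eta>) = inner (inv_dxx \<xi>1) \<eta> - inner (inv_dxx \<xi>2) \<eta>"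
    by (simp add: inner_inv_dxx inner_diff_left)
  also have "\<dots> = (\<integral>x. (c1 - c2) * rep_H \<eta> x + (rep_H (inv_dxx \<xi>1) x * rep_H \<eta> x - rep_H (inv_dxx \<xi>2) x * rep_H \<eta> x) \<partial>torus)"
    using rep_H_integrable rep_H_mult_integrable by (simp add: inner_H_eq rep_H_mean_zero)
  also have "\<dots> = (\<integral>x. (sinh (rep_H g1 x) - sinh (rep_H g2 x)) * rep_H \<eta> x \<partial>torus)"
    using eq by (intro integral_cong_AE) (measurable, auto elim!: eventually_mono)
  finally show "inner (\<xi>1 - \<xi>2) (inv_dxx \<eta>) = (\<integral>x. (sinh (rep_H g1 x) - sinh (rep_H g2 x)) * rep_H \<eta> x \<partial>torus)" .
qed

lemma dual_pair_unique:
  assumes "dual_pair g \<xi>1" "dual_pair g \<xi>2"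
  shows "\<xi>1 = \<xi>2"
proof -
  have "inner (\<xi>1 - \<xi>2) (inv_dxx (inv_dxx (\<xi>1 - \<xi>2))) = 0"
    unfolding inner_dual_pair_diff(1)[OF assms] by simp
  then have "inner (inv_dxx (\<xi>1 - \<xi>2)) (inv_dxx (\<xi>1 - \<xi>2)) = 0"
    by (simp add: inner_inv_dxx)
  then show ?thesis
    using inv_dxx_eq_0[of "\<xi>1 - \<xi>2"] by simp
qed

lemma dual_pair_monotone:
  assumes 1: "dual_pair g1 \<xi>1" and 2: "dual_pair g2 \<xi>2"
  shows "(norm (g1 - g2))\<^sup>2 \<le> inner (\<xi>1 - \<xi>2) (inv_dxx g1 - inv_dxx g2)"
proof -
  have "(norm (g1 - g2))\<^sup>2 \<le> (\<integral>x. (sinh (rep_H g1 x) - sinh (rep_H g2 x)) * rep_H (g1 - g2) x \<partial>torus)"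
    unfolding norm_H_sq
  proof (rule integral_mono_AE[OF rep_H_sq_integrable inner_dual_pair_diff(2)[OF 1 2]])
    show "AE x in torus. (rep_H (g1 - g2) x)\<^sup>2 \<le> (sinh (rep_H g1 x) - sinh (rep_H g2 x)) * rep_H (g1 - g2) x"
      using rep_H_minus[of g1 g2] by eventually_elim (simp add: sinh_strongly_monotone)
  qed
  then show ?thesis
    using inner_dual_pair_diff(1)[OF 1 2, of "g1 - g2"] linear_diff[OF linear_inv_dxx, of g1 g2] by simp
qed

lemma dual_pair_lipschitz:
  assumes 1: "dual_pair g1 \<xi>1" "norm \<xi>1 \<le> L" and 2: "dual_pair g2 \<xi>2" "norm \<xi>2 \<le> L"
  shows "inner (\<xi>1 - \<xi>2) (inv_dxx \<eta>) \<le> cosh (8 * L) * norm (g1 - g2) * norm \<eta>"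
proof -
  define a where "a = (\<integral>x. \<bar>rep_H (g1 - g2) x\<bar> * \<bar>rep_H \<eta> x\<bar> \<partial>torus)"
  have int: "integrable torus (\<lambda>x. \<bar>rep_H (g1 - g2) x\<bar> * \<bar>rep_H \<eta> x\<bar>)"
    using rep_H_mult_integrable[of "g1 - g2" \<eta>] by (simp flip: abs_mult)
  have "inner (\<xi>1 - \<xi>2) (inv_dxx \<eta>) \<le> (\<integral>x. cosh (8 * L) * (\<bar>rep_H (g1 - g2) x\<bar> * \<bar>rep_H \<eta> x\<bar>) \<partial>torus)"
    unfolding inner_dual_pair_diff(1)[OF 1(1) 2(1)]
  proof (rule integral_mono_AE[OF inner_dual_pair_diff(2)[OF 1(1) 2(1)]])
    show "AE x in torus. (sinh (rep_H g1 x) - sinh (rep_H g2 x)) * rep_H \<eta> x \<le> cosh (8 * L) * (\<bar>rep_H (g1 - g2) x\<bar> * \<bar>rep_H \<eta> x\<bar>)"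
      using rep_H_minus[of g1 g2] dual_pair_sinh_bound[OF 1(1)] dual_pair_sinh_bound[OF 2(1)]
    proof eventually_elim
      case (elim x)
      have "\<bar>rep_H g1 x\<bar> \<le> 8 * L" "\<bar>rep_H g2 x\<bar> \<le> 8 * L"
        using elim 1(2) 2(2) abs_le_abs_sinh[of "rep_H g1 x"] abs_le_abs_sinh[of "rep_H g2 x"] by linarith+
      then have *: "\<bar>sinh (rep_H g1 x) - sinh (rep_H g2 x)\<bar> \<le> cosh (8 * L) * \<bar>rep_H (g1 - g2) x\<bar>"
        unfolding elim by (rule sinh_lipschitz)
      have "(sinh (rep_H g1 x) - sinh (rep_H g2 x)) * rep_H \<eta> x \<le> \<bar>sinh (rep_H g1 x) - sinh (rep_H g2 x)\<bar> * \<bar>rep_H \<eta> x\<bar>"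
        by (metis abs_ge_self abs_mult)
      also have "\<dots> \<le> cosh (8 * L) * \<bar>rep_H (g1 - g2) x\<bar> * \<bar>rep_H \<eta> x\<bar>"
        using * by (intro mult_right_mono) auto
      finally show ?case
        by (simp add: mult.assoc)
    qed
  qed (use int in simp)
  also have "\<dots> = cosh (8 * L) * a"
    by (simp add: a_def)
  also have "\<dots> \<le> cosh (8 * L) * (norm (g1 - g2) * norm \<eta>)"
  proof (intro mult_left_mono)
    show "a \<le> norm (g1 - g2) * norm \<eta>"
    proof -
      have ab: "2 * (s * t) * (\<bar>p\<bar> * \<bar>q\<bar>) \<le> t\<^sup>2 * p\<^sup>2 + s\<^sup>2 * q\<^sup>2" for s t p q :: real
      proof -
        have "0 \<le> (t * \<bar>p\<bar> - s * \<bar>q\<bar>)\<^sup>2"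
          by simp
        then show ?thesis
          by (simp add: power2_diff power_mult_distrib mult_ac)
      qed
      define s t where "s = norm (g1 - g2)" and "t = norm \<eta>"
      have "2 * (s * t) * a = (\<integral>x. 2 * (s * t) * (\<bar>rep_H (g1 - g2) x\<bar> * \<bar>rep_H \<eta> x\<bar>) \<partial>torus)"
        by (simp add: a_def)
      also have "\<dots> \<le> (\<integral>x. t\<^sup>2 * (rep_H (g1 - g2) x)\<^sup>2 + s\<^sup>2 * (rep_H \<eta> x)\<^sup>2 \<partial>torus)"
        using int rep_H_sq_integrable ab by (intro integral_mono) auto
      also have "\<dots> = t\<^sup>2 * s\<^sup>2 + s\<^sup>2 * t\<^sup>2"
        using rep_H_sq_integrable by (simp add: s_def t_def norm_H_sq)
      finally have *: "(s * t) * a \<le> (s * t) * (s * t)"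
        by (simp add: power2_eq_square mult_ac)
      show ?thesis
      proof (cases "s * t = 0")
        case True
        then have "g1 - g2 = 0 \<or> \<eta> = 0"
          by (auto simp: s_def t_def)
        then have "AE x in torus. \<bar>rep_H (g1 - g2) x\<bar> * \<bar>rep_H \<eta> x\<bar> = 0"
          using rep_H_zero by (auto elim!: eventually_mono)
        then have "a = 0"
          unfolding a_def by (rule integral_eq_zero_AE)
        then show ?thesis
          by simp
      next
        case False
        then have "0 < s * t"
          by (simp add: s_def t_def)
        with * show ?thesis
          by (simp add: s_def t_def mult_le_cancel_left)
      qed
    qed
  qed simp
  finally show ?thesis
    by (simp add: mult.assoc)
qed

lemma bounded_linear_inv_dxx: "bounded_linear inv_dxx"
  using linear_inv_dxx norm_inv_dxx_le
  by (intro bounded_linear_intro[where K = 4]) (auto simp: linear_add linear_scale mult.commute)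

lemmas inv_dxx_tendsto = bounded_linear.tendsto[OF bounded_linear_inv_dxx]

lemma cosh_integral_lsc:
  assumes g: "g \<longlonglongrightarrow> \<gamma>" and fin: "\<And>n. cosh_integrable (g n)"
    and le: "\<And>n. cosh_integral (g n) \<le> a n" and a: "a \<longlonglongrightarrow> A"
  shows "cosh_integrable \<gamma>" "cosh_integral \<gamma> \<le> A"
proof -
  obtain r where r: "strict_mono r" "AE x in torus. (\<lambda>n. rep_H (g (r n)) x) \<longlonglongrightarrow> rep_H \<gamma> x"
    using H_AE_subseq[OF g] by blast
  have "(\<integral>\<^sup>+x. ennreal (cosh (rep_H \<gamma> x)) \<partial>torus) \<le> (\<integral>\<^sup>+x. liminf (\<lambda>n. ennreal (cosh (rep_H (g (r n)) x))) \<partial>torus)"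
  proof (rule nn_integral_mono_AE)
    show "AE x in torus. ennreal (cosh (rep_H \<gamma> x)) \<le> liminf (\<lambda>n. ennreal (cosh (rep_H (g (r n)) x)))"
      using r(2)
    proof eventually_elim
      case (elim x)
      have "isCont cosh (rep_H \<gamma> x)"
        using continuous_on_cosh_sinh(1) by (simp add: continuous_on_eq_continuous_at)
      then have "(\<lambda>n. cosh (rep_H (g (r n)) x)) \<longlonglongrightarrow> cosh (rep_H \<gamma> x)"
        using elim by (rule isCont_tendsto_compose)
      then have "(\<lambda>n. ennreal (cosh (rep_H (g (r n)) x))) \<longlonglongrightarrow> ennreal (cosh (rep_H \<gamma> x))"
        by (rule tendsto_ennrealI)
      from lim_imp_Liminf[OF trivial_limit_sequentially this] show ?case
        by (rule eq_refl[OF sym])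
    qed
  qed
  also have "\<dots> \<le> liminf (\<lambda>n. \<integral>\<^sup>+x. ennreal (cosh (rep_H (g (r n)) x)) \<partial>torus)"
    by (rule nn_integral_liminf) measurable
  also have "\<dots> \<le> liminf (\<lambda>n. ennreal (a (r n)))"
  proof (rule Liminf_mono, rule always_eventually, rule allI)
    fix n
    have "(\<integral>\<^sup>+x. ennreal (cosh (rep_H (g (r n)) x)) \<partial>torus) = ennreal (cosh_integral (g (r n)))"
      using fin[of "r n"] unfolding cosh_integral_def cosh_integrable_def by (intro nn_integral_eq_integral) auto
    then show "(\<integral>\<^sup>+x. ennreal (cosh (rep_H (g (r n)) x)) \<partial>torus) \<le> ennreal (a (r n))"
      using le by (simp add: ennreal_leI)
  qed
  also have "\<dots> = ennreal A"
  proof -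
    have "(\<lambda>n. a (r n)) \<longlonglongrightarrow> A"
      using LIMSEQ_subseq_LIMSEQ[OF a r(1)] by (simp add: o_def)
    then show ?thesis
      by (intro lim_imp_Liminf tendsto_ennrealI) auto
  qed
  finally have bound: "(\<integral>\<^sup>+x. ennreal (cosh (rep_H \<gamma> x)) \<partial>torus) \<le> ennreal A" .
  then show fin': "cosh_integrable \<gamma>"
    unfolding cosh_integrable_def by (intro integrableI_bounded) (auto intro: le_less_trans)
  have "0 \<le> cosh_integral (g n)" for n
    by (simp add: cosh_integral_def)
  then have "0 \<le> A"
    using le a by (intro LIMSEQ_le_const[of a A]) (auto intro: order_trans)
  have "(\<integral>\<^sup>+x. ennreal (cosh (rep_H \<gamma> x)) \<partial>torus) = ennreal (cosh_integral \<gamma>)"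
    using fin' unfolding cosh_integral_def cosh_integrable_def by (intro nn_integral_eq_integral) auto
  then show "cosh_integral \<gamma> \<le> A"
    using bound \<open>0 \<le> A\<close> by simp
qed

lemma subdiff_phi_closed:
  assumes X: "X \<longlonglongrightarrow> u" and \<xi>: "\<And>n. \<xi> n \<in> subdiff \<phi> (X n)" and L: "\<And>n. norm (\<xi> n) \<le> L"
  obtains \<eta> where "\<eta> \<in> subdiff \<phi> u" "norm \<eta> \<le> L"
proof -
  obtain g where g: "\<And>n. X n = inv_dxx (g n)" "\<And>n. dual_pair (g n) (\<xi> n)"
    using \<xi> unfolding subdiff_phi_iff by metis
  have "L \<ge> 0"
    using L[of 0] norm_ge_zero order_trans by blast
  have gdiff: "(norm (g i - g j))\<^sup>2 \<le> 2 * L * norm (X i - X j)" for i j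
  proof -
    have "(norm (g i - g j))\<^sup>2 \<le> inner (\<xi> i - \<xi> j) (X i - X j)"
      unfolding g(1) by (rule dual_pair_monotone[OF g(2) g(2)])
    also have "\<dots> \<le> norm (\<xi> i - \<xi> j) * norm (X i - X j)"
      by (rule norm_cauchy_schwarz)
    also have "\<dots> \<le> 2 * L * norm (X i - X j)"
      using norm_triangle_ineq4[of "\<xi> i" "\<xi> j"] L[of i] L[of j] by (intro mult_right_mono) auto
    finally show ?thesis .
  qed
  have "Cauchy g"
  proof (rule CauchyI)
    fix e :: real assume "e > 0"
    then have "e\<^sup>2 / (2 * L + 1) > 0"
      using \<open>L \<ge> 0\<close> by simp
    then obtain N where N: "\<And>i j. i \<ge> N \<Longrightarrow> j \<ge> N \<Longrightarrow> norm (X i - X j) < e\<^sup>2 / (2 * L + 1)"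
      using CauchyD[OF LIMSEQ_imp_Cauchy[OF X]] by blast
    have "norm (g i - g j) < e" if "i \<ge> N" "j \<ge> N" for i j
    proof -
      have "(norm (g i - g j))\<^sup>2 \<le> 2 * L * norm (X i - X j)"
        by (rule gdiff)
      also have "\<dots> \<le> (2 * L + 1) * norm (X i - X j)"
        by (simp add: distrib_right)
      also have "\<dots> < (2 * L + 1) * (e\<^sup>2 / (2 * L + 1))"
        using N[OF that] \<open>L \<ge> 0\<close> by (intro mult_strict_left_mono) auto
      also have "\<dots> = e\<^sup>2"
        using \<open>L \<ge> 0\<close> by simp
      finally show ?thesis
        using \<open>e > 0\<close> by (simp add: power2_less_imp_less)
    qed
    then show "\<exists>M. \<forall>m\<ge>M. \<forall>n\<ge>M. norm (g m - g n) < e"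
      by blast
  qed
  then obtain \<gamma> where \<gamma>: "g \<longlonglongrightarrow> \<gamma>"
    by (rule H_complete)
  have "X \<longlonglongrightarrow> inv_dxx \<gamma>"
    using inv_dxx_tendsto[OF \<gamma>] by (simp flip: g(1))
  then have u: "u = inv_dxx \<gamma>"
    using X LIMSEQ_unique by blast
  have gi: "cosh_integrable (g n)" for n
    by (rule dual_pair_cosh_integrable[OF g(2)])
  have slope: "cosh_integral (g n) \<le> cosh_integral f + L * norm (inv_dxx f - X n)" if f: "cosh_integrable f" for n f
  proof -
    have "ereal (cosh_integral (g n)) + ereal (inner (\<xi> n) (inv_dxx f - X n)) \<le> ereal (cosh_integral f)"
      using \<xi>[of n] unfolding subdiff_def phi_inv_dxx_integrable[OF f, symmetric] phi_inv_dxx_integrable[OF gi, symmetric] g(1)[symmetric]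
      by simp
    then have "cosh_integral (g n) + inner (\<xi> n) (inv_dxx f - X n) \<le> cosh_integral f"
      by simp
    moreover have "\<bar>inner (\<xi> n) (inv_dxx f - X n)\<bar> \<le> L * norm (inv_dxx f - X n)"
      by (rule order_trans[OF Cauchy_Schwarz_ineq2]) (intro mult_right_mono L norm_ge_zero)
    ultimately show ?thesis
      by linarith
  qed
  have lim: "cosh_integrable \<gamma> \<and> cosh_integral \<gamma> \<le> cosh_integral f + L * norm (inv_dxx f - u)" if f: "cosh_integrable f" for f
  proof -
    have "(\<lambda>n. cosh_integral f + L * norm (inv_dxx f - X n)) \<longlonglongrightarrow> cosh_integral f + L * norm (inv_dxx f - u)"
      by (intro tendsto_intros X)
    then show ?thesis
      using cosh_integral_lsc[OF \<gamma> gi slope[OF f]] by blast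
  qed
  have \<gamma>i: "cosh_integrable \<gamma>"
    using lim[OF gi[of 0]] by blast
  have "\<phi> (inv_dxx \<gamma>) \<le> \<phi> v + ereal (L * norm (v - inv_dxx \<gamma>))" for v
  proof (cases "v \<in> eff_domain \<phi>")
    case False
    then show ?thesis
      by (simp add: eff_domain_def)
  next
    case True
    then obtain f where f: "cosh_integrable f" and v: "v = inv_dxx f"
      unfolding eff_domain_phi by blast
    then show ?thesis
      using lim[OF f] by (simp add: phi_inv_dxx_integrable \<gamma>i u)
  qed
  then obtain \<eta> c where "norm \<eta> \<le> L" "AE x in torus. sinh (rep_H \<gamma> x) = c + rep_H (inv_dxx \<eta>) x"
    using slope_imp_sinh_eq[OF \<gamma>i \<open>L \<ge> 0\<close>] by blast
  then show thesis
    using that[of \<eta>] unfolding u by (auto simp: subdiff_phi_iff dual_pair_def)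
qed

lemma slope_imp_subdiff:
  assumes u: "u \<in> eff_domain \<phi>" and "L \<ge> 0"
    and slope: "\<And>v. \<phi> u \<le> \<phi> v + ereal (L * norm (v - u))"
  obtains \<xi> where "\<xi> \<in> subdiff \<phi> u" "norm \<xi> \<le> L"
proof -
  obtain g where g: "cosh_integrable g" "u = inv_dxx g"
    using u unfolding eff_domain_phi by blast
  obtain \<xi> c where "norm \<xi> \<le> L" "AE x in torus. sinh (rep_H g x) = c + rep_H (inv_dxx \<xi>) x"
    using slope_imp_sinh_eq[OF g(1) \<open>L \<ge> 0\<close>] slope unfolding g(2) by blast
  then show thesis
    using that[of \<xi>] g(2) by (auto simp: subdiff_phi_iff dual_pair_def)
qed

lemma inv_dxx_Linf_dense:
  assumes "e > 0"
  obtains \<zeta> where "\<zeta> \<in> Linf" "norm (inv_dxx \<zeta> - \<eta>) < e"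
proof -
  have bnd: "inner \<eta> (inv_dxx x) \<le> norm \<eta> * norm (inv_dxx x)" for x
    by (rule norm_cauchy_schwarz)
  have add: "inner \<eta> (inv_dxx (x + y)) = inner \<eta> (inv_dxx x) + inner \<eta> (inv_dxx y)" for x y
    by (simp add: linear_add[OF linear_inv_dxx] inner_add_right)
  have scale: "inner \<eta> (inv_dxx (c *\<^sub>R x)) = c * inner \<eta> (inv_dxx x)" for c x
    by (simp add: linear_scale[OF linear_inv_dxx])
  obtain \<xi> z where z: "\<And>n. z n \<in> Linf" "(\<lambda>n. inv_dxx (z n)) \<longlonglongrightarrow> \<xi>"
    and \<xi>: "\<And>x. x \<in> Linf \<Longrightarrow> inner \<eta> (inv_dxx x) = inner \<xi> (inv_dxx x)"
    using riesz_on_range[OF linear_inv_dxx subspace_Linf, of "\<lambda>x. inner \<eta> (inv_dxx x)" "norm \<eta>"] add scale bnd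
    by (metis norm_ge_zero)
  have "inner (\<eta> - \<xi>) (inv_dxx (inv_dxx (\<eta> - \<xi>))) = 0"
    using \<xi>[OF inv_dxx_Linf] by (simp add: inner_diff_left)
  then have "inner (inv_dxx (\<eta> - \<xi>)) (inv_dxx (\<eta> - \<xi>)) = 0"
    by (simp add: inner_inv_dxx)
  then have "\<eta> = \<xi>"
    using inv_dxx_eq_0[of "\<eta> - \<xi>"] by simp
  then obtain n where "norm (inv_dxx (z n) - \<eta>) < e"
    using LIMSEQ_D[OF z(2) \<open>e > 0\<close>] by blast
  then show thesis
    using that z(1) by blast
qed

lemma weak_deriv_sinh_dxx:
  assumes "\<xi> \<in> subdiff \<phi> u"
  shows "weak_deriv 2 (\<lambda>x. sinh (dxx u x)) (rep_H \<xi>)"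
proof -
  obtain g c where u: "u = inv_dxx g" and g: "cosh_integrable g"
    and c: "AE x in torus. sinh (rep_H g x) = c + rep_H (inv_dxx \<xi>) x"
    using assms by (rule subdiff_imp_sinh_eq)
  have [measurable]: "dxx u \<in> borel_measurable torus"
    unfolding u by (rule dxx_inv_dxx(2))
  have eq: "AE x in torus. sinh (dxx u x) = c + rep_H (inv_dxx \<xi>) x"
    using c dxx_inv_dxx(1)[of g] unfolding u by eventually_elim simp
  have "integrable torus (\<lambda>x. c + rep_H (inv_dxx \<xi>) x)"
    using rep_H_integrable by simp
  then have "integrable torus (\<lambda>x. sinh (dxx u x))"
    by (subst integrable_cong_AE[OF _ _ eq]) measurable
  moreover have "(\<integral>x. sinh (dxx u x) * deriv (deriv \<psi>) x \<partial>torus) = (\<integral>x. rep_H \<xi> x * \<psi> x \<partial>torus)"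
    if \<psi>: "torus_test \<psi>" for \<psi>
  proof -
    define \<psi>2 where "\<psi>2 = deriv (deriv \<psi>)"
    have \<psi>2: "\<psi>2 \<in> H_carrier"
      unfolding \<psi>2_def by (rule deriv_test_H_carrier[OF torus_test_deriv[OF \<psi>]])
    have [measurable]: "\<psi>2 \<in> borel_measurable torus"
      using \<psi>2 by (simp add: H_carrier_def L2_torus_def)
    have "(\<integral>x. sinh (dxx u x) * \<psi>2 x \<partial>torus) = (\<integral>x. c * \<psi>2 x + rep_H (inv_dxx \<xi>) x * \<psi>2 x \<partial>torus)"
      using eq by (intro integral_cong_AE) (measurable, auto elim!: eventually_mono simp: distrib_right)
    also have "\<dots> = c * (\<integral>x. \<psi>2 x \<partial>torus) + (\<integral>x. rep_H (inv_dxx \<xi>) x * \<psi>2 x \<partial>torus)"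
      using L2_integrable[OF H_carrier_L2[OF \<psi>2]] L2_mult_integrable[OF rep_H_L2 H_carrier_L2[OF \<psi>2]] by simp
    also have "\<dots> = (\<integral>x. rep_H \<xi> x * \<psi> x \<partial>torus)"
      using \<psi>2 integral_inv_dxx_test[OF \<psi>, of \<xi>] by (simp add: H_carrier_def \<psi>2_def)
    finally show ?thesis
      by (simp add: \<psi>2_def)
  qed
  ultimately show ?thesis
    using rep_H_integrable by (simp add: weak_deriv_def numeral_2_eq_2)
qed

lemma subdiff_phi_unique: "\<xi> \<in> subdiff \<phi> u \<Longrightarrow> \<eta> \<in> subdiff \<phi> u \<Longrightarrow> \<xi> = \<eta>"
  unfolding subdiff_phi_iff using dual_pair_unique inv_dxx_inject by metis

section \<open>Regularity of the flow\<close>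

lemma AE_lebesgue_ex_between:
  assumes "AE x in lebesgue. P x" "a < (b :: real)"
  obtains x where "a < x" "x < b" "P x"
proof -
  have "negligible {x. \<not> P x}"
    using assms(1) by (simp add: negligible_iff_null_sets completion.AE_iff_null_sets)
  then have "\<not> {a<..<b} \<subseteq> {x. \<not> P x}"
    using assms(2) negligible_subset open_not_negligible[of "{a<..<b}"] by auto
  then show thesis
    using that by auto
qed

lemma lam_nonneg: "0 \<le> lam"
  by (simp add: lam_def)

lemma EVI_phi_subdiff:
  assumes evi: "EVI_curve \<phi> lam h0 h" and \<xi>: "\<xi> \<in> subdiff \<phi> h0" and "0 \<le> t"
  obtains \<eta> where "\<eta> \<in> subdiff \<phi> (h t)" "norm \<eta> \<le> exp (- lam * t) * norm \<xi>"
proof (cases "t = 0")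
  case True
  then show thesis
    using that[of \<xi>] evi \<xi> by (simp add: EVI_curve_def)
next
  case False
  then have "0 < t"
    using \<open>0 \<le> t\<close> by simp
  have ex: "\<exists>\<eta>. \<eta> \<in> subdiff \<phi> (h t) \<and> norm \<eta> \<le> exp (- lam * r) * norm \<xi>" if r: "0 \<le> r" "r < t" for r
  proof -
    define P where "P s \<longleftrightarrow> (0 < s \<longrightarrow> h s \<in> eff_domain \<phi> \<and>
      (\<forall>v. \<phi> (h s) \<le> \<phi> v + ereal (exp (- lam * s) * norm \<xi> * norm (v - h s))))" for s
    have P: "AE s in lebesgue. P s"
      unfolding P_def by (rule EVI_slope[OF evi phi_nonneg lam_nonneg \<xi>])
    have "\<exists>s. max r (t - 1 / real (Suc n)) < s \<and> s < t \<and> P s" for n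
      using AE_lebesgue_ex_between[OF P, of "max r (t - 1 / real (Suc n))" t] r by auto
    then obtain s where s: "\<And>n. max r (t - 1 / real (Suc n)) < s n" "\<And>n. s n < t" "\<And>n. P (s n)"
      by metis
    have s_lim: "s \<longlonglongrightarrow> t"
    proof (rule tendsto_sandwich[OF always_eventually always_eventually])
      show "\<forall>n. t - 1 / real (Suc n) \<le> s n" "\<forall>n. s n \<le> t"
        using s(1,2) by (auto intro: less_imp_le)
      show "(\<lambda>n. t - 1 / real (Suc n)) \<longlonglongrightarrow> t"
        using tendsto_diff[OF tendsto_const LIMSEQ_inverse_real_of_nat, of t] by (simp add: inverse_eq_divide)
    qed simp
    have "isCont h t"
      using evi \<open>0 < t\<close> by (auto simp: EVI_curve_def intro: loc_abs_cont_isCont)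
    then have h_lim: "(\<lambda>n. h (s n)) \<longlonglongrightarrow> h t"
      using s_lim by (rule isCont_tendsto_compose)
    have "\<exists>\<zeta>. \<zeta> \<in> subdiff \<phi> (h (s n)) \<and> norm \<zeta> \<le> exp (- lam * r) * norm \<xi>" for n
    proof -
      have "0 < s n" "r < s n"
        using s(1)[of n] r by auto
      then have dom: "h (s n) \<in> eff_domain \<phi>"
        and slope: "\<phi> (h (s n)) \<le> \<phi> v + ereal (exp (- lam * s n) * norm \<xi> * norm (v - h (s n)))" for v
        using s(3)[of n] unfolding P_def by blast+
      have "0 \<le> exp (- lam * s n) * norm \<xi>"
        by simp
      then obtain \<zeta> where "\<zeta> \<in> subdiff \<phi> (h (s n))" "norm \<zeta> \<le> exp (- lam * s n) * norm \<xi>"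
        using slope_imp_subdiff[OF dom _ slope] by blast
      moreover have "exp (- lam * s n) * norm \<xi> \<le> exp (- lam * r) * norm \<xi>"
        using \<open>r < s n\<close> lam_nonneg by (intro mult_right_mono) (auto intro: mult_left_mono)
      ultimately show ?thesis
        by (meson order_trans)
    qed
    then obtain \<zeta> where "\<And>n. \<zeta> n \<in> subdiff \<phi> (h (s n))" "\<And>n. norm (\<zeta> n) \<le> exp (- lam * r) * norm \<xi>"
      by metis
    then show ?thesis
      using subdiff_phi_closed[OF h_lim] by metis
  qed
  then obtain \<eta> where \<eta>: "\<eta> \<in> subdiff \<phi> (h t)"
    using \<open>0 < t\<close> by blast
  have le: "norm \<eta> \<le> exp (- lam * r) * norm \<xi>" if r: "0 \<le> r" "r < t" for r
    using ex[OF r] subdiff_phi_unique[OF \<eta>] by blast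
  have "norm \<eta> \<le> exp (- lam * t) * norm \<xi>"
  proof (rule tendsto_lowerbound)
    show "((\<lambda>r. exp (- lam * r) * norm \<xi>) \<longlongrightarrow> exp (- lam * t) * norm \<xi>) (at_left t)"
      by (intro tendsto_intros)
    show "\<forall>\<^sub>F r in at_left t. norm \<eta> \<le> exp (- lam * r) * norm \<xi>"
      unfolding eventually_at_left[OF \<open>0 < t\<close>] using le \<open>0 < t\<close> by (intro exI[of _ 0]) auto
  qed simp
  with \<eta> show thesis
    by (rule that)
qed

lemma subgrad_phi:
  assumes "\<xi> \<in> subdiff \<phi> u"
  shows "subgrad \<phi> u = \<xi>" "subdiff \<phi> u = {\<xi>}"
  using assms subdiff_phi_unique unfolding subgrad_def by blast+

lemma dini_nonincreasing:
  fixes g :: "real \<Rightarrow> real"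
  assumes "a \<le> b" and cont: "continuous_on {a..b} g"
    and dini: "\<And>x e. a \<le> x \<Longrightarrow> x < b \<Longrightarrow> 0 < e \<Longrightarrow> \<forall>\<^sub>F y in at_right x. g y - g x \<le> e * (y - x)"
  shows "g b \<le> g a"
proof (rule field_le_epsilon)
  fix e' :: real assume "e' > 0"
  define e where "e = e' / (b - a + 1)"
  have "e > 0"
    using \<open>e' > 0\<close> \<open>a \<le> b\<close> by (simp add: e_def)
  define S where "S = {x \<in> {a..b}. g x - g a \<le> e * (x - a)}"
  have "closed S"
  proof -
    have "continuous_on {a..b} (\<lambda>x. g x - g a)" "continuous_on {a..b} (\<lambda>x. e * (x - a))"
      by (intro continuous_intros cont)+
    then show ?thesis
      unfolding S_def by (intro continuous_on_closed_Collect_le) auto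
  qed
  have "a \<in> S"
    using \<open>a \<le> b\<close> by (simp add: S_def)
  have "S \<noteq> {}" "bdd_above S"
    using \<open>a \<in> S\<close> by (auto simp: S_def intro!: bdd_aboveI[of _ b])
  define x where "x = Sup S"
  have "x \<in> S"
    unfolding x_def using closed_contains_Sup[OF \<open>S \<noteq> {}\<close> \<open>bdd_above S\<close> \<open>closed S\<close>] .
  have "x = b"
  proof (rule ccontr)
    assume "x \<noteq> b"
    then have x: "a \<le> x" "x < b"
      using \<open>x \<in> S\<close> by (auto simp: S_def)
    obtain c where c: "c > x" "\<And>y. x < y \<Longrightarrow> y < c \<Longrightarrow> g y - g x \<le> e * (y - x)"
      using dini[OF x \<open>e > 0\<close>] unfolding eventually_at_right[OF x(2)] by blast
    define y where "y = (x + min b c) / 2"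
    have y: "x < y" "y < c" "y < b"
      using x c(1) by (auto simp: y_def)
    have "g y - g a \<le> e * (y - x) + e * (x - a)"
      using c(2)[OF y(1,2)] \<open>x \<in> S\<close> by (simp add: S_def)
    then have "y \<in> S"
      using x y by (simp add: S_def algebra_simps)
    then have "y \<le> x"
      unfolding x_def using \<open>bdd_above S\<close> by (rule cSup_upper)
    then show False
      using y by simp
  qed
  then have "g b - g a \<le> e * (b - a)"
    using \<open>x \<in> S\<close> by (simp add: S_def)
  also have "\<dots> \<le> e * (b - a + 1)"
    using \<open>e > 0\<close> by simp
  also have "\<dots> = e'"
    using \<open>a \<le> b\<close> by (simp add: e_def)
  finally show "g b \<le> g a + e'"
    by simp
qed

lemma norm_diff_sq: "(norm (x - y))\<^sup>2 = (norm x)\<^sup>2 + (norm y)\<^sup>2 - 2 * inner x y" for x y :: "'a::real_inner"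
  by (simp add: power2_norm_eq_inner inner_diff_left inner_diff_right inner_commute)

lemma tendsto_zero_if_sq_le:
  fixes f :: "'a \<Rightarrow> 'b::real_normed_vector"
  assumes "(b \<longlongrightarrow> (0 :: real)) F" "\<forall>\<^sub>F x in F. (norm (f x))\<^sup>2 \<le> b x"
  shows "(f \<longlongrightarrow> 0) F"
proof (rule Lim_null_comparison)
  show "\<forall>\<^sub>F x in F. norm (f x) \<le> sqrt (b x)"
    using assms(2) by eventually_elim (rule real_le_rsqrt)
  show "((\<lambda>x. sqrt (b x)) \<longlongrightarrow> 0) F"
    using tendsto_real_sqrt[OF assms(1)] by simp
qed

locale phi_flow =
  fixes h :: "real \<Rightarrow> H" and h0 :: H
  assumes evi: "EVI_curve \<phi> lam h0 h" and h0: "h0 \<in> subdiff_domain \<phi>"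
begin

definition grad :: "real \<Rightarrow> H" where
  "grad t = subgrad \<phi> (h t)"

definition M :: real where
  "M = norm (grad 0)"

lemma h_0: "h 0 = h0"
  using evi by (simp add: EVI_curve_def)

lemma evi_shift: "0 \<le> s \<Longrightarrow> EVI_curve \<phi> lam (h s) (\<lambda>t. h (t + s))"
  by (rule EVI_shift[OF evi])

lemma grad_subdiff:
  assumes "0 \<le> t"
  shows "grad t \<in> subdiff \<phi> (h t)"
proof -
  obtain \<xi> where "\<xi> \<in> subdiff \<phi> h0"
    using h0 by (auto simp: subdiff_domain_def)
  then obtain \<eta> where "\<eta> \<in> subdiff \<phi> (h t)"
    using EVI_phi_subdiff[OF evi _ assms] by blast
  then show ?thesis
    using subgrad_phi(1) by (simp add: grad_def)
qed

lemma grad_decay: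
  assumes "0 \<le> s" "s \<le> t"
  shows "norm (grad t) \<le> exp (- lam * (t - s)) * norm (grad s)"
proof -
  obtain \<eta> where \<eta>: "\<eta> \<in> subdiff \<phi> (h (t - s + s))" "norm \<eta> \<le> exp (- lam * (t - s)) * norm (grad s)"
    using EVI_phi_subdiff[OF evi_shift[OF assms(1)] grad_subdiff[OF assms(1)], of "t - s"] assms by auto
  then have "\<eta> \<in> subdiff \<phi> (h t)"
    by simp
  then have "\<eta> = grad t"
    using subgrad_phi(1) by (simp add: grad_def)
  then show ?thesis
    using \<eta>(2) by simp
qed

lemma grad_mono:
  assumes "0 \<le> s" "s \<le> t"
  shows "norm (grad t) \<le> norm (grad s)"
proof -
  have "exp (- lam * (t - s)) \<le> 1"
    using assms lam_nonneg by simp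
  then have "exp (- lam * (t - s)) * norm (grad s) \<le> 1 * norm (grad s)"
    by (intro mult_right_mono) auto
  then show ?thesis
    using grad_decay[OF assms] by simp
qed

lemma grad_le_M: "0 \<le> t \<Longrightarrow> norm (grad t) \<le> M"
  unfolding M_def by (rule grad_mono) auto

lemma M_nonneg: "0 \<le> M"
  by (simp add: M_def)

lemma h_speed:
  assumes "0 \<le> s" "s \<le> t"
  shows "norm (h s - h t) \<le> (t - s) * norm (grad s)"
  using EVI_speed[OF evi_shift[OF assms(1)] phi_nonneg lam_nonneg grad_subdiff[OF assms(1)], of "t - s"] assms
  by (simp add: norm_minus_commute)

lemma h_lipschitz:
  assumes "0 \<le> s" "0 \<le> t"
  shows "norm (h s - h t) \<le> M * \<bar>s - t\<bar>"
proof -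
  have *: "norm (h s - h t) \<le> M * (t - s)" if "0 \<le> s" "s \<le> t" for s t
  proof -
    have "norm (h s - h t) \<le> (t - s) * norm (grad s)"
      by (rule h_speed[OF that])
    also have "\<dots> \<le> (t - s) * M"
      using that by (intro mult_left_mono grad_le_M) auto
    finally show ?thesis
      by (simp add: mult.commute)
  qed
  show ?thesis
    using *[of s t] *[of t s] assms by (cases "s \<le> t") (auto simp: norm_minus_commute)
qed

lemma h_continuous: "continuous_on {0..} h"
proof -
  have "M-lipschitz_on {0..} h"
    using h_lipschitz M_nonneg by (intro lipschitz_onI) (auto simp: dist_norm dist_real_def)
  then show ?thesis
    by (rule lipschitz_on_continuous_on)
qed

definition w :: "real \<Rightarrow> H" where
  "w t = (SOME g. h t = inv_dxx g \<and> dual_pair g (grad t))"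

lemma w:
  assumes "0 \<le> t"
  shows "h t = inv_dxx (w t)" "dual_pair (w t) (grad t)"
proof -
  have "\<exists>g. h t = inv_dxx g \<and> dual_pair g (grad t)"
    using grad_subdiff[OF assms] by (simp add: subdiff_phi_iff)
  then have "h t = inv_dxx (w t) \<and> dual_pair (w t) (grad t)"
    unfolding w_def by (rule someI_ex)
  then show "h t = inv_dxx (w t)" "dual_pair (w t) (grad t)"
    by auto
qed

lemma w_diff_le:
  assumes "0 \<le> s" "0 \<le> t"
  shows "(norm (w s - w t))\<^sup>2 \<le> norm (grad s - grad t) * norm (h s - h t)"
proof -
  have "(norm (w s - w t))\<^sup>2 \<le> inner (grad s - grad t) (h s - h t)"
    unfolding w(1)[OF assms(1)] w(1)[OF assms(2)] by (rule dual_pair_monotone[OF w(2)[OF assms(1)] w(2)[OF assms(2)]])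
  also have "\<dots> \<le> norm (grad s - grad t) * norm (h s - h t)"
    by (rule norm_cauchy_schwarz)
  finally show ?thesis .
qed

lemma w_hoelder:
  assumes "0 \<le> s" "0 \<le> t"
  shows "norm (w s - w t) \<le> 2 * M * sqrt \<bar>s - t\<bar>"
proof (rule power2_le_imp_le)
  have "(norm (w s - w t))\<^sup>2 \<le> norm (grad s - grad t) * norm (h s - h t)"
    by (rule w_diff_le[OF assms])
  also have "\<dots> \<le> (2 * M) * (M * \<bar>s - t\<bar>)"
    using norm_triangle_ineq4[of "grad s" "grad t"] grad_le_M[OF assms(1)] grad_le_M[OF assms(2)] M_nonneg
    by (intro mult_mono h_lipschitz assms) auto
  also have "\<dots> \<le> 4 * (M * (M * \<bar>s - t\<bar>))"
    using M_nonneg by simp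
  also have "\<dots> = (2 * M * sqrt \<bar>s - t\<bar>)\<^sup>2"
    by (simp add: power_mult_distrib power2_eq_square)
  finally show "(norm (w s - w t))\<^sup>2 \<le> (2 * M * sqrt \<bar>s - t\<bar>)\<^sup>2" .
qed (simp add: M_nonneg)

lemma w_tendsto:
  assumes "0 \<le> t"
  shows "(w \<longlongrightarrow> w t) (at t within {0..})"
proof -
  have "((\<lambda>s. w s - w t) \<longlongrightarrow> 0) (at t within {0..})"
  proof (rule Lim_null_comparison)
    show "\<forall>\<^sub>F s in at t within {0..}. norm (w s - w t) \<le> 2 * M * sqrt \<bar>s - t\<bar>"
      unfolding eventually_at_filter by (rule always_eventually) (auto intro: w_hoelder assms)
    have "((\<lambda>s. 2 * M * sqrt \<bar>s - t\<bar>) \<longlongrightarrow> 2 * M * sqrt \<bar>t - t\<bar>) (at t within {0..})"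
      by (intro tendsto_intros)
    then show "((\<lambda>s. 2 * M * sqrt \<bar>s - t\<bar>) \<longlongrightarrow> 0) (at t within {0..})"
      by simp
  qed
  then show ?thesis
    by (simp add: LIM_zero_iff)
qed

lemma grad_weak_continuous:
  assumes "0 \<le> t"
  shows "((\<lambda>s. inner (grad s) \<eta>) \<longlongrightarrow> inner (grad t) \<eta>) (at t within {0..})"
proof (rule tendstoI)
  fix e :: real assume "e > 0"
  then have "e / (4 * (M + 1)) > 0"
    using M_nonneg by simp
  then obtain \<zeta> where \<zeta>: "norm (inv_dxx \<zeta> - \<eta>) < e / (4 * (M + 1))"
    using inv_dxx_Linf_dense by blast
  define C where "C = cosh (8 * M) * norm \<zeta>"
  have "((\<lambda>s. C * norm (w s - w t)) \<longlongrightarrow> C * norm (w t - w t)) (at t within {0..})"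
    by (intro tendsto_intros w_tendsto assms)
  then have "\<forall>\<^sub>F s in at t within {0..}. C * norm (w s - w t) < e / 2"
    using \<open>e > 0\<close> by (intro order_tendstoD(2)) auto
  moreover have "\<forall>\<^sub>F s in at t within {0..}. s \<in> {0..}"
    by (simp add: eventually_at_filter)
  ultimately show "\<forall>\<^sub>F s in at t within {0..}. dist (inner (grad s) \<eta>) (inner (grad t) \<eta>) < e"
  proof eventually_elim
    case (elim s)
    then have s: "0 \<le> s"
      by simp
    have b: "inner (grad p - grad q) (inv_dxx \<zeta>) \<le> C * norm (w p - w q)" if "0 \<le> p" "0 \<le> q" for p q
      using dual_pair_lipschitz[OF w(2)[OF that(1)] grad_le_M[OF that(1)] w(2)[OF that(2)] grad_le_M[OF that(2)], of \<zeta>]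
      by (simp add: C_def mult_ac)
    have 1: "\<bar>inner (grad s - grad t) (inv_dxx \<zeta>)\<bar> \<le> C * norm (w s - w t)"
      using b[OF s assms] b[OF assms s] by (simp add: inner_diff_left norm_minus_commute abs_le_iff)
    have "\<bar>inner (grad s - grad t) (inv_dxx \<zeta> - \<eta>)\<bar> \<le> norm (grad s - grad t) * norm (inv_dxx \<zeta> - \<eta>)"
      by (rule Cauchy_Schwarz_ineq2)
    also have "\<dots> \<le> (2 * (M + 1)) * (e / (4 * (M + 1)))"
      using norm_triangle_ineq4[of "grad s" "grad t"] grad_le_M[OF s] grad_le_M[OF assms] \<zeta> M_nonneg
      by (intro mult_mono) auto
    also have "\<dots> = e / 2"
      using M_nonneg by (simp add: field_simps)
    finally have 2: "\<bar>inner (grad s - grad t) (inv_dxx \<zeta> - \<eta>)\<bar> \<le> e / 2" .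
    have "inner (grad s) \<eta> - inner (grad t) \<eta> =
       inner (grad s - grad t) (inv_dxx \<zeta>) - inner (grad s - grad t) (inv_dxx \<zeta> - \<eta>)"
      by (simp add: inner_diff_left inner_diff_right)
    then show ?case
      using 1 2 elim(1) unfolding dist_real_def by linarith
  qed
qed

lemma grad_right_continuous:
  assumes "0 \<le> t"
  shows "(grad \<longlongrightarrow> grad t) (at_right t)"
proof -
  have "((\<lambda>s. inner (grad s) (grad t)) \<longlongrightarrow> inner (grad t) (grad t)) (at_right t)"
    using grad_weak_continuous[OF assms] by (rule tendsto_within_subset) (use assms in auto)
  then have "((\<lambda>s. 2 * (norm (grad t))\<^sup>2 - 2 * inner (grad s) (grad t)) \<longlongrightarrow> 2 * (norm (grad t))\<^sup>2 - 2 * inner (grad t) (grad t)) (at_right t)"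
    by (intro tendsto_diff tendsto_mult tendsto_const)
  then have "((\<lambda>s. 2 * (norm (grad t))\<^sup>2 - 2 * inner (grad s) (grad t)) \<longlongrightarrow> 0) (at_right t)"
    by (simp add: power2_norm_eq_inner)
  moreover have "\<forall>\<^sub>F s in at_right t. (norm (grad s - grad t))\<^sup>2 \<le> 2 * (norm (grad t))\<^sup>2 - 2 * inner (grad s) (grad t)"
    using eventually_at_right_less[of t]
  proof eventually_elim
    case (elim s)
    have "(norm (grad s))\<^sup>2 \<le> (norm (grad t))\<^sup>2"
      using grad_mono[OF assms, of s] elim by (intro power_mono) auto
    then show ?case
      by (simp add: norm_diff_sq)
  qed
  ultimately have "((\<lambda>s. grad s - grad t) \<longlongrightarrow> 0) (at_right t)"
    by (rule tendsto_zero_if_sq_le)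
  then show ?thesis
    by (simp add: LIM_zero_iff)
qed

end

lemma dual_pair_zero: "dual_pair 0 0"
proof -
  have "AE x in torus. sinh (rep_H 0 x) = 0 + rep_H (inv_dxx 0) x"
    unfolding linear_0[OF linear_inv_dxx] using rep_H_zero by eventually_elim simp
  then show ?thesis
    unfolding dual_pair_def by blast
qed

lemma dual_pair_integral:
  assumes "dual_pair g \<xi>"
  shows "(\<integral>x. sinh (rep_H g x) * rep_H \<zeta> x \<partial>torus) = inner \<xi> (inv_dxx \<zeta>)"
proof -
  have "inner \<xi> (inv_dxx \<zeta>) = (\<integral>x. (sinh (rep_H g x) - sinh (rep_H 0 x)) * rep_H \<zeta> x \<partial>torus)"
    using inner_dual_pair_diff(1)[OF assms dual_pair_zero, of \<zeta>] by simp
  also have "\<dots> = (\<integral>x. sinh (rep_H g x) * rep_H \<zeta> x \<partial>torus)"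
    using rep_H_zero by (intro integral_cong_AE) (measurable, auto elim!: eventually_mono)
  finally show ?thesis ..
qed

lemma at_left_eq_within:
  assumes "0 < (t :: real)"
  shows "at_left t = at t within {0..<t}"
proof (rule at_within_nhd[of t "{0<..}"])
  show "{..<t} \<inter> {0<..} - {t} = {0..<t} \<inter> {0<..} - {t}"
    by auto
qed (use assms in auto)

context phi_flow
begin

lemma inner_h_AE_derivative:
  assumes \<zeta>: "\<zeta> \<in> Linf"
  shows "AE t in lebesgue. 0 < t \<longrightarrow> (\<exists>d. ((\<lambda>s. inner (h s) (inv_dxx \<zeta>)) has_real_derivative d) (at t) \<and>
    - d \<le> inner (grad t) (inv_dxx \<zeta>))"
proof -
  have ne: "eff_domain \<phi> \<noteq> {}"
    using h0 by (auto simp: subdiff_domain_def)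
  show ?thesis
    using EVI_weak_derivative[OF evi phi_nonneg lam_nonneg ne]
  proof eventually_elim
    case (elim t)
    show ?case
    proof
      assume "0 < t"
      then have t: "0 \<le> t"
        by simp
      have ci: "cosh_integrable (w t)"
        by (rule dual_pair_cosh_integrable[OF w(2)[OF t]])
      have eq: "h t + \<epsilon> *\<^sub>R inv_dxx \<zeta> = inv_dxx (w t + \<epsilon> *\<^sub>R \<zeta>)" for \<epsilon>
        by (simp add: w(1)[OF t] inv_dxx_add_scaleR)
      have "h t + \<epsilon> *\<^sub>R inv_dxx \<zeta> \<in> eff_domain \<phi>" for \<epsilon>
        unfolding eq eff_domain_phi using cosh_integrable_add[OF ci \<zeta>] by blast
      then obtain d where d: "((\<lambda>s. inner (h s) (inv_dxx \<zeta>)) has_real_derivative d) (at t)"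
        and ineq: "\<And>\<epsilon>. - \<epsilon> * d \<le> real_of_ereal (\<phi> (h t + \<epsilon> *\<^sub>R inv_dxx \<zeta>)) - real_of_ereal (\<phi> (h t))"
        using elim \<open>0 < t\<close> by blast
      have "- d \<le> (\<integral>x. sinh (rep_H (w t) x) * rep_H \<zeta> x \<partial>torus)"
      proof (rule le_sinh_integral_if_slope[OF ci \<zeta>])
        fix \<epsilon> :: real
        show "cosh_integral (w t) + \<epsilon> * - d \<le> cosh_integral (w t + \<epsilon> *\<^sub>R \<zeta>)"
          using ineq[of \<epsilon>] unfolding eq unfolding w(1)[OF t] phi_inv_dxx_integrable[OF ci]
            phi_inv_dxx_integrable[OF cosh_integrable_add[OF ci \<zeta>]] by simp
      qed
      then show "\<exists>d. ((\<lambda>s. inner (h s) (inv_dxx \<zeta>)) has_real_derivative d) (at t) \<and> - d \<le> inner (grad t) (inv_dxx \<zeta>)"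
        using d unfolding dual_pair_integral[OF w(2)[OF t]] by blast
    qed
  qed
qed

lemma inner_h_diff_le_regular:
  assumes \<zeta>: "\<zeta> \<in> Linf" and sr: "0 \<le> s" "s \<le> r"
    and le: "\<And>\<tau>. s \<le> \<tau> \<Longrightarrow> \<tau> \<le> r \<Longrightarrow> inner (grad \<tau>) (inv_dxx \<zeta>) \<le> m"
  shows "inner (h s - h r) (inv_dxx \<zeta>) \<le> (r - s) * m"
proof -
  define G where "G \<tau> = - inner (h \<tau>) (inv_dxx \<zeta>) - m * \<tau>" for \<tau>
  have mono: "G r \<le> G a" if a: "0 < a" "s \<le> a" "a \<le> r" for a
  proof (rule abs_cont_on_nonincreasing[OF a(3)])
    show ha: "abs_cont_on a r h"
      using evi a by (auto simp: EVI_curve_def loc_abs_cont_def)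
    show "abs_cont_on a r G"
    proof (rule abs_cont_on_dominated[OF ha ha])
      fix p q assume pq: "a \<le> p" "p \<le> q" "q \<le> r"
      define N where "N = norm (inv_dxx \<zeta>)"
      have "N \<ge> 0"
        by (simp add: N_def)
      have "G q - G p = - inner (h q - h p) (inv_dxx \<zeta>) - m * (q - p)"
        by (simp add: G_def inner_diff_left right_diff_distrib)
      then have "\<bar>G q - G p\<bar> \<le> \<bar>inner (h q - h p) (inv_dxx \<zeta>)\<bar> + \<bar>m * (q - p)\<bar>"
        by linarith
      also have "\<dots> \<le> norm (h q - h p) * N + \<bar>m\<bar> * (q - p)"
        using pq Cauchy_Schwarz_ineq2[of "h q - h p" "inv_dxx \<zeta>"] by (simp add: N_def abs_mult)
      also have "\<dots> \<le> (N + \<bar>m\<bar>) * norm (h q - h p) + (N + \<bar>m\<bar>) * (q - p)"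
        using pq \<open>N \<ge> 0\<close> by (intro add_mono) (auto simp: distrib_right mult.commute[of _ N])
      also have "\<dots> \<le> (N + \<bar>m\<bar>) * (norm (h q - h p) + norm (h q - h p) + (q - p))"
        using \<open>N \<ge> 0\<close> by (simp add: distrib_left)
      finally show "norm (G q - G p) \<le> (norm (inv_dxx \<zeta>) + \<bar>m\<bar>) * (norm (h q - h p) + norm (h q - h p) + (q - p))"
        by (simp add: N_def)
    qed simp
    show "AE x in lebesgue. a < x \<and> x < r \<longrightarrow>
      (\<exists>A D. (A has_real_derivative D) (at x) \<and> D \<le> 0 \<and>
        (\<forall>\<epsilon>>0. \<forall>\<^sub>F t in nhds x. \<bar>G t - A t\<bar> \<le> \<epsilon> * norm (h t - h x)))"
      using inner_h_AE_derivative[OF \<zeta>]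
    proof eventually_elim
      case (elim x)
      show ?case
      proof
        assume x: "a < x \<and> x < r"
        then obtain d where d: "((\<lambda>s. inner (h s) (inv_dxx \<zeta>)) has_real_derivative d) (at x)"
          "- d \<le> inner (grad x) (inv_dxx \<zeta>)"
          using elim a by auto
        have "(G has_real_derivative - d - m * 1) (at x)"
          unfolding G_def by (intro DERIV_diff DERIV_minus d(1) DERIV_cmult DERIV_ident)
        moreover have "- d - m * 1 \<le> 0"
          using d(2) le[of x] x a by simp
        ultimately show "\<exists>A D. (A has_real_derivative D) (at x) \<and> D \<le> 0 \<and>
            (\<forall>\<epsilon>>0. \<forall>\<^sub>F t in nhds x. \<bar>G t - A t\<bar> \<le> \<epsilon> * norm (h t - h x))"
          by (intro exI[of _ G] exI[of _ "- d - m * 1"]) simp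
      qed
    qed
  qed
  have "G r \<le> G s"
  proof (cases "s = r")
    case False
    then have "s < r"
      using sr by simp
    have "(h \<longlongrightarrow> h s) (at s within {0..})"
      using h_continuous sr(1) by (simp add: continuous_on)
    then have "(h \<longlongrightarrow> h s) (at_right s)"
      by (rule tendsto_within_subset) (use sr(1) in auto)
    then have "(G \<longlongrightarrow> G s) (at_right s)"
      unfolding G_def by (intro tendsto_intros)
    moreover have "\<forall>\<^sub>F a in at_right s. G r \<le> G a"
      unfolding eventually_at_right[OF \<open>s < r\<close>] using mono sr \<open>s < r\<close> by (intro exI[of _ r]) auto
    ultimately show ?thesis
      by (intro tendsto_lowerbound) auto
  qed simp
  then show ?thesis
    by (simp add: G_def inner_diff_left algebra_simps)
qed

lemma inner_h_diff_le:
  assumes sr: "0 \<le> s" "s \<le> r"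
    and le: "\<And>\<tau>. s \<le> \<tau> \<Longrightarrow> \<tau> \<le> r \<Longrightarrow> inner (grad \<tau>) \<eta> \<le> m"
  shows "inner (h s - h r) \<eta> \<le> (r - s) * m"
proof (rule field_le_epsilon)
  fix e :: real assume "e > 0"
  define \<delta> where "\<delta> = e / (2 * M * (r - s) + 1)"
  have den: "2 * M * (r - s) + 1 > 0"
    using M_nonneg sr by (simp add: add_nonneg_pos)
  have "\<delta> > 0"
    using \<open>e > 0\<close> den by (simp add: \<delta>_def)
  obtain \<zeta> where \<zeta>: "\<zeta> \<in> Linf" "norm (inv_dxx \<zeta> - \<eta>) < \<delta>"
    using inv_dxx_Linf_dense[OF \<open>\<delta> > 0\<close>] by blast
  have "inner (h s - h r) (inv_dxx \<zeta>) \<le> (r - s) * (m + M * \<delta>)"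
  proof (rule inner_h_diff_le_regular[OF \<zeta>(1) sr])
    fix \<tau> assume \<tau>: "s \<le> \<tau>" "\<tau> \<le> r"
    have "inner (grad \<tau>) (inv_dxx \<zeta> - \<eta>) \<le> norm (grad \<tau>) * norm (inv_dxx \<zeta> - \<eta>)"
      by (rule norm_cauchy_schwarz)
    also have "\<dots> \<le> M * \<delta>"
      using \<tau> sr \<zeta>(2) M_nonneg by (intro mult_mono grad_le_M) auto
    finally show "inner (grad \<tau>) (inv_dxx \<zeta>) \<le> m + M * \<delta>"
      using le[OF \<tau>] by (simp add: inner_diff_right)
  qed
  moreover have "inner (h s - h r) (\<eta> - inv_dxx \<zeta>) \<le> M * (r - s) * \<delta>"
  proof -
    have "inner (h s - h r) (\<eta> - inv_dxx \<zeta>) \<le> norm (h s - h r) * norm (\<eta> - inv_dxx \<zeta>)"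
      by (rule norm_cauchy_schwarz)
    also have "\<dots> \<le> M * (r - s) * \<delta>"
      using h_lipschitz[of s r] sr \<zeta>(2) M_nonneg by (intro mult_mono) (auto simp: norm_minus_commute)
    finally show ?thesis .
  qed
  ultimately have "inner (h s - h r) \<eta> \<le> (r - s) * m + (2 * M * (r - s)) * \<delta>"
    by (simp add: inner_diff_right algebra_simps)
  also have "(2 * M * (r - s)) * \<delta> \<le> (2 * M * (r - s) + 1) * \<delta>"
    using \<open>\<delta> > 0\<close> by (intro mult_right_mono) auto
  also have "\<dots> = e"
    using den by (simp add: \<delta>_def)
  finally show "inner (h s - h r) \<eta> \<le> (r - s) * m + e"
    by simp
qed

lemma h_diff_approx:
  assumes sr: "0 \<le> s" "s \<le> r"
    and le: "\<And>\<tau>. s \<le> \<tau> \<Longrightarrow> \<tau> \<le> r \<Longrightarrow> norm (grad \<tau> - v) \<le> e"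
  shows "norm (h s - h r - (r - s) *\<^sub>R v) \<le> (r - s) * e"
proof -
  define \<eta> where "\<eta> = h s - h r - (r - s) *\<^sub>R v"
  have "e \<ge> 0"
    using le[OF order_refl sr(2)] norm_ge_zero order_trans by blast
  have "inner (h s - h r) \<eta> \<le> (r - s) * (inner v \<eta> + e * norm \<eta>)"
  proof (rule inner_h_diff_le[OF sr])
    fix \<tau> assume \<tau>: "s \<le> \<tau>" "\<tau> \<le> r"
    have "inner (grad \<tau> - v) \<eta> \<le> norm (grad \<tau> - v) * norm \<eta>"
      by (rule norm_cauchy_schwarz)
    also have "\<dots> \<le> e * norm \<eta>"
      using le[OF \<tau>] by (intro mult_right_mono) auto
    finally show "inner (grad \<tau>) \<eta> \<le> inner v \<eta> + e * norm \<eta>"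
      by (simp add: inner_diff_left)
  qed
  then have "inner \<eta> \<eta> \<le> ((r - s) * e) * norm \<eta>"
    by (subst (1) \<eta>_def) (simp add: inner_diff_left algebra_simps)
  then have "norm \<eta> * norm \<eta> \<le> ((r - s) * e) * norm \<eta>"
    by (simp add: norm_eq_sqrt_inner)
  then have "norm \<eta> \<le> (r - s) * e"
    using sr \<open>e \<ge> 0\<close> by (cases "norm \<eta> = 0") (auto simp: mult_le_cancel_right)
  then show ?thesis
    by (simp add: \<eta>_def)
qed

definition energy :: "real \<Rightarrow> real" where
  "energy t = cosh_integral (w t)"

lemma energy_diff_le:
  assumes "0 \<le> s" "0 \<le> r"
  shows "energy s - energy r \<le> inner (grad s) (h s - h r)"
proof -
  have phi: "\<phi> (h t) = ereal (energy t)" if "0 \<le> t" for t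
    unfolding w(1)[OF that] energy_def by (rule phi_inv_dxx_integrable[OF dual_pair_cosh_integrable[OF w(2)[OF that]]])
  have "\<phi> (h s) + ereal (inner (grad s) (h r - h s)) \<le> \<phi> (h r)"
    using grad_subdiff[OF assms(1)] by (simp add: subdiff_def)
  then have "energy s + inner (grad s) (h r - h s) \<le> energy r"
    by (simp add: phi assms)
  then show ?thesis
    by (simp add: inner_diff_right)
qed

lemma energy_lipschitz:
  assumes "0 \<le> s" "0 \<le> r"
  shows "\<bar>energy s - energy r\<bar> \<le> M * M * \<bar>s - r\<bar>"
proof -
  have *: "energy s - energy r \<le> M * M * \<bar>s - r\<bar>" if "0 \<le> s" "0 \<le> r" for s r
  proof -
    have "energy s - energy r \<le> inner (grad s) (h s - h r)"
      by (rule energy_diff_le[OF that])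
    also have "\<dots> \<le> norm (grad s) * norm (h s - h r)"
      by (rule norm_cauchy_schwarz)
    also have "\<dots> \<le> M * (M * \<bar>s - r\<bar>)"
      using that M_nonneg by (intro mult_mono grad_le_M h_lipschitz) auto
    finally show ?thesis
      by (simp add: mult.assoc)
  qed
  show ?thesis
    using *[OF assms] *[OF assms(2,1)] by (simp add: abs_minus_commute abs_le_iff)
qed

lemma energy_continuous: "continuous_on {0..} energy"
proof -
  have "(M * M)-lipschitz_on {0..} energy"
    using energy_lipschitz M_nonneg by (intro lipschitz_onI) (auto simp: dist_real_def)
  then show ?thesis
    by (rule lipschitz_on_continuous_on)
qed

lemma energy_dissipation:
  assumes sr: "0 \<le> s" "s \<le> r"
  shows "(r - s) * (norm (grad r))\<^sup>2 \<le> energy s - energy r"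
proof -
  define f where "f = (norm (grad r))\<^sup>2"
  define g where "g x = energy x + x * f" for x
  have "g r \<le> g s"
  proof (rule dini_nonincreasing[OF sr(2)])
    show "continuous_on {s..r} g"
      unfolding g_def using sr by (intro continuous_intros continuous_on_subset[OF energy_continuous]) auto
    fix x e :: real assume x: "s \<le> x" "x < r" and "0 < e"
    then have x0: "0 \<le> x"
      using sr by simp
    define \<delta> where "\<delta> = e / (2 * M + 1)"
    have "\<delta> > 0" and \<delta>: "2 * M * \<delta> \<le> e"
    proof -
      show "\<delta> > 0"
        using \<open>0 < e\<close> M_nonneg by (simp add: \<delta>_def)
      then have "2 * M * \<delta> \<le> (2 * M + 1) * \<delta>"
        by (intro mult_right_mono) auto
      then show "2 * M * \<delta> \<le> e"
        using M_nonneg by (simp add: \<delta>_def)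
    qed
    have "\<forall>\<^sub>F y in at_right x. dist (grad y) (grad x) < \<delta>"
      using grad_right_continuous[OF x0] \<open>\<delta> > 0\<close> by (rule tendstoD)
    then obtain b where b: "b > x" "\<And>y. x < y \<Longrightarrow> y < b \<Longrightarrow> norm (grad y - grad x) < \<delta>"
      unfolding eventually_at_right[OF x(2)] by (auto simp: dist_norm)
    have "g y - g x \<le> e * (y - x)" if y: "x < y" "y < min b r" for y
    proof -
      have y0: "0 \<le> y"
        using x0 y by simp
      have "norm (grad \<tau> - grad x) \<le> \<delta>" if "x \<le> \<tau>" "\<tau> \<le> y" for \<tau>
        using b(2)[of \<tau>] that y \<open>\<delta> > 0\<close> by (cases "\<tau> = x") auto
      then have A: "norm (h x - h y - (y - x) *\<^sub>R grad x) \<le> (y - x) * \<delta>"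
        using y x0 by (intro h_diff_approx) auto
      have "inner (grad y) (grad x - grad y) \<ge> - (M * \<delta>)"
      proof -
        have "\<bar>inner (grad y) (grad x - grad y)\<bar> \<le> norm (grad y) * norm (grad x - grad y)"
          by (rule Cauchy_Schwarz_ineq2)
        also have "\<dots> \<le> M * \<delta>"
          using b(2)[of y] y y0 M_nonneg by (intro mult_mono grad_le_M) (auto simp: norm_minus_commute)
        finally show ?thesis
          by linarith
      qed
      then have "inner (grad y) (grad x) \<ge> (norm (grad y))\<^sup>2 - M * \<delta>"
        by (simp add: inner_diff_right power2_norm_eq_inner)
      moreover have "f \<le> (norm (grad y))\<^sup>2"
        unfolding f_def using y y0 by (intro power_mono grad_mono) auto
      ultimately have B: "(y - x) * (f - M * \<delta>) \<le> (y - x) * inner (grad y) (grad x)"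
        using y by (intro mult_left_mono) auto
      have C: "\<bar>inner (grad y) (h x - h y - (y - x) *\<^sub>R grad x)\<bar> \<le> M * ((y - x) * \<delta>)"
        using A y0 M_nonneg by (intro order_trans[OF Cauchy_Schwarz_ineq2] mult_mono grad_le_M) auto
      have "energy y - energy x \<le> inner (grad y) (h y - h x)"
        by (rule energy_diff_le[OF y0 x0])
      also have "\<dots> = - inner (grad y) (h x - h y - (y - x) *\<^sub>R grad x) - (y - x) * inner (grad y) (grad x)"
        by (simp add: inner_diff_right)
      also have "\<dots> \<le> M * ((y - x) * \<delta>) - (y - x) * (f - M * \<delta>)"
        using B C by linarith
      also have "\<dots> = (y - x) * (2 * M * \<delta>) - (y - x) * f"
        by (simp add: algebra_simps)
      also have "\<dots> \<le> (y - x) * e - (y - x) * f"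
        using \<delta> y by (intro diff_right_mono mult_left_mono) auto
      finally show ?thesis
        by (simp add: g_def algebra_simps)
    qed
    then show "\<forall>\<^sub>F y in at_right x. g y - g x \<le> e * (y - x)"
      unfolding eventually_at_right[OF x(2)] using b(1) x(2) by (intro exI[of _ "min b r"]) auto
  qed
  then show ?thesis
    by (simp add: g_def f_def algebra_simps)
qed

lemma inner_chord_lower:
  assumes "0 \<le> s" "s < r" "r \<le> t" and F: "\<And>\<tau>. 0 \<le> \<tau> \<Longrightarrow> \<tau> < t \<Longrightarrow> F \<le> (norm (grad \<tau>))\<^sup>2"
  shows "(r - s) * F \<le> inner (grad s) (h s - h r)"
proof -
  have *: "(q - s) * F \<le> inner (grad s) (h s - h q)" if q: "s \<le> q" "q < t" for q
  proof -
    have "(q - s) * F \<le> (q - s) * (norm (grad q))\<^sup>2"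
      using q assms(1) by (intro mult_left_mono F) auto
    also have "\<dots> \<le> energy s - energy q"
      using q assms(1) by (intro energy_dissipation) auto
    also have "\<dots> \<le> inner (grad s) (h s - h q)"
      using q assms(1) by (intro energy_diff_le) auto
    finally show ?thesis .
  qed
  show ?thesis
  proof (cases "r < t")
    case True
    then show ?thesis
      using * assms by simp
  next
    case False
    then have "r = t" "s < t"
      using assms by auto
    have "(h \<longlongrightarrow> h t) (at t within {0..})"
      using h_continuous assms by (simp add: continuous_on)
    then have ht: "(h \<longlongrightarrow> h t) (at t within {0..<t})"
      by (rule tendsto_within_subset) auto
    then have "(h \<longlongrightarrow> h t) (at_left t)"
      using assms by (simp add: at_left_eq_within)
    then have "((\<lambda>q. inner (grad s) (h s - h q)) \<longlongrightarrow> inner (grad s) (h s - h t)) (at_left t)"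
      by (intro tendsto_intros)
    moreover have "((\<lambda>q. (q - s) * F) \<longlongrightarrow> (t - s) * F) (at_left t)"
      by (intro tendsto_intros)
    moreover have "\<forall>\<^sub>F q in at_left t. (q - s) * F \<le> inner (grad s) (h s - h q)"
      unfolding eventually_at_left[OF \<open>s < t\<close>] using * \<open>s < t\<close> by (intro exI[of _ s]) auto
    ultimately show ?thesis
      unfolding \<open>r = t\<close> by (intro tendsto_le[of "at_left t"]) auto
  qed
qed

lemma h_chord:
  assumes "0 \<le> s" "s < r" "r \<le> t" and F: "\<And>\<tau>. 0 \<le> \<tau> \<Longrightarrow> \<tau> < t \<Longrightarrow> F \<le> (norm (grad \<tau>))\<^sup>2"
    and e: "(norm (grad s))\<^sup>2 \<le> F + e\<^sup>2 / 2" "0 \<le> e"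
  shows "norm (h s - h r - (r - s) *\<^sub>R grad s) \<le> (r - s) * e"
proof (rule power2_le_imp_le)
  define f where "f = (norm (grad s))\<^sup>2"
  have "norm (h s - h r) \<le> (r - s) * norm (grad s)"
    using assms by (intro h_speed) auto
  then have "(norm (h s - h r))\<^sup>2 \<le> ((r - s) * norm (grad s))\<^sup>2"
    by (intro power_mono) auto
  then have 1: "(norm (h s - h r))\<^sup>2 \<le> (r - s)\<^sup>2 * f"
    by (simp add: power_mult_distrib f_def)
  have "(r - s) * F \<le> inner (grad s) (h s - h r)"
    using assms(1-3) F by (rule inner_chord_lower)
  then have "(r - s) * ((r - s) * F) \<le> (r - s) * inner (grad s) (h s - h r)"
    using assms(2) by (intro mult_left_mono) auto
  then have 2: "(r - s)\<^sup>2 * F \<le> (r - s) * inner (grad s) (h s - h r)"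
    by (simp add: power2_eq_square mult.assoc)
  have "(norm (h s - h r - (r - s) *\<^sub>R grad s))\<^sup>2 =
     (norm (h s - h r))\<^sup>2 + (r - s)\<^sup>2 * f - 2 * ((r - s) * inner (grad s) (h s - h r))"
    unfolding norm_diff_sq[of "h s - h r"] by (simp add: f_def power_mult_distrib inner_commute)
  also have "\<dots> \<le> (r - s)\<^sup>2 * f + (r - s)\<^sup>2 * f - 2 * ((r - s)\<^sup>2 * F)"
    using 1 2 by linarith
  also have "\<dots> = (r - s)\<^sup>2 * (2 * f - 2 * F)"
    by (simp add: algebra_simps)
  also have "\<dots> \<le> (r - s)\<^sup>2 * e\<^sup>2"
    using e(1) by (intro mult_left_mono) (auto simp: f_def)
  also have "\<dots> = ((r - s) * e)\<^sup>2"
    by (simp add: power_mult_distrib)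
  finally show "(norm (h s - h r - (r - s) *\<^sub>R grad s))\<^sup>2 \<le> ((r - s) * e)\<^sup>2" .
qed (use assms in simp)

text \<open>
  Here \<open>F\<close> is a lower bound for the left limit of \<open>\<parallel>grad\<parallel>\<^sup>2\<close> at \<open>t\<close>, and \<open>e\<close> measures how close
  \<open>s\<close> is to \<open>t\<close>. Comparing the chords from \<open>s\<close> and from \<open>t - (t - s) / 4\<close> to \<open>t\<close> shows that \<open>grad\<close>
  hardly changes in between; monotonicity turns this into a bound for the increment of \<open>w\<close>, and
  the bounds for the points \<open>t - (t - s) / 4 ^ k\<close> sum up geometrically.
\<close>

lemma w_left_estimate:
  assumes st: "0 \<le> s" "s < t" and F: "\<And>\<tau>. 0 \<le> \<tau> \<Longrightarrow> \<tau> < t \<Longrightarrow> F \<le> (norm (grad \<tau>))\<^sup>2"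
    and e: "(norm (grad s))\<^sup>2 \<le> F + e\<^sup>2 / 2" "0 \<le> e"
  shows "(norm (w s - w t))\<^sup>2 \<le> 32 * M * e * (t - s)"
proof -
  define q where "q = sqrt (8 * M * e)"
  have "q \<ge> 0"
    using M_nonneg e(2) by (simp add: q_def)
  have e': "(norm (grad s'))\<^sup>2 \<le> F + e\<^sup>2 / 2" if "s \<le> s'" for s'
    using power_mono[OF grad_mono[OF st(1) that] norm_ge_zero, of 2] e(1) by linarith
  have step: "norm (w s' - w (t - (t - s') / 4)) \<le> q * sqrt (t - s')" if s': "s \<le> s'" "s' < t" for s'
  proof -
    define r where "r = t - (t - s') / 4"
    have r: "0 \<le> s'" "s' < r" "r < t" "t - r = (t - s') / 4"
      using s' st by (auto simp: r_def field_simps)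
    have A: "norm (h s' - h t - (t - s') *\<^sub>R grad s') \<le> (t - s') * e"
      using r s' F e'[OF s'(1)] e(2) by (intro h_chord) auto
    have B: "norm (h s' - h r - (r - s') *\<^sub>R grad s') \<le> (r - s') * e"
      using r s' F e'[OF s'(1)] e(2) by (intro h_chord[of _ _ t]) auto
    have C: "norm (h r - h t - (t - r) *\<^sub>R grad r) \<le> (t - r) * e"
      using r s' F e'[of r] e(2) by (intro h_chord) auto
    have eq: "(t - r) *\<^sub>R (grad r - grad s') = (h s' - h t - (t - s') *\<^sub>R grad s')
        - (h s' - h r - (r - s') *\<^sub>R grad s') - (h r - h t - (t - r) *\<^sub>R grad r)"
      by (simp add: algebra_simps)
    have "norm ((t - r) *\<^sub>R (grad r - grad s')) \<le> (t - s') * e + (r - s') * e + (t - r) * e"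
      unfolding eq using A B C norm_triangle_ineq4[of "(h s' - h t - (t - s') *\<^sub>R grad s') - (h s' - h r - (r - s') *\<^sub>R grad s')"
          "h r - h t - (t - r) *\<^sub>R grad r"]
        norm_triangle_ineq4[of "h s' - h t - (t - s') *\<^sub>R grad s'" "h s' - h r - (r - s') *\<^sub>R grad s'"]
      by linarith
    also have "\<dots> = 8 * (t - r) * e"
    proof -
      have ts: "t - s' = 4 * (t - r)"
        using r(4) by simp
      have rs: "r - s' = 3 * (t - r)"
        using ts by simp
      show ?thesis
        unfolding ts rs by (simp add: algebra_simps)
    qed
    finally have "norm ((t - r) *\<^sub>R (grad r - grad s')) \<le> (t - r) * (8 * e)"
      by (simp only: mult_ac)
    moreover have "norm ((t - r) *\<^sub>R (grad r - grad s')) = (t - r) * norm (grad r - grad s')"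
      using r(3) by simp
    ultimately have "(t - r) * norm (grad r - grad s') \<le> (t - r) * (8 * e)"
      by (simp only:)
    then have g: "norm (grad s' - grad r) \<le> 8 * e"
      using r by (simp add: norm_minus_commute)
    have "(norm (w s' - w r))\<^sup>2 \<le> norm (grad s' - grad r) * norm (h s' - h r)"
      using r by (intro w_diff_le) auto
    also have "\<dots> \<le> (8 * e) * (M * (t - s'))"
    proof (rule mult_mono[OF g])
      have "norm (h s' - h r) \<le> M * \<bar>s' - r\<bar>"
        using r by (intro h_lipschitz) auto
      also have "\<dots> \<le> M * (t - s')"
        using r M_nonneg by (intro mult_left_mono) auto
      finally show "norm (h s' - h r) \<le> M * (t - s')" .
    qed (use e(2) in auto)
    also have "\<dots> = (q * sqrt (t - s'))\<^sup>2"
      using s' M_nonneg e(2) by (simp add: q_def power_mult_distrib)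
    finally show ?thesis
      unfolding r_def[symmetric] by (rule power2_le_imp_le) (use \<open>q \<ge> 0\<close> s' in simp)
  qed
  have iter: "norm (w s' - w t) \<le> sqrt (t - s') * (2 * M / 2 ^ k + 2 * q)" if "s \<le> s'" "s' < t" for k s'
    using that
  proof (induction k arbitrary: s')
    case 0
    have "norm (w s' - w t) \<le> 2 * M * sqrt \<bar>s' - t\<bar>"
      using 0 st by (intro w_hoelder) auto
    also have "\<dots> \<le> sqrt (t - s') * (2 * M + 2 * q)"
      using 0 \<open>q \<ge> 0\<close> by (simp add: distrib_left mult.commute)
    finally show ?case
      by simp
  next
    case (Suc k)
    define r where "r = t - (t - s') / 4"
    have r: "s \<le> r" "r < t" "t - r = (t - s') / 4"
      using Suc.prems by (auto simp: r_def field_simps)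
    have sq: "sqrt (t - r) = sqrt (t - s') / 2"
      unfolding r(3) by (simp add: real_sqrt_divide)
    have "norm (w s' - w t) \<le> norm (w s' - w r) + norm (w r - w t)"
      using norm_triangle_ineq[of "w s' - w r" "w r - w t"] by simp
    also have "\<dots> \<le> q * sqrt (t - s') + sqrt (t - r) * (2 * M / 2 ^ k + 2 * q)"
      using step[OF Suc.prems] Suc.IH[OF r(1,2)] by (intro add_mono) (auto simp: r_def)
    also have "\<dots> = sqrt (t - s') * (2 * M / 2 ^ Suc k + 2 * q)"
      unfolding sq by (simp add: field_simps)
    finally show ?case .
  qed
  have "norm (w s - w t) \<le> sqrt (t - s) * (0 + 2 * q)"
  proof (rule tendsto_lowerbound)
    have "(\<lambda>k. 2 * M * (1 / 2) ^ k) \<longlonglongrightarrow> 2 * M * 0"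
      by (intro tendsto_intros LIMSEQ_power_zero) simp
    then have "(\<lambda>k. 2 * M / 2 ^ k) \<longlonglongrightarrow> 0"
      by (simp add: power_one_over)
    then show "(\<lambda>k. sqrt (t - s) * (2 * M / 2 ^ k + 2 * q)) \<longlonglongrightarrow> sqrt (t - s) * (0 + 2 * q)"
      by (intro tendsto_intros)
    show "\<forall>\<^sub>F k in sequentially. norm (w s - w t) \<le> sqrt (t - s) * (2 * M / 2 ^ k + 2 * q)"
      using iter[OF order_refl st(2)] by simp
  qed simp
  then have "(norm (w s - w t))\<^sup>2 \<le> (sqrt (t - s) * (0 + 2 * q))\<^sup>2"
    by (intro power_mono) auto
  also have "\<dots> = 32 * M * e * (t - s)"
    using st M_nonneg e(2) by (simp add: q_def power_mult_distrib)
  finally show ?thesis .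
qed

lemma grad_left_estimate:
  assumes st: "0 \<le> s" "s < t" and F: "\<And>\<tau>. 0 \<le> \<tau> \<Longrightarrow> \<tau> < t \<Longrightarrow> F \<le> (norm (grad \<tau>))\<^sup>2"
    and e: "(norm (grad s))\<^sup>2 \<le> F + e\<^sup>2 / 2" "0 \<le> e"
  shows "F \<le> inner (grad s) (grad t) + (32 * cosh (8 * M) * M + M) * e"
proof -
  have t: "0 \<le> t"
    using st by simp
  have "inner (grad s - grad t) (h s - h t) \<le> cosh (8 * M) * norm (w s - w t) * norm (w s - w t)"
    using dual_pair_lipschitz[OF w(2)[OF st(1)] grad_le_M[OF st(1)] w(2)[OF t] grad_le_M[OF t], of "w s - w t"]
    by (simp add: w(1)[OF st(1)] w(1)[OF t] linear_diff[OF linear_inv_dxx])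
  also have "\<dots> = cosh (8 * M) * (norm (w s - w t))\<^sup>2"
    by (simp add: power2_eq_square)
  also have "\<dots> \<le> cosh (8 * M) * (32 * M * e * (t - s))"
    by (intro mult_left_mono w_left_estimate[OF st F e]) auto
  finally have 1: "inner (grad s - grad t) (h s - h t) \<le> (t - s) * (32 * cosh (8 * M) * M * e)"
    by (simp only: mult_ac)
  have "inner (grad t) (h s - h t - (t - s) *\<^sub>R grad s) \<le> norm (grad t) * norm (h s - h t - (t - s) *\<^sub>R grad s)"
    by (rule norm_cauchy_schwarz)
  also have "\<dots> \<le> M * ((t - s) * e)"
    using st t F e M_nonneg by (intro mult_mono grad_le_M h_chord) auto
  finally have 2: "inner (grad t) (h s - h t) \<le> (t - s) * inner (grad s) (grad t) + (t - s) * (M * e)"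
    by (simp add: inner_diff_right inner_commute mult_ac)
  have "(t - s) * F \<le> inner (grad s) (h s - h t)"
    using st F by (intro inner_chord_lower) auto
  also have "\<dots> \<le> (t - s) * (32 * cosh (8 * M) * M * e) + ((t - s) * inner (grad s) (grad t) + (t - s) * (M * e))"
    using 1 2 by (simp add: inner_diff_left)
  also have "\<dots> = (t - s) * (inner (grad s) (grad t) + (32 * cosh (8 * M) * M + M) * e)"
    by (simp add: algebra_simps)
  finally show ?thesis
    using st by simp
qed

lemma grad_left_continuous:
  assumes "0 < t"
  shows "(grad \<longlongrightarrow> grad t) (at_left t)"
proof -
  define F where "F = Inf ((\<lambda>\<tau>. (norm (grad \<tau>))\<^sup>2) ` {0..<t})"
  have bb: "bdd_below ((\<lambda>\<tau>. (norm (grad \<tau>))\<^sup>2) ` {0..<t})"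
    by (intro bdd_belowI2[of _ 0]) simp
  have F_le: "F \<le> (norm (grad \<tau>))\<^sup>2" if "0 \<le> \<tau>" "\<tau> < t" for \<tau>
    unfolding F_def using bb that by (intro cInf_lower) auto
  have F_near: "\<forall>\<^sub>F s in at_left t. 0 \<le> s \<and> s < t \<and> (norm (grad s))\<^sup>2 \<le> F + \<epsilon>" if "\<epsilon> > 0" for \<epsilon>
  proof -
    have "F < F + \<epsilon>"
      using that by simp
    then obtain s0 where s0: "0 \<le> s0" "s0 < t" "(norm (grad s0))\<^sup>2 < F + \<epsilon>"
      unfolding F_def using \<open>0 < t\<close> cInf_lessD[of "(\<lambda>\<tau>. (norm (grad \<tau>))\<^sup>2) ` {0..<t}"] by fastforce
    have "(norm (grad s))\<^sup>2 \<le> F + \<epsilon>" if "s0 < s" for s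
      using power_mono[OF grad_mono[OF s0(1) less_imp_le[OF that]] norm_ge_zero, of 2] s0(3) by linarith
    then show ?thesis
      unfolding eventually_at_left[OF s0(2)] using s0 by (intro exI[of _ s0]) auto
  qed
  have weak: "((\<lambda>s. inner (grad s) (grad t)) \<longlongrightarrow> inner (grad t) (grad t)) (at_left t)"
    unfolding at_left_eq_within[OF assms] using grad_weak_continuous[of t "grad t"] assms
    by (intro tendsto_within_subset[of _ _ _ "{0..}" "{0..<t}"]) auto
  define C where "C = 32 * cosh (8 * M) * M + M"
  have "C \<ge> 0"
    using M_nonneg by (simp add: C_def)
  have F_bound: "F \<le> inner (grad t) (grad t) + C * e" if "e > 0" for e
  proof (rule tendsto_lowerbound)
    show "((\<lambda>s. inner (grad s) (grad t) + C * e) \<longlongrightarrow> inner (grad t) (grad t) + C * e) (at_left t)"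
      by (intro tendsto_add weak tendsto_const)
    have "0 < e\<^sup>2 / 2"
      using that by simp
    from F_near[OF this] show "\<forall>\<^sub>F s in at_left t. F \<le> inner (grad s) (grad t) + C * e"
    proof eventually_elim
      case (elim s)
      then show ?case
        unfolding C_def using F_le that by (intro grad_left_estimate) auto
    qed
  qed simp
  have F_grad: "F \<le> (norm (grad t))\<^sup>2"
  proof (rule field_le_epsilon)
    fix \<epsilon> :: real assume "\<epsilon> > 0"
    have "F \<le> inner (grad t) (grad t) + C * (\<epsilon> / (C + 1))"
      using \<open>\<epsilon> > 0\<close> \<open>C \<ge> 0\<close> by (intro F_bound) simp
    also have "C * (\<epsilon> / (C + 1)) \<le> \<epsilon>"
      using \<open>\<epsilon> > 0\<close> \<open>C \<ge> 0\<close> by (simp add: field_simps)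
    finally show "F \<le> (norm (grad t))\<^sup>2 + \<epsilon>"
      by (simp add: power2_norm_eq_inner)
  qed
  have norm_lim: "((\<lambda>s. (norm (grad s))\<^sup>2) \<longlongrightarrow> (norm (grad t))\<^sup>2) (at_left t)"
  proof (rule tendstoI)
    fix \<epsilon> :: real assume "\<epsilon> > 0"
    then have "\<epsilon> / 2 > 0"
      by simp
    from F_near[OF this] show "\<forall>\<^sub>F s in at_left t. dist ((norm (grad s))\<^sup>2) ((norm (grad t))\<^sup>2) < \<epsilon>"
    proof eventually_elim
      case (elim s)
      have "(norm (grad t))\<^sup>2 \<le> (norm (grad s))\<^sup>2"
        using elim by (intro power_mono grad_mono) auto
      then show ?case
        using elim F_grad \<open>\<epsilon> > 0\<close> by (simp add: dist_real_def)
    qed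
  qed
  have "((\<lambda>s. (norm (grad s))\<^sup>2 + (norm (grad t))\<^sup>2 - 2 * inner (grad s) (grad t)) \<longlongrightarrow>
      (norm (grad t))\<^sup>2 + (norm (grad t))\<^sup>2 - 2 * inner (grad t) (grad t)) (at_left t)"
    by (intro tendsto_add tendsto_diff tendsto_mult tendsto_const norm_lim weak)
  then have "((\<lambda>s. (norm (grad s))\<^sup>2 + (norm (grad t))\<^sup>2 - 2 * inner (grad s) (grad t)) \<longlongrightarrow> 0) (at_left t)"
    by (simp add: power2_norm_eq_inner)
  then have "((\<lambda>s. grad s - grad t) \<longlongrightarrow> 0) (at_left t)"
    by (rule tendsto_zero_if_sq_le) (simp add: norm_diff_sq)
  then show ?thesis
    by (simp add: LIM_zero_iff)
qed

lemma grad_continuous: "continuous_on {0..} grad"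
  unfolding continuous_on
proof
  fix t :: real assume "t \<in> {0..}"
  then have t: "0 \<le> t"
    by simp
  show "(grad \<longlongrightarrow> grad t) (at t within {0..})"
  proof (cases "t = 0")
    case True
    then show ?thesis
      using grad_right_continuous[OF t] by (simp add: at_within_Ici_at_right)
  next
    case False
    then have "0 < t"
      using t by simp
    have "(grad \<longlongrightarrow> grad t) (at t)"
      using grad_right_continuous[OF t] grad_left_continuous[OF \<open>0 < t\<close>] by (simp add: filterlim_at_split)
    then show ?thesis
      by (rule tendsto_within_subset) simp
  qed
qed

lemma h_has_vector_derivative:
  assumes t: "0 \<le> t"
  shows "(h has_vector_derivative - grad t) (at t within {0..})"
  unfolding has_vector_derivative_def has_derivative_within_alt
proof (intro conjI allI impI)
  show "bounded_linear (\<lambda>x. x *\<^sub>R - grad t)"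
    by (rule bounded_linear_scaleR_left)
  fix e :: real assume "0 < e"
  then obtain d where "d > 0" and d: "\<And>y. y \<in> {0..} \<Longrightarrow> dist y t < d \<Longrightarrow> dist (grad y) (grad t) < e"
    using grad_continuous t unfolding continuous_on_iff by (metis atLeast_iff)
  have "norm (h y - h t - (y - t) *\<^sub>R - grad t) \<le> e * norm (y - t)" if y: "y \<in> {0..}" "norm (y - t) < d" for y
  proof -
    have near: "norm (grad \<tau> - grad t) \<le> e" if "min y t \<le> \<tau>" "\<tau> \<le> max y t" for \<tau>
    proof -
      have "\<tau> \<in> {0..}" "dist \<tau> t < d"
        using that y t by (auto simp: dist_real_def min_def max_def split: if_splits)
      then show ?thesis
        using d[of \<tau>] by (simp add: dist_norm)
    qed
    show ?thesis
    proof (cases "t \<le> y")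
      case True
      have "norm (h t - h y - (y - t) *\<^sub>R grad t) \<le> (y - t) * e"
        using near True t by (intro h_diff_approx) auto
      moreover have "h y - h t - (y - t) *\<^sub>R - grad t = - (h t - h y - (y - t) *\<^sub>R grad t)"
        by simp
      ultimately show ?thesis
        using True by (simp only: norm_minus_cancel) (simp add: mult.commute)
    next
      case False
      have "norm (h y - h t - (t - y) *\<^sub>R grad t) \<le> (t - y) * e"
        using near False y by (intro h_diff_approx) auto
      moreover have "h y - h t - (y - t) *\<^sub>R - grad t = h y - h t - (t - y) *\<^sub>R grad t"
        by (simp add: algebra_simps)
      ultimately show ?thesis
        using False by (simp add: mult.commute)
    qed
  qed
  then show "\<exists>d>0. \<forall>y\<in>{0..}. norm (y - t) < d \<longrightarrow> norm (h y - h t - (y - t) *\<^sub>R - grad t) \<le> e * norm (y - t)"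
    using \<open>d > 0\<close> by blast
qed

lemma norm_h_le:
  assumes "0 \<le> t"
  shows "norm (h t) \<le> norm h0"
proof (rule power2_le_imp_le)
  have "(norm (h t))\<^sup>2 \<le> (norm (h 0))\<^sup>2"
  proof (rule DERIV_nonpos_imp_decreasing_open[OF assms])
    fix x assume x: "0 < x" "x < t"
    then have x0: "0 \<le> x"
      by simp
    have dh: "(h has_vector_derivative - grad x) (at x)"
      using h_has_vector_derivative[OF x0] x(1) at_within_interior[of x "{0..}"] by simp
    have "((\<lambda>s. inner (h s) (h s)) has_vector_derivative inner (h x) (- grad x) + inner (- grad x) (h x)) (at x)"
      by (rule bounded_bilinear.has_vector_derivative[OF bounded_bilinear_inner dh dh])
    then have "((\<lambda>s. (norm (h s))\<^sup>2) has_real_derivative - 2 * inner (grad x) (h x)) (at x)"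
      unfolding power2_norm_eq_inner has_real_derivative_iff_has_vector_derivative
      by (simp add: inner_commute)
    moreover have "0 \<le> inner (grad x) (h x)"
    proof -
      have "0 \<le> (norm (w x - 0))\<^sup>2"
        by simp
      also have "\<dots> \<le> inner (grad x - 0) (inv_dxx (w x) - inv_dxx 0)"
        by (rule dual_pair_monotone[OF w(2)[OF x0] dual_pair_zero])
      finally show ?thesis
        unfolding w(1)[OF x0, symmetric] linear_0[OF linear_inv_dxx] by simp
    qed
    ultimately show "\<exists>y. ((\<lambda>s. (norm (h s))\<^sup>2) has_real_derivative y) (at x) \<and> y \<le> 0"
      by (intro exI[of _ "- 2 * inner (grad x) (h x)"]) simp
  next
    show "continuous_on {0..t} (\<lambda>s. (norm (h s))\<^sup>2)"
      by (intro continuous_intros continuous_on_subset[OF h_continuous]) auto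
  qed
  then show "(norm (h t))\<^sup>2 \<le> (norm h0)\<^sup>2"
    by (simp add: h_0)
qed simp

end

theorem theorem3p6:
  fixes T :: real and h0 :: H and h :: "real \<Rightarrow> H"
  assumes "T > 0"
    and "h0 \<in> subdiff_domain \<phi>" and "\<phi> h0 < \<infinity>"
    and "EVI_curve \<phi> lam h0 h"
  shows "(\<forall>t\<ge>0. h t \<in> subdiff_domain \<phi>
           \<and> subdiff \<phi> (h t) = {subgrad \<phi> (h t)}
           \<and> weak_deriv 2 (\<lambda>x. sinh (dxx (h t) x)) (rep_H (subgrad \<phi> (h t)))
           \<and> (h has_vector_derivative - subgrad \<phi> (h t)) (at t within {0..}))
       \<and> (\<forall>t\<in>{0..T}. h t \<in> subdiff_domain \<phi>)
       \<and> continuous_on {0..T} h \<and> continuous_on {0..T} (\<lambda>t. subgrad \<phi> (h t))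
       \<and> C1_on_interval T h
       \<and> (\<forall>t\<ge>0. norm (h t) \<le> norm h0)
       \<and> (\<forall>t\<ge>0. norm (vector_derivative h (at t within {0..})) = norm (subgrad \<phi> (h t))
           \<and> norm (subgrad \<phi> (h t)) \<le> exp (- lam * t) * norm (subgrad \<phi> h0))"
proof -
  interpret phi_flow h h0
    using assms by unfold_locales
  have grad: "subgrad \<phi> (h t) = grad t" for t
    by (simp add: grad_def)
  have dom: "h t \<in> subdiff_domain \<phi>" if "0 \<le> t" for t
    using grad_subdiff[OF that] by (auto simp: subdiff_domain_def subdiff_def)
  have cont: "continuous_on {0..T} h" "continuous_on {0..T} grad"
    by (auto intro: continuous_on_subset[OF h_continuous] continuous_on_subset[OF grad_continuous])
  have C1: "C1_on_interval T h"
    unfolding C1_on_interval_def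
  proof (intro exI[of _ "\<lambda>t. - grad t"] conjI ballI)
    show "(h has_vector_derivative - grad t) (at t within {0..T})" if "t \<in> {0..T}" for t
      by (rule has_vector_derivative_within_subset[OF h_has_vector_derivative]) (use that in auto)
    show "continuous_on {0..T} (\<lambda>t. - grad t)"
      by (intro continuous_on_minus cont)
  qed
  have deriv: "vector_derivative h (at t within {0..}) = - grad t" if "0 \<le> t" for t
  proof (rule vector_derivative_within[OF _ h_has_vector_derivative[OF that]])
    have "at_right t \<le> at t within {0..}"
      using that by (intro at_le) auto
    then show "at t within {0..} \<noteq> bot"
      using trivial_limit_at_right_real[of t] by (metis bot.extremum_uniqueI)
  qed
  have decay: "norm (grad t) \<le> exp (- lam * t) * norm (subgrad \<phi> h0)" if "0 \<le> t" for t
    using grad_decay[of 0 t] that by (simp add: grad_def h_0)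
  show ?thesis
    unfolding grad
    by (intro conjI allI impI ballI)
      (simp_all add: dom subgrad_phi(2)[OF grad_subdiff] weak_deriv_sinh_dxx[OF grad_subdiff]
        h_has_vector_derivative cont C1 norm_h_le deriv decay[simplified])
qed

end
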